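(* For every fixed odd positive integer $d$, there is a polynomial time algorithm that, given a polynomial $p(x_1,\dots,x_n)$ of degree $d$, decides whether $p$ is pseudoconvex.
   Context: A differentiable function $f:\mathbb{R}^n\to\mathbb{R}$ is pseudoconvex if the implication $\nabla f(x)^T(y-x)\ge 0\Rightarrow f(y)\ge f(x)$ holds for all $x,y\in\mathbb{R}^n$. The input is the ordered list of the polynomial's coefficients, which are integers written in binary (rational coefficients are turned into integers by clearing denominators); the number of variables $n$ is part of the input, and polynomial time means running time bounded by a polynomial in the total number of bits of the input. *)

theory Defs
  imports "HOL-Analysis.Analysis" "HOL-Library.Poly_Mapping" "HOL-Library.Log_Nat"
    "HOL-Computational_Algebra.Polynomial"
begin

section \<open>Pseudoconvex functions\<close>

text \<open>
  The dimension varies within the statement, so points of \<open>\<real>\<^sup>n\<close> are the elements of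
  \<^term>\<open>topspace (Euclidean_space n)\<close>, i.e. the sequences that vanish from index \<open>n\<close> on.
  The coordinates are numbered from 0.
\<close>

definition has_gradient ::
    "nat \<Rightarrow> ((nat \<Rightarrow> real) \<Rightarrow> real) \<Rightarrow> (nat \<Rightarrow> real) \<Rightarrow> (nat \<Rightarrow> real) \<Rightarrow> bool" where
  "has_gradient n f x g \<longleftrightarrow>
     (\<forall>\<epsilon>>0. \<exists>\<delta>>0. \<forall>y \<in> topspace (Euclidean_space n).
        L2_set (\<lambda>i. y i - x i) {..<n} < \<delta> \<longrightarrow>
        \<bar>f y - f x - (\<Sum>i<n. g i * (y i - x i))\<bar> \<le> \<epsilon> * L2_set (\<lambda>i. y i - x i) {..<n})"

text \<open>Gradients are unique (in their first \<open>n\<close> coordinates), so \<open>grad\<close> below is the gradient of \<open>f\<close>.\<close>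

definition pseudoconvex :: "nat \<Rightarrow> ((nat \<Rightarrow> real) \<Rightarrow> real) \<Rightarrow> bool" where
  "pseudoconvex n f \<longleftrightarrow>
     (\<exists>grad. (\<forall>x \<in> topspace (Euclidean_space n). has_gradient n f x (grad x)) \<and>
        (\<forall>x \<in> topspace (Euclidean_space n). \<forall>y \<in> topspace (Euclidean_space n).
           (\<Sum>i<n. grad x i * (y i - x i)) \<ge> 0 \<longrightarrow> f y \<ge> f x))"

section \<open>Polynomials with integer coefficients and their encoding\<close>

text \<open>A monomial maps each variable to its exponent, a polynomial maps each monomial to its coefficient.\<close>

type_synonym monomial = "nat \<Rightarrow>\<^sub>0 nat"
type_synonym int_mpoly = "monomial \<Rightarrow>\<^sub>0 int"

definition monomial_degree :: "monomial \<Rightarrow> nat" where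
  "monomial_degree m = (\<Sum>i \<in> Poly_Mapping.keys m. Poly_Mapping.lookup m i)"

definition total_degree :: "int_mpoly \<Rightarrow> nat" where
  "total_degree p = Max (insert 0 (monomial_degree ` Poly_Mapping.keys p))"

definition variables :: "int_mpoly \<Rightarrow> nat set" where
  "variables p = (\<Union>m \<in> Poly_Mapping.keys p. Poly_Mapping.keys m)"

definition eval_mpoly :: "int_mpoly \<Rightarrow> (nat \<Rightarrow> real) \<Rightarrow> real" where
  "eval_mpoly p x =
     (\<Sum>m \<in> Poly_Mapping.keys p. real_of_int (Poly_Mapping.lookup p m) *
        (\<Prod>i \<in> Poly_Mapping.keys m. x i ^ Poly_Mapping.lookup m i))"

text \<open>All exponent vectors of length \<open>n\<close> with sum at most \<open>d\<close>, in lexicographically increasing order.\<close>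

fun exponent_vectors :: "nat \<Rightarrow> nat \<Rightarrow> nat list list" where
  "exponent_vectors 0 d = [[]]"
| "exponent_vectors (Suc n) d = [k # ks. k \<leftarrow> [0..<Suc d], ks \<leftarrow> exponent_vectors n (d - k)]"

text \<open>
  The number of variables, followed by the list of the coefficients of all monomials of degree
  at most \<open>d\<close> (zero coefficients included).
\<close>

definition encode :: "nat \<Rightarrow> nat \<Rightarrow> int_mpoly \<Rightarrow> int list" where
  "encode d n p =
     int n # map (\<lambda>ks. Poly_Mapping.lookup p (Poly_Mapping.nth ks)) (exponent_vectors n d)"

section \<open>Polynomial time\<close>

text \<open>
  The machine model is the random access machine of Aho, Hopcroft and Ullman under the
  logarithmic cost criterion, which is polynomially equivalent to Turing machines: every
  instruction is charged the number of bits of all the numbers and addresses it handles. In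
  particular a multiplication costs at least as much as its result has bits, up to a constant.
  There is no division instruction. Register 0 is the accumulator.
\<close>

text \<open>One sign bit and the binary digits of the absolute value.\<close>

definition bits :: "int \<Rightarrow> nat" where
  "bits k = Suc (floorlog 2 (nat \<bar>k\<bar>))"

type_synonym registers = "nat \<Rightarrow> int"

datatype location = Reg nat | Ind nat
datatype operand = Lit int | Loc location

datatype instruction =
  Load operand | Store location | Add operand | Sub operand | Mult operand
| Read location | Jump nat | Jump_Pos nat | Jump_Zero nat | Accept | Reject

type_synonym program = "instruction list"

text \<open>An indirect access through a negative number refers to register 0.\<close>

fun address :: "registers \<Rightarrow> location \<Rightarrow> nat" where
  "address r (Reg i) = i"
| "address r (Ind i) = nat (r i)"

fun address_cost :: "registers \<Rightarrow> location \<Rightarrow> nat" where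
  "address_cost r (Reg i) = bits (int i)"
| "address_cost r (Ind i) = bits (int i) + bits (r i)"

fun operand_value :: "registers \<Rightarrow> operand \<Rightarrow> int" where
  "operand_value r (Lit k) = k"
| "operand_value r (Loc l) = r (address r l)"

fun operand_cost :: "registers \<Rightarrow> operand \<Rightarrow> nat" where
  "operand_cost r (Lit k) = bits k"
| "operand_cost r (Loc l) = address_cost r l + bits (r (address r l))"

text \<open>
  A configuration consists of the program counter, the registers and the unread part of the
  input. The number in the middle of a step is its cost. The machine is stuck, without giving an
  answer, if it leaves the program or reads past the end of the input.
\<close>

type_synonym config = "nat \<times> registers \<times> int list"

definition fetch :: "program \<Rightarrow> nat \<Rightarrow> instruction option" where
  "fetch P pc = (if pc < length P then Some (P ! pc) else None)"

inductive step :: "program \<Rightarrow> config \<Rightarrow> nat \<Rightarrow> config \<Rightarrow> bool" for P where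
  Load: "fetch P pc = Some (Load a) \<Longrightarrow>
    step P (pc, r, xs) (operand_cost r a) (Suc pc, r(0 := operand_value r a), xs)"
| Store: "fetch P pc = Some (Store l) \<Longrightarrow>
    step P (pc, r, xs) (bits (r 0) + address_cost r l) (Suc pc, r(address r l := r 0), xs)"
| Add: "fetch P pc = Some (Add a) \<Longrightarrow>
    step P (pc, r, xs) (bits (r 0) + operand_cost r a) (Suc pc, r(0 := r 0 + operand_value r a), xs)"
| Sub: "fetch P pc = Some (Sub a) \<Longrightarrow>
    step P (pc, r, xs) (bits (r 0) + operand_cost r a) (Suc pc, r(0 := r 0 - operand_value r a), xs)"
| Mult: "fetch P pc = Some (Mult a) \<Longrightarrow>
    step P (pc, r, xs) (bits (r 0) + operand_cost r a) (Suc pc, r(0 := r 0 * operand_value r a), xs)"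
| Read: "fetch P pc = Some (Read l) \<Longrightarrow>
    step P (pc, r, x # xs) (bits x + address_cost r l) (Suc pc, r(address r l := x), xs)"
| Jump: "fetch P pc = Some (Jump t) \<Longrightarrow>
    step P (pc, r, xs) 1 (t, r, xs)"
| Jump_Pos: "fetch P pc = Some (Jump_Pos t) \<Longrightarrow>
    step P (pc, r, xs) (bits (r 0)) (if r 0 > 0 then t else Suc pc, r, xs)"
| Jump_Zero: "fetch P pc = Some (Jump_Zero t) \<Longrightarrow>
    step P (pc, r, xs) (bits (r 0)) (if r 0 = 0 then t else Suc pc, r, xs)"

inductive answers :: "program \<Rightarrow> config \<Rightarrow> bool \<Rightarrow> nat \<Rightarrow> bool" for P where
  accept: "fetch P pc = Some Accept \<Longrightarrow> answers P (pc, r, xs) True 1"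
| reject: "fetch P pc = Some Reject \<Longrightarrow> answers P (pc, r, xs) False 1"
| step: "step P c s c' \<Longrightarrow> answers P c' b t \<Longrightarrow> answers P c b (s + t)"

lemma step_deterministic:
  assumes "step P c s c'" and "step P c t c''"
  shows "s = t \<and> c' = c''"
  using assms by (auto elim!: step.cases split: if_splits)

lemma answers_deterministic:
  assumes "answers P c b t" and "answers P c b' t'"
  shows "b = b' \<and> t = t'"
  using assms
proof (induction arbitrary: b' t')
  case (accept pc r xs)
  from accept.prems accept.hyps show ?case by cases (auto elim: step.cases)
next
  case (reject pc r xs)
  from reject.prems reject.hyps show ?case by cases (auto elim: step.cases)
next
  case (step c s c' b t)
  from step.prems show ?case
  proof cases
    case (step s2 c2 t2)
    with step_deterministic [OF \<open>step P c s c'\<close>] step.IH show ?thesis by blast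
  qed (use \<open>step P c s c'\<close> in \<open>auto elim: step.cases\<close>)
qed

text \<open>
  A program decides \<open>Q\<close> on the instances \<open>X\<close>, encoded by \<open>enc\<close>, in polynomial time if its running
  time is bounded by a polynomial in the total number of bits of the input. Nothing is required of
  inputs that do not encode an instance.
\<close>

definition poly_time_decides :: "program \<Rightarrow> 'a set \<Rightarrow> ('a \<Rightarrow> int list) \<Rightarrow> ('a \<Rightarrow> bool) \<Rightarrow> bool" where
  "poly_time_decides P X enc Q \<longleftrightarrow>
     (\<exists>q :: nat poly. \<forall>x \<in> X. \<exists>t \<le> poly q (\<Sum>k \<leftarrow> enc x. bits k).
        answers P (0, \<lambda>_. 0, enc x) (Q x) t)"

end

theory Submission
  imports Defs
begin

text \<open>
  Let \<open>p\<close> be a polynomial of odd degree \<open>d\<close>. On every line whose direction \<open>v\<close> is not a zero of the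
  leading form of \<open>p\<close>, \<open>p\<close> restricts to a univariate polynomial of the odd degree \<open>d\<close>. If \<open>p\<close> is
  pseudoconvex, then a critical point of this restriction is a minimum of it, but a polynomial of odd
  degree is unbounded below. So the derivative along the line has no zero, and its sign is that of the
  leading form at \<open>v\<close>, wherever the line starts (\<open>directional_derivative_sign\<close>). Such directions are
  dense, hence no direction increases \<open>p\<close> at one point and decreases it at another, and all gradients
  are parallel (\<open>gradients_parallel\<close>). Therefore \<open>p x = h (\<xi> \<bullet> x)\<close> for a vector \<open>\<xi>\<close> and a univariate
  polynomial \<open>h\<close> whose derivative has no real root. Conversely, such a composition is pseudoconvex
  because \<open>h\<close> is strictly monotone.

  In terms of the derivatives \<open>T m = m! p\<^sub>m\<close> of \<open>p\<close> at the origin, this becomes a test without divisions.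
  Some variable \<open>i\<close> must satisfy \<open>T (d e\<^sub>i) \<noteq> 0\<close>, and for any such \<open>i\<close> the polynomial is pseudoconvex if
  and only if \<open>T (m + e\<^sub>j) T (d e\<^sub>i) = T (m + e\<^sub>i) T ((d - 1) e\<^sub>i + e\<^sub>j)\<close> for all \<open>j\<close> and all \<open>m\<close> of degree
  less than \<open>d\<close>, and the derivative of \<open>t \<mapsto> p (t e\<^sub>i)\<close> has no real root (\<open>pseudoconvex_imp_test\<close>,
  \<open>test_imp_pseudoconvex\<close>). For fixed \<open>d\<close> these are polynomially many identities and one condition on
  a univariate polynomial of fixed degree. The latter is settled by a decision tree of fixed size
  (\<open>decidable_no_real_root\<close>): the number of real roots is a Cauchy index, which the Euclidean
  algorithm with pseudo-division expresses by the signs of polynomials in the coefficients.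

  The algorithm is written in a small structured language with expressions, conditionals and loops,
  which is compiled to the random access machine. If all values that a program stores have
  polynomially many bits and it makes polynomially many steps, then the compiled program runs in
  polynomial time (\<open>poly_time_decides_by_com\<close>). The memory is used as a sparse table: the derivative
  \<open>T m\<close> is kept at an address that encodes \<open>m\<close> in a fixed base. These addresses are exponentially large,
  but have only \<open>O(n)\<close> bits, and the neighbours \<open>m + e\<^sub>j\<close> of \<open>m\<close> are found by an addition. A nest of \<open>d\<close>
  loops, each over the variables from a certain one on, produces the monomials in the order of the
  input (\<open>visits_eq\<close>); the same nest, one level less deep, drives the check of the identities.
\<close>

section \<open>A structured language for the random access machine\<close>

datatype arith = Sum | Difference | Product

datatype exp = Num int | Var location | Bin arith exp exp

abbreviation "Plus \<equiv> Bin Sum"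
abbreviation "Minus \<equiv> Bin Difference"
abbreviation "Times \<equiv> Bin Product"

primrec arith_fun :: "arith \<Rightarrow> int \<Rightarrow> int \<Rightarrow> int" where
  "arith_fun Sum = (+)"
| "arith_fun Difference = (-)"
| "arith_fun Product = (*)"

primrec arith_instruction :: "arith \<Rightarrow> operand \<Rightarrow> instruction" where
  "arith_instruction Sum = Add"
| "arith_instruction Difference = Sub"
| "arith_instruction Product = Mult"

primrec ev :: "registers \<Rightarrow> exp \<Rightarrow> int" where
  "ev s (Num k) = k"
| "ev s (Var l) = s (address s l)"
| "ev s (Bin f a b) = arith_fun f (ev s a) (ev s b)"

datatype com = Assign location exp | Get location | Seq com com | Cond exp com com | While exp com

text \<open>
  Variables live in the positive even registers; the odd registers hold intermediate results of
  expressions, and register 0 is the accumulator. Separating the two by parity leaves room for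
  variables at arbitrarily large computed addresses.
\<close>

definition data :: "nat \<Rightarrow> bool" where
  "data i \<longleftrightarrow> even i \<and> i \<noteq> 0"

fun data_loc :: "registers \<Rightarrow> location \<Rightarrow> bool" where
  "data_loc s (Reg i) = data i"
| "data_loc s (Ind i) = (data i \<and> data (nat (s i)))"

primrec data_exp :: "registers \<Rightarrow> exp \<Rightarrow> bool" where
  "data_exp s (Num k) = True"
| "data_exp s (Var l) = data_loc s l"
| "data_exp s (Bin f a b) = (data_exp s a \<and> data_exp s b)"

text \<open>
  The number \<open>X\<close> bounds every value that is stored in a variable. It does not bound the intermediate
  values of expressions, which can be estimated from the shape of the expressions (\<open>ev_bound\<close>). The
  natural number counts assignments, reads and tests.
\<close>

inductive exec :: "int \<Rightarrow> com \<Rightarrow> registers \<times> int list \<Rightarrow> nat \<Rightarrow> registers \<times> int list \<Rightarrow> bool" for X where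
  Assign: "data_exp s e \<Longrightarrow> data_loc s l \<Longrightarrow> \<bar>ev s e\<bar> \<le> X \<Longrightarrow>
    exec X (Assign l e) (s, xs) 1 (s(address s l := ev s e), xs)"
| Get: "data_loc s l \<Longrightarrow> \<bar>x\<bar> \<le> X \<Longrightarrow> exec X (Get l) (s, x # xs) 1 (s(address s l := x), xs)"
| Seq: "exec X c1 \<sigma> k1 \<sigma>' \<Longrightarrow> exec X c2 \<sigma>' k2 \<sigma>'' \<Longrightarrow> exec X (Seq c1 c2) \<sigma> (k1 + k2) \<sigma>''"
| CondT: "data_exp s e \<Longrightarrow> ev s e > 0 \<Longrightarrow> exec X c1 (s, xs) k \<sigma>' \<Longrightarrow>
    exec X (Cond e c1 c2) (s, xs) (k + 1) \<sigma>'"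
| CondF: "data_exp s e \<Longrightarrow> \<not> ev s e > 0 \<Longrightarrow> exec X c2 (s, xs) k \<sigma>' \<Longrightarrow>
    exec X (Cond e c1 c2) (s, xs) (k + 1) \<sigma>'"
| WhileT: "data_exp s e \<Longrightarrow> ev s e > 0 \<Longrightarrow> exec X c (s, xs) k1 \<sigma>' \<Longrightarrow>
    exec X (While e c) \<sigma>' k2 \<sigma>'' \<Longrightarrow> exec X (While e c) (s, xs) (k1 + k2 + 1) \<sigma>''"
| WhileF: "data_exp s e \<Longrightarrow> \<not> ev s e > 0 \<Longrightarrow> exec X (While e c) (s, xs) 1 (s, xs)"

fun loc_index :: "location \<Rightarrow> nat" where
  "loc_index (Reg i) = i"
| "loc_index (Ind i) = i"

text \<open>
  One measure for everything that a program text contributes to the cost of a step: it bounds the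
  literals, the register numbers, the nesting depth and the length of the code.
\<close>

primrec esize :: "exp \<Rightarrow> nat" where
  "esize (Num k) = nat \<bar>k\<bar> + 1"
| "esize (Var l) = loc_index l + 1"
| "esize (Bin f a b) = esize a + esize b + 1"

primrec csize :: "com \<Rightarrow> nat" where
  "csize (Assign l e) = loc_index l + esize e"
| "csize (Get l) = loc_index l"
| "csize (Seq c1 c2) = csize c1 + csize c2"
| "csize (Cond e c1 c2) = esize e + csize c1 + csize c2"
| "csize (While e c) = esize e + csize c"

text \<open>
  The first argument is the index of the first free odd register. The right operand is evaluated
  first and put aside there, so that the left operand ends up in the accumulator, where a subtraction
  needs it.
\<close>

primrec ecode :: "nat \<Rightarrow> exp \<Rightarrow> instruction list" where
  "ecode t (Num k) = [Load (Lit k)]"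
| "ecode t (Var l) = [Load (Loc l)]"
| "ecode t (Bin f a b) = ecode t b @ [Store (Reg (2 * t + 1))] @ ecode (Suc t) a @
     [arith_instruction f (Loc (Reg (2 * t + 1)))]"

primrec code_length :: "com \<Rightarrow> nat" where
  "code_length (Assign l e) = length (ecode 0 e) + 1"
| "code_length (Get l) = 1"
| "code_length (Seq c1 c2) = code_length c1 + code_length c2"
| "code_length (Cond e c1 c2) = length (ecode 0 e) + 2 + code_length c1 + code_length c2"
| "code_length (While e c) = length (ecode 0 e) + 3 + code_length c"

primrec compile :: "nat \<Rightarrow> com \<Rightarrow> instruction list" where
  "compile pc (Assign l e) = ecode 0 e @ [Store l]"
| "compile pc (Get l) = [Read l]"
| "compile pc (Seq c1 c2) = compile pc c1 @ compile (pc + code_length c1) c2"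
| "compile pc (Cond e c1 c2) =
     (let here = pc + length (ecode 0 e);
          yes = here + code_length c2 + 2
      in ecode 0 e @ [Jump_Pos yes] @ compile (here + 1) c2 @ [Jump (yes + code_length c1)] @ compile yes c1)"
| "compile pc (While e c) =
     (let here = pc + length (ecode 0 e)
      in ecode 0 e @ [Jump_Pos (here + 2), Jump (here + code_length c + 3)] @ compile (here + 2) c @ [Jump pc])"

lemma length_compile [simp]: "length (compile pc c) = code_length c"
  by (induction c arbitrary: pc) (auto simp: Let_def)

definition code_at :: "program \<Rightarrow> nat \<Rightarrow> instruction list \<Rightarrow> bool" where
  "code_at P pc is \<longleftrightarrow> (\<forall>i<length is. fetch P (pc + i) = Some (is ! i))"

lemma code_at_Nil [simp]: "code_at P pc []"
  by (simp add: code_at_def)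

lemma code_at_Cons [simp]: "code_at P pc (x # xs) \<longleftrightarrow> fetch P pc = Some x \<and> code_at P (Suc pc) xs"
  by (auto simp: code_at_def nth_Cons less_Suc_eq_0_disj split: nat.splits)

lemma code_at_append [simp]: "code_at P pc (xs @ ys) \<longleftrightarrow> code_at P pc xs \<and> code_at P (pc + length xs) ys"
  by (induction xs arbitrary: pc) auto

lemma code_at_self: "code_at (pre @ P @ post) (length pre) P"
  by (auto simp: code_at_def fetch_def nth_append)

inductive walk :: "program \<Rightarrow> nat \<Rightarrow> nat \<Rightarrow> config \<Rightarrow> config \<Rightarrow> bool" for P A where
  stay: "walk P A 0 c c"
| move: "step P c a c' \<Longrightarrow> a \<le> A \<Longrightarrow> walk P A m c' c'' \<Longrightarrow> walk P A (Suc m) c c''"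

lemma walk_trans [trans]: "walk P A m c c' \<Longrightarrow> walk P A k c' c'' \<Longrightarrow> walk P A (m + k) c c''"
  by (induction rule: walk.induct) (auto intro: walk.move)

lemma walk_step: "step P c a c' \<Longrightarrow> a \<le> A \<Longrightarrow> walk P A 1 c c'"
  using walk.move walk.stay by (metis One_nat_def)

lemma walk_answers:
  assumes "walk P A m c c'" and "answers P c' b t"
  shows "\<exists>u \<le> m * A + t. answers P c b u"
  using assms
proof (induction rule: walk.induct)
  case (move c a c' m c'')
  then obtain u where "u \<le> m * A + t" "answers P c' b u" by blast
  with move have "answers P c b (a + u)" "a + u \<le> Suc m * A + t"
    by (auto intro: answers.step)
  then show ?case by blast
qed auto

lemma bits_mono: "\<bar>a\<bar> \<le> \<bar>b\<bar> \<Longrightarrow> bits a \<le> bits b"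
  by (auto simp: bits_def intro!: floorlog_mono)

lemma bits_pos: "1 \<le> bits a"
  by (simp add: bits_def)

definition agree :: "registers \<Rightarrow> registers \<Rightarrow> bool" where
  "agree s r \<longleftrightarrow> (\<forall>i. data i \<longrightarrow> r i = s i)"

definition bounded_by :: "int \<Rightarrow> registers \<Rightarrow> bool" where
  "bounded_by H r \<longleftrightarrow> (\<forall>i. \<bar>r i\<bar> \<le> H)"

lemma agree_address: "agree s r \<Longrightarrow> data_loc s l \<Longrightarrow> address r l = address s l"
  by (cases l) (auto simp: agree_def)

lemma data_loc_address: "data_loc s l \<Longrightarrow> data (address s l)"
  by (cases l) auto

lemma data_0 [simp]: "\<not> data 0"
  by (simp add: data_def)

lemma data_Suc_double [simp]: "\<not> data (Suc (2 * t))"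
  by (simp add: data_def)

lemma nat_le_power: "2 \<le> (X::int) \<Longrightarrow> k \<le> n \<Longrightarrow> int k \<le> X ^ n"
proof -
  assume X: "2 \<le> X" and k: "k \<le> n"
  have "int k \<le> 2 ^ n" using k by (metis (mono_tags) less_exp of_nat_less_numeral_power_cancel_iff le_less_trans less_imp_le)
  also have "\<dots> \<le> X ^ n" using X by (intro power_mono) auto
  finally show ?thesis .
qed

lemma double_le_power: "2 \<le> (X::int) \<Longrightarrow> k < n \<Longrightarrow> int (Suc (2 * k)) \<le> X ^ n"
proof -
  assume X: "2 \<le> X" and k: "k < n"
  then obtain m where n: "n = Suc m" and km: "k \<le> m" by (cases n) auto
  have "int (Suc k) \<le> 2 ^ m"
    using km less_exp[of m] by (metis Suc_le_eq le_less_trans of_nat_le_numeral_power_cancel_iff)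
  then have "int (Suc (2 * k)) \<le> 2 ^ n" by (simp add: n)
  also have "\<dots> \<le> X ^ n" using X by (intro power_mono) auto
  finally show ?thesis .
qed

lemma esize_pos: "1 \<le> esize e"
  by (induction e) auto

text \<open>
  Both \<open>u + v\<close> and \<open>u v\<close> are at most \<open>X u v\<close> for \<open>u, v \<ge> 1\<close> and \<open>X \<ge> 2\<close>. So the
  number of bits grows at most by the factor \<open>esize e\<close> from the bound on the variables to that on values.
\<close>

lemma ev_bound:
  assumes X: "2 \<le> X" and s: "bounded_by X s"
  shows "\<bar>ev s e\<bar> \<le> X ^ esize e"
proof (induction e)
  case (Num k)
  have "int (nat \<bar>k\<bar>) \<le> X ^ (nat \<bar>k\<bar> + 1)" using X by (intro nat_le_power) auto
  then show ?case by simp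
next
  case (Var l)
  have "\<bar>s (address s l)\<bar> \<le> X" using s by (auto simp: bounded_by_def)
  also have "X ^ 1 \<le> X ^ esize (Var l)" using X by (intro power_increasing) auto
  finally show ?case using X by simp
next
  case (Bin f a b)
  let ?A = "X ^ esize a" and ?B = "X ^ esize b"
  have AB: "1 \<le> ?A" "1 \<le> ?B" using X by auto
  have "0 \<le> (?A - 1) * (?B - 1)" using AB by simp
  then have "?A + ?B \<le> 1 + ?A * ?B" by (simp add: algebra_simps)
  moreover have "1 \<le> ?A * ?B" using mult_mono[OF AB] AB by simp
  ultimately have "?A + ?B \<le> 2 * (?A * ?B)" by simp
  also have "\<dots> \<le> X * (?A * ?B)" using X AB by (intro mult_right_mono) auto
  finally have sum: "?A + ?B \<le> X ^ esize (Bin f a b)" by (simp add: power_add mult_ac)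
  have "\<bar>ev s a\<bar> * \<bar>ev s b\<bar> \<le> ?A * ?B" using Bin.IH AB by (intro mult_mono) auto
  also have "\<dots> \<le> X * (?A * ?B)" using mult_right_mono[of 1 X "?A * ?B"] X AB by simp
  finally have "\<bar>ev s a * ev s b\<bar> \<le> X ^ esize (Bin f a b)"
    by (simp add: abs_mult power_add mult_ac)
  with sum Bin.IH show ?case by (cases f) auto
qed

lemma operand_cost_Loc_bound:
  assumes "bounded_by H r" and "int (loc_index l) \<le> H"
  shows "operand_cost r (Loc l) \<le> 3 * bits H"
proof -
  have b: "\<And>i. bits (r i) \<le> bits H"
    by (rule bits_mono) (use assms(1) in \<open>auto simp: bounded_by_def intro: order_trans\<close>)
  have "bits (int (loc_index l)) \<le> bits H" by (rule bits_mono) (use assms(2) in auto)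
  then show ?thesis
    using b[of "loc_index l"] b[of "address r l"] by (cases l) auto
qed

lemma address_cost_bound:
  assumes "bounded_by H r" and "int (loc_index l) \<le> H"
  shows "address_cost r l \<le> 2 * bits H"
proof -
  have b: "\<And>i. bits (r i) \<le> bits H"
    by (rule bits_mono) (use assms(1) in \<open>auto simp: bounded_by_def intro: order_trans\<close>)
  have "bits (int (loc_index l)) \<le> bits H" by (rule bits_mono) (use assms(2) in auto)
  then show ?thesis
    using b[of "loc_index l"] by (cases l) auto
qed

lemma bounded_by_bits: "bounded_by H r \<Longrightarrow> bits (r i) \<le> bits H"
  by (rule bits_mono) (auto simp: bounded_by_def intro: order_trans)

lemma agree_upd_0: "agree s (r(0 := v)) \<longleftrightarrow> agree s r"
  by (auto simp: agree_def data_def)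

lemma bounded_by_copy: "bounded_by H r \<Longrightarrow> bounded_by H (r(i := r j))"
  by (auto simp: bounded_by_def)

lemma bounded_by_upd: "bounded_by H r \<Longrightarrow> \<bar>v\<bar> \<le> H \<Longrightarrow> bounded_by H (r(i := v))"
  by (auto simp: bounded_by_def)

text \<open>
  The registers with odd numbers below \<open>2 * t + 1\<close> are preserved because they hold operands of the
  enclosing expressions. The step cost \<open>4 * bits (X ^ w)\<close> suffices since an instruction handles at
  most four numbers: the accumulator, a register number, an address and the value stored there.
\<close>

lemma ecode_walk:
  assumes X: "2 \<le> X" and s: "bounded_by X s"
  shows "code_at P pc (ecode t e) \<Longrightarrow> agree s r \<Longrightarrow> bounded_by (X ^ w) r \<Longrightarrow> data_exp s e \<Longrightarrow>
    esize e + t \<le> w \<Longrightarrow>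
    \<exists>r'. walk P (4 * bits (X ^ w)) (length (ecode t e)) (pc, r, xs) (pc + length (ecode t e), r', xs) \<and>
      r' 0 = ev s e \<and> agree s r' \<and> (\<forall>j<t. r' (2 * j + 1) = r (2 * j + 1)) \<and> bounded_by (X ^ w) r'"
proof (induction e arbitrary: pc t r)
  case (Num k)
  let ?H = "X ^ w"
  have "int (nat \<bar>k\<bar>) \<le> ?H" using X Num.prems by (intro nat_le_power) auto
  then have k: "\<bar>k\<bar> \<le> ?H" by simp
  have "step P (pc, r, xs) (bits k) (Suc pc, r(0 := k), xs)"
    using step.Load[of P pc "Lit k" r xs] Num.prems by simp
  moreover have "bits k \<le> bits ?H" by (rule bits_mono) (use k in auto)
  ultimately have "walk P (4 * bits ?H) 1 (pc, r, xs) (Suc pc, r(0 := k), xs)"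
    by (intro walk_step) auto
  moreover have "agree s (r(0 := k))" "bounded_by ?H (r(0 := k))"
    using Num.prems k by (auto simp: agree_upd_0 intro: bounded_by_upd)
  ultimately show ?case
    by (intro exI[of _ "r(0 := k)"]) (simp del: fun_upd_apply add: fun_upd_same fun_upd_other)
next
  case (Var l)
  let ?H = "X ^ w"
  have ad: "address r l = address s l" using Var.prems by (auto intro: agree_address)
  have da: "data (address s l)" using Var.prems by (auto intro: data_loc_address)
  have v: "r (address r l) = s (address s l)" using Var.prems da ad by (auto simp: agree_def)
  have "int (loc_index l) \<le> ?H" using X Var.prems by (intro nat_le_power) auto
  then have c: "operand_cost r (Loc l) \<le> 3 * bits ?H"
    using Var.prems by (intro operand_cost_Loc_bound) auto
  have "step P (pc, r, xs) (operand_cost r (Loc l)) (Suc pc, r(0 := s (address s l)), xs)"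
    using step.Load[of P pc "Loc l" r xs] Var.prems v by simp
  then have "walk P (4 * bits ?H) 1 (pc, r, xs) (Suc pc, r(0 := s (address s l)), xs)"
    using c by (intro walk_step) auto
  moreover have "\<bar>s (address s l)\<bar> \<le> ?H"
    using Var.prems(3) v by (metis bounded_by_def)
  then have "agree s (r(0 := s (address s l)))" "bounded_by ?H (r(0 := s (address s l)))"
    using Var.prems by (auto simp: agree_upd_0 intro: bounded_by_upd)
  ultimately show ?case
    by (intro exI[of _ "r(0 := s (address s l))"]) (simp del: fun_upd_apply add: fun_upd_same fun_upd_other)
next
  case (Bin f a b)
  let ?H = "X ^ w" and ?T = "2 * t + 1"
  let ?A = "4 * bits ?H"
  let ?m = "length (ecode t b)" and ?k = "length (ecode (Suc t) a)"
  have "code_at P pc (ecode t b)" "data_exp s b" "esize b + t \<le> w" using Bin.prems by auto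
  from Bin.IH(2)[OF this(1) Bin.prems(2,3) this(2,3)] obtain r1 where
    w1: "walk P ?A ?m (pc, r, xs) (pc + ?m, r1, xs)" and
    r1: "r1 0 = ev s b" "agree s r1" "\<forall>j<t. r1 (2 * j + 1) = r (2 * j + 1)" "bounded_by ?H r1" by blast
  have tb: "int ?T \<le> ?H" using double_le_power[OF X, of t w] Bin.prems by simp
  let ?r2 = "r1(?T := r1 0)"
  have "step P (pc + ?m, r1, xs) (bits (r1 0) + address_cost r1 (Reg ?T)) (Suc (pc + ?m), ?r2, xs)"
    using step.Store[of P "pc + ?m" "Reg ?T" r1 xs] Bin.prems by simp
  moreover have "bits (r1 0) + address_cost r1 (Reg ?T) \<le> ?A"
    using bounded_by_bits[OF r1(4), of 0] address_cost_bound[OF r1(4), of "Reg ?T"] tb by simp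
  ultimately have w2: "walk P ?A 1 (pc + ?m, r1, xs) (Suc (pc + ?m), ?r2, xs)" by (rule walk_step)
  have r2: "agree s ?r2" "bounded_by ?H ?r2"
    using r1(2) bounded_by_copy[OF r1(4)] by (auto simp: agree_def)
  have "code_at P (Suc (pc + ?m)) (ecode (Suc t) a)" "data_exp s a" "esize a + Suc t \<le> w"
    using Bin.prems esize_pos[of b] by auto
  from Bin.IH(1)[OF this(1) r2 this(2,3)] obtain r3 where
    w3: "walk P ?A ?k (Suc (pc + ?m), ?r2, xs) (Suc (pc + ?m) + ?k, r3, xs)" and
    r3: "r3 0 = ev s a" "agree s r3" "\<forall>j<Suc t. r3 (2 * j + 1) = ?r2 (2 * j + 1)" "bounded_by ?H r3" by blast
  let ?q = "Suc (pc + ?m) + ?k"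
  have r3T: "r3 ?T = ev s b" using r3(3) r1(1) by simp
  let ?r4 = "r3(0 := arith_fun f (r3 0) (r3 ?T))"
  have "fetch P ?q = Some (arith_instruction f (Loc (Reg ?T)))" using Bin.prems(1) by simp
  then have "step P (?q, r3, xs) (bits (r3 0) + operand_cost r3 (Loc (Reg ?T))) (Suc ?q, ?r4, xs)"
    by (cases f) (auto dest: step.Add step.Sub step.Mult simp del: operand_cost.simps)
  moreover have "bits (r3 0) + operand_cost r3 (Loc (Reg ?T)) \<le> ?A"
    using bounded_by_bits[OF r3(4), of 0] operand_cost_Loc_bound[OF r3(4), of "Reg ?T"] tb by simp
  ultimately have w4: "walk P ?A 1 (?q, r3, xs) (Suc ?q, ?r4, xs)" by (rule walk_step)
  have "walk P ?A (?m + 1 + ?k + 1) (pc, r, xs) (Suc ?q, ?r4, xs)"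
    using w1 w2 w3 w4 by (blast intro: walk_trans)
  \<comment> \<open>The result itself is bounded by the shape of the whole expression, not through its operands.\<close>
  moreover have "\<bar>ev s (Bin f a b)\<bar> \<le> ?H"
  proof -
    have "\<bar>ev s (Bin f a b)\<bar> \<le> X ^ esize (Bin f a b)" by (rule ev_bound[OF X s])
    also have "\<dots> \<le> ?H" using X Bin.prems by (intro power_increasing) auto
    finally show ?thesis .
  qed
  moreover have "?r4 0 = ev s (Bin f a b)" using r3(1) r3T by simp
  ultimately have "walk P ?A (length (ecode t (Bin f a b))) (pc, r, xs)
      (pc + length (ecode t (Bin f a b)), ?r4, xs)" "?r4 0 = ev s (Bin f a b)"
      "\<forall>j<t. ?r4 (2 * j + 1) = r (2 * j + 1)" "agree s ?r4" "bounded_by ?H ?r4"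
    using r3 r1(3) bounded_by_upd[OF r3(4), of "ev s (Bin f a b)" 0]
    by (auto simp: agree_upd_0 add_ac)
  then show ?case by blast
qed


lemma length_ecode: "length (ecode t e) \<le> 2 * esize e"
proof (induction e arbitrary: t)
  case (Bin f a b)
  then show ?case using add_mono[OF Bin.IH(2)[of t] Bin.IH(1)[of "Suc t"]] by simp
qed auto

lemma exec_bounded: "exec X c \<sigma> k \<sigma>' \<Longrightarrow> bounded_by X (fst \<sigma>) \<Longrightarrow> bounded_by X (fst \<sigma>')"
  by (induction rule: exec.induct) (auto simp: bounded_by_upd simp del: fun_upd_apply)

lemma test_walk:
  assumes X: "2 \<le> X" and "bounded_by X s" "agree s r" "bounded_by (X ^ w) r" "data_exp s e" "esize e \<le> w"
    and at: "code_at P pc (ecode 0 e @ [Jump_Pos target])"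
  shows "\<exists>r'. walk P (4 * bits (X ^ w)) (length (ecode 0 e) + 1) (pc, r, xs)
      (if ev s e > 0 then target else pc + length (ecode 0 e) + 1, r', xs) \<and>
    agree s r' \<and> bounded_by (X ^ w) r'"
proof -
  let ?A = "4 * bits (X ^ w)" and ?m = "length (ecode 0 e)"
  have "code_at P pc (ecode 0 e)" "esize e + 0 \<le> w" using assms by auto
  from ecode_walk[OF assms(1,2) this(1) assms(3,4,5) this(2)] obtain r' where
    w: "walk P ?A ?m (pc, r, xs) (pc + ?m, r', xs)" and
    r': "r' 0 = ev s e" "agree s r'" "bounded_by (X ^ w) r'" by blast
  have "step P (pc + ?m, r', xs) (bits (r' 0)) (if ev s e > 0 then target else pc + ?m + 1, r', xs)"
    using step.Jump_Pos[of P "pc + ?m" target r' xs] at r'(1) by (auto split: if_splits)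
  then have "walk P ?A 1 (pc + ?m, r', xs) (if ev s e > 0 then target else pc + ?m + 1, r', xs)"
    using bounded_by_bits[OF r'(3), of 0] by (intro walk_step) auto
  with w r' show ?thesis by (blast intro: walk_trans)
qed

lemma jump_walk:
  "fetch P pc = Some (Jump target) \<Longrightarrow> walk P (4 * bits H) 1 (pc, r, xs) (target, r, xs)"
  using bits_pos[of H] by (intro walk_step[OF step.Jump]) auto

text \<open>
  One step of a structured program evaluates at most one expression, whose code is at most twice as
  long as its size, and executes at most two further instructions: a read, a store, or a conditional
  jump and the jump that closes a branch, leaves a loop or returns to its start.
\<close>

lemma compile_walk:
  assumes X: "2 \<le> X"
  shows "exec X c \<sigma> k \<sigma>' \<Longrightarrow> code_at P pc (compile pc c) \<Longrightarrow> bounded_by X (fst \<sigma>) \<Longrightarrow>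
    agree (fst \<sigma>) r \<Longrightarrow> bounded_by (X ^ w) r \<Longrightarrow> csize c \<le> w \<Longrightarrow>
    \<exists>m r'. m \<le> k * (2 * w + 3) \<and>
      walk P (4 * bits (X ^ w)) m (pc, r, snd \<sigma>) (pc + code_length c, r', snd \<sigma>') \<and>
      agree (fst \<sigma>') r' \<and> bounded_by (X ^ w) r'"
proof (induction arbitrary: pc r rule: exec.induct)
  case (Assign s e l xs)
  let ?H = "X ^ w" and ?m = "length (ecode 0 e)"
  let ?A = "4 * bits ?H"
  have "code_at P pc (ecode 0 e)" "esize e + 0 \<le> w" using Assign.prems by auto
  from ecode_walk[OF X _ this(1) _ Assign.prems(4) Assign.hyps(1) this(2)] Assign.prems obtain r1 where
    w1: "walk P ?A ?m (pc, r, xs) (pc + ?m, r1, xs)" and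
    r1: "r1 0 = ev s e" "agree s r1" "bounded_by ?H r1" by fastforce
  have ad: "address r1 l = address s l" using r1(2) Assign.hyps(2) by (rule agree_address)
  let ?r2 = "r1(address s l := r1 0)"
  have "step P (pc + ?m, r1, xs) (bits (r1 0) + address_cost r1 l) (Suc (pc + ?m), ?r2, xs)"
    using step.Store[of P "pc + ?m" l r1 xs] Assign.prems ad by simp
  moreover have "int (loc_index l) \<le> ?H"
    using Assign.prems esize_pos[of e] by (intro nat_le_power[OF X]) auto
  then have "bits (r1 0) + address_cost r1 l \<le> ?A"
    using bounded_by_bits[OF r1(3), of 0] address_cost_bound[OF r1(3), of l] by simp
  ultimately have "walk P ?A 1 (pc + ?m, r1, xs) (Suc (pc + ?m), ?r2, xs)" by (rule walk_step)
  with w1 have "walk P ?A (?m + 1) (pc, r, xs) (Suc (pc + ?m), ?r2, xs)" by (rule walk_trans)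
  moreover have "agree (s(address s l := ev s e)) ?r2" "bounded_by ?H ?r2"
    using r1(1,2) bounded_by_copy[OF r1(3), of _ 0] by (auto simp: agree_def)
  moreover have "?m + 1 \<le> 1 * (2 * w + 3)" using length_ecode[of 0 e] Assign.prems by simp
  ultimately show ?case by (intro exI[of _ "?m + 1"] exI[of _ ?r2]) (simp del: fun_upd_apply)
next
  case (Get s l x xs)
  let ?H = "X ^ w"
  let ?A = "4 * bits ?H"
  have ad: "address r l = address s l" using Get by (auto intro: agree_address)
  let ?r2 = "r(address s l := x)"
  have "step P (pc, r, x # xs) (bits x + address_cost r l) (Suc pc, ?r2, xs)"
    using step.Read[of P pc l r x xs] Get.prems ad by simp
  moreover have l: "int (loc_index l) \<le> ?H"
    using Get.prems by (intro nat_le_power[OF X]) auto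
  have x: "\<bar>x\<bar> \<le> ?H" if "w \<noteq> 0"
    using Get.hyps(2) self_le_power[of X w] X that by simp
  have w0: "w \<noteq> 0" using Get.hyps(1) Get.prems by (cases l) (auto simp: data_def)
  have "bits x + address_cost r l \<le> ?A"
    using bits_mono[of x ?H] x w0 address_cost_bound[OF Get.prems(4) l] by simp
  ultimately have "walk P ?A 1 (pc, r, x # xs) (Suc pc, ?r2, xs)" by (intro walk_step) auto
  moreover have "agree (s(address s l := x)) ?r2" "bounded_by ?H ?r2"
    using Get.prems x w0 by (auto simp: agree_def bounded_by_def)
  ultimately show ?case by (intro exI[of _ 1] exI[of _ ?r2]) (simp del: fun_upd_apply)
next
  case (Seq c1 \<sigma> k1 \<sigma>' c2 k2 \<sigma>'')
  let ?A = "4 * bits (X ^ w)"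
  from Seq.IH(1)[of pc r] Seq.prems obtain m1 r1 where
    1: "m1 \<le> k1 * (2 * w + 3)" "walk P ?A m1 (pc, r, snd \<sigma>) (pc + code_length c1, r1, snd \<sigma>')"
      "agree (fst \<sigma>') r1" "bounded_by (X ^ w) r1" by auto
  have "bounded_by X (fst \<sigma>')" using exec_bounded Seq by blast
  with Seq.IH(2)[of "pc + code_length c1" r1] Seq.prems 1 obtain m2 r2 where
    2: "m2 \<le> k2 * (2 * w + 3)"
      "walk P ?A m2 (pc + code_length c1, r1, snd \<sigma>') (pc + code_length c1 + code_length c2, r2, snd \<sigma>'')"
      "agree (fst \<sigma>'') r2" "bounded_by (X ^ w) r2" by auto
  have "walk P ?A (m1 + m2) (pc, r, snd \<sigma>) (pc + code_length (Seq c1 c2), r2, snd \<sigma>'')"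
    using walk_trans[OF 1(2) 2(2)] by (simp add: add_ac)
  moreover have "m1 + m2 \<le> (k1 + k2) * (2 * w + 3)"
    using add_mono[OF 1(1) 2(1)] by (simp add: algebra_simps)
  ultimately show ?case using 2 by blast
next
  case (CondT s e c1 xs k \<sigma>' c2)
  let ?A = "4 * bits (X ^ w)" and ?m = "length (ecode 0 e)"
  let ?yes = "pc + ?m + code_length c2 + 2"
  obtain r1 where w1: "walk P ?A (?m + 1) (pc, r, xs) (?yes, r1, xs)" and
    r1: "agree s r1" "bounded_by (X ^ w) r1"
    using test_walk[OF X, of s r w e P pc ?yes xs] CondT.prems CondT.hyps by (auto simp: Let_def)
  from CondT.IH[of ?yes r1] CondT.prems r1 obtain m2 r2 where
    2: "m2 \<le> k * (2 * w + 3)" "walk P ?A m2 (?yes, r1, xs) (?yes + code_length c1, r2, snd \<sigma>')"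
      "agree (fst \<sigma>') r2" "bounded_by (X ^ w) r2" by (auto simp: Let_def eval_nat_numeral)
  have "walk P ?A (?m + 1 + m2) (pc, r, xs) (?yes + code_length c1, r2, snd \<sigma>')"
    using w1 2(2) by (rule walk_trans)
  moreover have "?m + 1 + m2 \<le> (k + 1) * (2 * w + 3)"
    using 2(1) length_ecode[of 0 e] CondT.prems by simp
  ultimately show ?case using 2
    by (intro exI[of _ "?m + 1 + m2"] exI[of _ r2]) (simp add: add_ac)
next
  case (CondF s e c2 xs k \<sigma>' c1)
  let ?A = "4 * bits (X ^ w)" and ?m = "length (ecode 0 e)"
  let ?no = "pc + ?m + 1"
  let ?end = "pc + ?m + code_length c2 + 2 + code_length c1"
  obtain r1 where w1: "walk P ?A (?m + 1) (pc, r, xs) (?no, r1, xs)" and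
    r1: "agree s r1" "bounded_by (X ^ w) r1"
    using test_walk[OF X, of s r w e P pc "pc + ?m + code_length c2 + 2" xs] CondF.prems CondF.hyps
    by (auto simp: Let_def)
  from CondF.IH[of ?no r1] CondF.prems r1 obtain m2 r2 where
    2: "m2 \<le> k * (2 * w + 3)" "walk P ?A m2 (?no, r1, xs) (?no + code_length c2, r2, snd \<sigma>')"
      "agree (fst \<sigma>') r2" "bounded_by (X ^ w) r2" by (auto simp: Let_def)
  have "walk P ?A 1 (?no + code_length c2, r2, snd \<sigma>') (?end, r2, snd \<sigma>')"
    using CondF.prems by (intro jump_walk) (simp add: Let_def)
  with w1 2(2) have "walk P ?A (?m + 1 + m2 + 1) (pc, r, xs) (?end, r2, snd \<sigma>')"
    by (blast intro: walk_trans)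
  moreover have "?m + 1 + m2 + 1 \<le> (k + 1) * (2 * w + 3)"
    using 2(1) length_ecode[of 0 e] CondF.prems by simp
  ultimately show ?case using 2
    by (intro exI[of _ "?m + 1 + m2 + 1"] exI[of _ r2]) (simp add: add_ac)
next
  case (WhileT s e c xs k1 \<sigma>' k2 \<sigma>'')
  let ?A = "4 * bits (X ^ w)" and ?m = "length (ecode 0 e)"
  let ?body = "pc + ?m + 2"
  obtain r1 where w1: "walk P ?A (?m + 1) (pc, r, xs) (?body, r1, xs)" and
    r1: "agree s r1" "bounded_by (X ^ w) r1"
    using test_walk[OF X, of s r w e P pc ?body xs] WhileT.prems WhileT.hyps by (auto simp: Let_def)
  from WhileT.IH(1)[of ?body r1] WhileT.prems r1 obtain m2 r2 where
    2: "m2 \<le> k1 * (2 * w + 3)" "walk P ?A m2 (?body, r1, xs) (?body + code_length c, r2, snd \<sigma>')"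
      "agree (fst \<sigma>') r2" "bounded_by (X ^ w) r2" by (auto simp: Let_def)
  have w3: "walk P ?A 1 (?body + code_length c, r2, snd \<sigma>') (pc, r2, snd \<sigma>')"
    using WhileT.prems by (intro jump_walk) (simp add: Let_def)
  have "bounded_by X (fst \<sigma>')" using exec_bounded WhileT by fastforce
  with WhileT.IH(2)[of pc r2] WhileT.prems 2 obtain m4 r4 where
    4: "m4 \<le> k2 * (2 * w + 3)"
      "walk P ?A m4 (pc, r2, snd \<sigma>') (pc + code_length (While e c), r4, snd \<sigma>'')"
      "agree (fst \<sigma>'') r4" "bounded_by (X ^ w) r4" by blast
  have "walk P ?A (?m + 1 + m2 + 1 + m4) (pc, r, xs) (pc + code_length (While e c), r4, snd \<sigma>'')"
    using w1 2(2) w3 4(2) by (blast intro: walk_trans)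
  moreover have "?m + 1 + m2 + 1 + m4 \<le> (k1 + k2 + 1) * (2 * w + 3)"
    using 2(1) 4(1) length_ecode[of 0 e] WhileT.prems by (simp add: algebra_simps)
  ultimately show ?case using 4
    by (intro exI[of _ "?m + 1 + m2 + 1 + m4"] exI[of _ r4]) simp
next
  case (WhileF s e c xs)
  let ?A = "4 * bits (X ^ w)" and ?m = "length (ecode 0 e)"
  let ?end = "pc + ?m + code_length c + 3"
  obtain r1 where w1: "walk P ?A (?m + 1) (pc, r, xs) (pc + ?m + 1, r1, xs)" and
    r1: "agree s r1" "bounded_by (X ^ w) r1"
    using test_walk[OF X, of s r w e P pc "pc + ?m + 2" xs] WhileF.prems WhileF.hyps
    by (auto simp: Let_def)
  have "walk P ?A 1 (pc + ?m + 1, r1, xs) (?end, r1, xs)"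
    using WhileF.prems by (intro jump_walk) (simp add: Let_def)
  with w1 have "walk P ?A (?m + 1 + 1) (pc, r, xs) (?end, r1, xs)" by (rule walk_trans)
  moreover have "?m + 1 + 1 \<le> 1 * (2 * w + 3)"
    using length_ecode[of 0 e] WhileF.prems by simp
  ultimately show ?case using r1
    by (intro exI[of _ "?m + 1 + 1"] exI[of _ r1]) (simp add: add_ac)
qed

lemma bits_power_2: "bits (2 ^ m) = m + 2"
  by (simp add: bits_def nat_power_eq floorlog_def)

text \<open>
  The cost of a run is at most the number of its instructions times the cost of the most expensive
  one. The former is a constant multiple of the number of structured steps, the latter a constant
  multiple of the number of bits of the bound on the stored values.
\<close>

theorem poly_time_decides_by_com:
  fixes time size :: "nat poly"
  assumes res: "data res"
    and size: "\<And>N. poly size N \<ge> 1"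
    and run: "\<And>x. x \<in> I \<Longrightarrow> \<exists>k s xs. k \<le> poly time (\<Sum>a \<leftarrow> enc x. bits a) \<and>
      exec (2 ^ poly size (\<Sum>a \<leftarrow> enc x. bits a)) c (\<lambda>_. 0, enc x) k (s, xs) \<and> (Q x \<longleftrightarrow> s res > 0)"
  shows "\<exists>P. poly_time_decides P I enc Q"
proof -
  define w where "w = csize c + res"
  define l where "l = code_length c"
  define P where "P = compile 0 c @ [Load (Loc (Reg res)), Jump_Pos (l + 3), Reject, Accept]"
  define q where "q = [:4:] * (([:2 * w + 3:] * time + [:3:]) * ([:w:] * size + [:2:]))"
  have at: "code_at P 0 (compile 0 c)" "code_at P l [Load (Loc (Reg res)), Jump_Pos (l + 3), Reject, Accept]"
    using code_at_self[of "[]" P "[]"] by (auto simp: P_def l_def)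
  have "\<exists>t \<le> poly q (\<Sum>a \<leftarrow> enc x. bits a). answers P (0, \<lambda>_. 0, enc x) (Q x) t" if "x \<in> I" for x
  proof -
    define N where "N = (\<Sum>a \<leftarrow> enc x. bits a)"
    define X where "X = (2::int) ^ poly size N"
    define A where "A = 4 * bits (X ^ w)"
    have X: "2 \<le> X" using self_le_power[of "2::int" "poly size N"] size[of N] by (simp add: X_def)
    have A: "A = 4 * (w * poly size N + 2)"
      by (simp add: A_def X_def flip: power_mult) (simp add: bits_power_2 mult.commute)
    from run[OF that] obtain k s xs where k: "k \<le> poly time N"
      and ex: "exec X c (\<lambda>_. 0, enc x) k (s, xs)" and Q: "Q x \<longleftrightarrow> s res > 0"
      by (auto simp: N_def X_def)
    have "bounded_by X (\<lambda>_. 0)" "bounded_by (X ^ w) (\<lambda>_. 0)" "agree (\<lambda>_. 0) (\<lambda>_. 0)"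
      using X by (auto simp: bounded_by_def agree_def)
    with compile_walk[OF X ex, of P 0 "\<lambda>_. 0" w] at obtain m r where
      m: "m \<le> k * (2 * w + 3)" and
      w1: "walk P A m (0, \<lambda>_. 0, enc x) (l, r, xs)" and
      r: "agree s r" "bounded_by (X ^ w) r" by (auto simp: A_def l_def w_def)
    let ?r2 = "r(0 := r res)"
    have "step P (l, r, xs) (operand_cost r (Loc (Reg res))) (Suc l, ?r2, xs)"
      using step.Load[of P l "Loc (Reg res)" r xs] at by simp
    moreover have "int (loc_index (Reg res)) \<le> X ^ w"
      unfolding loc_index.simps by (rule nat_le_power[OF X]) (simp add: w_def)
    then have "operand_cost r (Loc (Reg res)) \<le> A"
      using operand_cost_Loc_bound[OF r(2)] unfolding A_def by fastforce
    ultimately have w2: "walk P A 1 (l, r, xs) (Suc l, ?r2, xs)" by (rule walk_step)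
    have "step P (Suc l, ?r2, xs) (bits (?r2 0)) (if ?r2 0 > 0 then l + 3 else Suc (Suc l), ?r2, xs)"
      using step.Jump_Pos[of P "Suc l" "l + 3" ?r2 xs] at by simp
    moreover have "bits (?r2 0) \<le> A"
      using bounded_by_bits[OF r(2), of res] by (simp add: A_def)
    ultimately have "walk P A 1 (Suc l, ?r2, xs) (if ?r2 0 > 0 then l + 3 else Suc (Suc l), ?r2, xs)"
      by (rule walk_step)
    with w1 w2 have w3: "walk P A (m + 1 + 1) (0, \<lambda>_. 0, enc x) (if ?r2 0 > 0 then l + 3 else Suc (Suc l), ?r2, xs)"
      by (blast intro: walk_trans)
    have "?r2 0 = s res" using r(1) res by (auto simp: agree_def)
    then have "answers P (if ?r2 0 > 0 then l + 3 else Suc (Suc l), ?r2, xs) (Q x) 1"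
      using Q at answers.accept[of P "l + 3" ?r2 xs] answers.reject[of P "Suc (Suc l)" ?r2 xs]
      by (simp add: eval_nat_numeral del: fun_upd_apply)
    with walk_answers[OF w3] obtain u where
      u: "u \<le> (m + 1 + 1) * A + 1" "answers P (0, \<lambda>_. 0, enc x) (Q x) u" by blast
    have "1 \<le> A" by (simp add: A)
    with u(1) have "u \<le> (m + 3) * A" by (simp add: algebra_simps)
    also have "\<dots> \<le> (poly time N * (2 * w + 3) + 3) * A"
      using m k by (intro mult_right_mono add_mono order_refl) (auto intro: order_trans mult_right_mono)
    also have "\<dots> = poly q N" by (simp add: A q_def algebra_simps)
    finally show ?thesis using u(2) unfolding N_def by blast
  qed
  then show ?thesis unfolding poly_time_decides_def by blast
qed

section \<open>Real roots and the Cauchy index\<close>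

text \<open>
  Far to the right a polynomial has the sign of its leading coefficient, and on the way there the
  sign cannot change without a root.
\<close>

lemma sgn_poly_right_of_roots:
  fixes f :: "real poly"
  assumes "f \<noteq> 0" and "\<And>x. a \<le> x \<Longrightarrow> poly f x \<noteq> 0"
  shows "sgn (poly f a) = sgn (lead_coeff f)"
proof -
  have pos: "poly g a > 0" if "lead_coeff g > 0" "\<And>x. a \<le> x \<Longrightarrow> poly g x \<noteq> 0" for g :: "real poly"
  proof (rule ccontr)
    assume "\<not> poly g a > 0"
    then have neg: "poly g a < 0" using that(2)[of a] by auto
    from poly_pinfty_gt_lc[OF that(1)] obtain n where n: "\<And>x. x \<ge> n \<Longrightarrow> poly g x \<ge> lead_coeff g" by blast
    have "poly g (max n (a + 1)) > 0" using n[of "max n (a + 1)"] that(1) by auto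
    with poly_IVT_pos[of a "max n (a + 1)" g] neg that(2) show False by force
  qed
  show ?thesis
  proof (cases "lead_coeff f > 0")
    case True
    with pos[of f] assms show ?thesis by simp
  next
    case False
    with assms(1) have "lead_coeff f < 0" by (simp add: leading_coeff_neq_0 less_le)
    with pos[of "- f"] assms show ?thesis by simp
  qed
qed

text \<open>
  Without roots the signs at both infinities agree with the sign at 0. Reflection at the origin
  exchanges the infinities and multiplies the leading coefficient by the parity of the degree.
\<close>

lemma even_degree_if_no_real_root:
  fixes f :: "real poly"
  assumes "\<And>x. poly f x \<noteq> 0"
  shows "even (degree f)"
proof (rule ccontr)
  assume odd: "odd (degree f)"
  have f: "f \<noteq> 0" using assms by auto
  define g where "g = pcompose f [:0, -1:]"
  have g: "g \<noteq> 0" "poly g x = poly f (- x)" for x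
    using f by (auto simp: g_def poly_pcompose pcompose_eq_0_iff)
  have "lead_coeff g = - lead_coeff f"
    unfolding g_def by (subst lead_coeff_comp) (use odd in auto)
  moreover have "sgn (poly g 0) = sgn (lead_coeff g)"
    using g assms by (intro sgn_poly_right_of_roots) auto
  moreover have "sgn (poly f 0) = sgn (lead_coeff f)"
    using f assms by (intro sgn_poly_right_of_roots) auto
  ultimately have "sgn (lead_coeff f) = 0" using g(2)[of 0] by simp
  with f show False by (simp add: sgn_0_0)
qed

text \<open>
  The value at \<open>a\<close> of the cofactor of the root \<open>a\<close>. Its sign is the sign of \<open>f\<close> immediately to the right
  of \<open>a\<close>, and up to the parity of the order also the sign to the left.
\<close>

definition unit_at :: "real \<Rightarrow> real poly \<Rightarrow> real" where
  "unit_at a f = poly (f div [:-a, 1:] ^ order a f) a"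

lemma order_unit_eqI:
  assumes "f = [:-a, 1:] ^ k * u" and "poly u a \<noteq> 0"
  shows "order a f = k" and "unit_at a f = poly u a"
proof -
  have "u \<noteq> 0" using assms(2) by auto
  then show "order a f = k"
    using assms by (simp add: order_mult order_power_n_n order_0I)
  then show "unit_at a f = poly u a" using assms(1) by (simp add: unit_at_def)
qed

lemma unit_decomp:
  assumes "f \<noteq> 0"
  obtains u where "f = [:-a, 1:] ^ order a f * u" "poly u a = unit_at a f" "unit_at a f \<noteq> 0"
proof -
  from order_decomp[OF assms] obtain u where u: "f = [:-a, 1:] ^ order a f * u" "\<not> [:-a, 1:] dvd u" by blast
  then have "poly u a \<noteq> 0" by (simp add: poly_eq_0_iff_dvd)
  with order_unit_eqI(2)[OF u(1)] u(1) that show ?thesis by auto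
qed

lemma unit_at_mult:
  assumes "f \<noteq> 0" and "g \<noteq> 0"
  shows "unit_at a (f * g) = unit_at a f * unit_at a g"
proof -
  obtain u where u: "f = [:-a, 1:] ^ order a f * u" "poly u a = unit_at a f" "unit_at a f \<noteq> 0"
    using unit_decomp assms(1) .
  obtain v where v: "g = [:-a, 1:] ^ order a g * v" "poly v a = unit_at a g" "unit_at a g \<noteq> 0"
    using unit_decomp assms(2) .
  have "f * g = [:-a, 1:] ^ (order a f + order a g) * (u * v)"
    by (subst u(1), subst v(1)) (simp add: power_add mult_ac)
  from order_unit_eqI(2)[OF this] u v show ?thesis by simp
qed

text \<open>
  Half of the sign immediately to the right of \<open>a\<close> minus the sign immediately to the left.
\<close>

definition sign_change :: "real poly \<Rightarrow> real \<Rightarrow> real" where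
  "sign_change f a = (if odd (order a f) then sgn (unit_at a f) else 0)"

text \<open>
  The sign changes telescope to half of the sign at \<open>\<infinity>\<close> minus the sign at \<open>-\<infinity>\<close>. The induction removes
  the factor \<open>(x - a) ^ k\<close> of the largest root \<open>a\<close>: at \<open>a\<close> the cofactor has the sign of its leading
  coefficient, and left of \<open>a\<close> the factor multiplies all signs by \<open>(-1) ^ k\<close>.
\<close>

lemma sum_sign_change:
  assumes "f \<noteq> 0"
  shows "(\<Sum>a | poly f a = 0. sign_change f a) = (if odd (degree f) then sgn (lead_coeff f) else 0)"
  using assms
proof (induction "degree f" arbitrary: f rule: less_induct)
  case less
  let ?R = "{x. poly f x = 0}"
  have fin: "finite ?R" by (rule poly_roots_finite[OF less.prems])
  show ?case
  proof (cases "?R = {}")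
    case True
    then show ?thesis using even_degree_if_no_real_root[of f] by auto
  next
    case False
    define a where "a = Max ?R"
    have a: "poly f a = 0" "\<And>x. poly f x = 0 \<Longrightarrow> x \<le> a"
      using Max_in[OF fin False] Max_ge[OF fin] by (auto simp: a_def)
    define k where "k = order a f"
    obtain g where g: "f = [:-a, 1:] ^ k * g" "poly g a = unit_at a f" "unit_at a f \<noteq> 0"
      using unit_decomp[OF less.prems, of a] k_def by metis
    have g0: "g \<noteq> 0" using g by auto
    have k0: "k \<noteq> 0" using a less.prems by (simp add: k_def order_eq_0_iff)
    have deg: "degree f = k + degree g"
      by (subst g(1)) (simp add: degree_mult_eq g0 degree_power_eq)
    have lc: "lead_coeff f = lead_coeff g"
      using lead_coeff_mult[of "[:-a, 1:] ^ k" g] by (simp add: lead_coeff_power flip: g(1))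
    have R: "?R = insert a {x. poly g x = 0}"
      by (subst g(1)) (use k0 in auto)
    have gr: "x < a" if "poly g x = 0" for x
    proof -
      have "poly f x = 0" using that g(1) by (metis mult_zero_right poly_mult)
      then have "x \<le> a" by (rule a(2))
      moreover have "x \<noteq> a" using that g by auto
      ultimately show ?thesis by simp
    qed
    have sa: "sgn (unit_at a f) = sgn (lead_coeff g)"
      using sgn_poly_right_of_roots[OF g0, of a] gr g(2) by force
    have sb: "sign_change f b = (-1) ^ k * sign_change g b" if "poly g b = 0" for b
    proof -
      obtain u where u: "g = [:-b, 1:] ^ order b g * u" "poly u b = unit_at b g" "unit_at b g \<noteq> 0"
        using unit_decomp[OF g0] .
      have "f = [:-b, 1:] ^ order b g * ([:-a, 1:] ^ k * u)"
        by (subst g(1), subst u(1)) (simp add: mult_ac)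
      moreover have "poly ([:-a, 1:] ^ k * u) b = (b - a) ^ k * unit_at b g"
        by (simp add: u(2))
      ultimately have "order b f = order b g" "unit_at b f = (b - a) ^ k * unit_at b g"
        using order_unit_eqI[of f b "order b g" "[:-a, 1:] ^ k * u"] u(3) gr[OF that] by auto
      moreover have "sgn ((b - a) ^ k) = (-1) ^ k" using gr[OF that] by (induction k) (auto simp: sgn_mult)
      ultimately show ?thesis by (simp add: sign_change_def sgn_mult)
    qed
    have "(\<Sum>a\<in>?R. sign_change f a) = sign_change f a + (\<Sum>b | poly g b = 0. sign_change f b)"
      unfolding R using g0 g by (subst sum.insert) (auto simp: poly_roots_finite)
    also have "(\<Sum>b | poly g b = 0. sign_change f b) = (-1) ^ k * (\<Sum>b | poly g b = 0. sign_change g b)"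
      by (simp add: sb sum_distrib_left)
    also have "(\<Sum>b | poly g b = 0. sign_change g b) = (if odd (degree g) then sgn (lead_coeff g) else 0)"
      using less.hyps[of g] deg k0 g0 by simp
    finally show ?thesis
      unfolding lc unfolding deg by (auto simp: sign_change_def sa simp flip: k_def)
  qed
qed

text \<open>
  Half of the jump of the sign of \<open>q / p\<close> at \<open>a\<close>, where only poles count, i.e. points at which the order
  of \<open>p\<close> exceeds that of \<open>q\<close>.
\<close>

definition jump :: "real poly \<Rightarrow> real poly \<Rightarrow> real \<Rightarrow> real" where
  "jump p q a = (if p \<noteq> 0 \<and> q \<noteq> 0 \<and> order a q < order a p \<and> odd (order a p + order a q)
     then sgn (unit_at a p * unit_at a q) else 0)"

definition cauchy_index :: "real poly \<Rightarrow> real poly \<Rightarrow> real" where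
  "cauchy_index p q = (\<Sum>a | poly p a = 0. jump p q a)"

lemma cauchy_index_0 [simp]: "cauchy_index 0 q = 0" "cauchy_index p 0 = 0"
  by (auto simp: cauchy_index_def jump_def)

text \<open>
  If the orders of \<open>p\<close> and \<open>q\<close> at a point have different parity, exactly one of \<open>q / p\<close> and \<open>p / q\<close> has a
  pole there, and its jump is the sign change of \<open>p * q\<close>. Otherwise nothing changes sign.
\<close>

lemma cauchy_index_reciprocity:
  assumes "p \<noteq> 0" and "q \<noteq> 0"
  shows "cauchy_index p q =
    (if odd (degree p + degree q) then sgn (lead_coeff p * lead_coeff q) else 0) - cauchy_index q p"
proof -
  let ?R = "{a. poly (p * q) a = 0}"
  have fin: "finite ?R" by (rule poly_roots_finite) (use assms in simp)
  have extend: "cauchy_index f g = (\<Sum>a\<in>?R. jump f g a)"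
    if "f \<noteq> 0" "{a. poly f a = 0} \<subseteq> ?R" for f g
    unfolding cauchy_index_def
    by (rule sum.mono_neutral_left[OF fin that(2)])
      (use that(1) in \<open>auto simp: jump_def order_0I\<close>)
  have "jump p q a + jump q p a = sign_change (p * q) a" for a
  proof (cases "odd (order a p + order a q)")
    case True
    then have "order a p < order a q \<or> order a q < order a p" by (metis even_add linorder_neqE_nat)
    then show ?thesis using assms True order_mult[of p q a] unit_at_mult[of p q a]
      by (auto simp: jump_def sign_change_def mult.commute)
  next
    case False
    then show ?thesis using assms order_mult[of p q a] by (auto simp: jump_def sign_change_def)
  qed
  then have "cauchy_index p q + cauchy_index q p = (\<Sum>a\<in>?R. sign_change (p * q) a)"
    using extend[of p q] extend[of q p] assms
    by (simp add: sum.distrib[symmetric] Collect_mono_iff)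
  also have "\<dots> = (if odd (degree p + degree q) then sgn (lead_coeff p * lead_coeff q) else 0)"
    using sum_sign_change[of "p * q"] assms unfolding lead_coeff_mult by (simp add: degree_mult_eq)
  finally show ?thesis by linarith
qed

text \<open>
  Scaling by a positive constant is harmless, and adding a multiple of \<open>p\<close> changes \<open>q / p\<close> by a polynomial, which affects neither poles nor the signs
  next to them.
\<close>

lemma cauchy_index_cong:
  assumes c: "c > 0"
  shows "cauchy_index p (smult c q + f * p) = cauchy_index p q"
proof (cases "p = 0")
  case False
  have "jump p (smult c q + f * p) a = jump p q a" for a
  proof (cases "q \<noteq> 0 \<and> order a q < order a p")
    case True
    obtain u where u: "p = [:-a, 1:] ^ order a p * u"
      using unit_decomp[OF False] by metis
    obtain v where v: "q = [:-a, 1:] ^ order a q * v" "poly v a = unit_at a q" "unit_at a q \<noteq> 0"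
      using unit_decomp True by metis
    define k where "k = order a p - order a q"
    have k: "order a p = order a q + k" "k \<noteq> 0" using True by (auto simp: k_def)
    define q' where "q' = smult c q + f * p"
    define v' where "v' = smult c v + f * ([:-a, 1:] ^ k * u)"
    have "q' = [:-a, 1:] ^ order a q * v'"
      unfolding q'_def v'_def by (subst u, subst v(1)) (simp add: k power_add algebra_simps)
    moreover have "poly v' a = c * unit_at a q" using k(2) by (simp add: v'_def v(2))
    ultimately have "order a q' = order a q" "unit_at a q' = c * unit_at a q" "q' \<noteq> 0"
      using order_unit_eqI[of q' a "order a q" v'] v(3) c by auto
    then show ?thesis using True c
      unfolding jump_def q'_def[symmetric] by (auto simp: sgn_mult)
  next
    case nlt: False
    have "[:-a, 1:] ^ order a p dvd q" using nlt by (auto simp: order_divides)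
    then have "[:-a, 1:] ^ order a p dvd smult c q + f * p"
      by (intro dvd_add dvd_smult dvd_mult order_1)
    then have "smult c q + f * p = 0 \<or> order a p \<le> order a (smult c q + f * p)"
      by (simp add: order_divides)
    then show ?thesis using nlt by (auto simp: jump_def)
  qed
  then show ?thesis by (simp add: cauchy_index_def)
qed simp

text \<open>
  The logarithmic derivative has a simple pole with positive residue at each root.
\<close>

theorem cauchy_index_pderiv:
  assumes "p \<noteq> 0"
  shows "cauchy_index p (pderiv p) = card {a. poly p a = 0}"
proof -
  have "jump p (pderiv p) a = 1" if root: "poly p a = 0" for a
  proof -
    obtain u where u: "p = [:-a, 1:] ^ order a p * u" "poly u a = unit_at a p" "unit_at a p \<noteq> 0"
      using unit_decomp[OF assms] .
    obtain k where k: "order a p = Suc k"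
      using root order_eq_0_iff[OF assms, of a] by (cases "order a p") auto
    define w where "w = [:-a, 1:] * pderiv u + smult (of_nat (Suc k)) u"
    have "pderiv p = pderiv ([:-a, 1:] ^ Suc k * u)" by (subst u(1)) (simp only: k)
    also have "\<dots> = [:-a, 1:] ^ k * w"
      unfolding lemma_order_pderiv1 w_def by (simp add: algebra_simps)
    finally have pd: "pderiv p = [:-a, 1:] ^ k * w" .
    have w: "poly w a = real (Suc k) * unit_at a p"
      by (simp add: w_def u(2) del: of_nat_Suc)
    then have w0: "poly w a \<noteq> 0" using u(3) by (simp del: of_nat_Suc)
    have "order a (pderiv p) = k" "unit_at a (pderiv p) = real (Suc k) * unit_at a p"
      using order_unit_eqI[OF pd w0] w by auto
    moreover have "pderiv p \<noteq> 0" using pd w0 by (metis mult_eq_0_iff pCons_eq_0_iff poly_0 power_not_zero one_neq_zero)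
    moreover have "sgn (unit_at a p) * sgn (unit_at a p) = 1"
      using u(3) by (simp add: sgn_if)
    ultimately show ?thesis using assms k
      by (simp add: jump_def sgn_mult)
  qed
  then show ?thesis by (simp add: cauchy_index_def)
qed

section \<open>Decision trees\<close>

text \<open>
  The tests compare integer expressions in the registers with 0. The expressions may only use fixed
  registers, so that they are meaningful in every state.
\<close>

datatype 'a tree = Leaf 'a | Test exp "'a tree" "'a tree"

primrec outcome :: "registers \<Rightarrow> 'a tree \<Rightarrow> 'a" where
  "outcome s (Leaf a) = a"
| "outcome s (Test e t u) = (if ev s e > 0 then outcome s t else outcome s u)"

fun static_loc :: "location \<Rightarrow> bool" where
  "static_loc (Reg i) = data i"
| "static_loc (Ind i) = False"

primrec static_exp :: "exp \<Rightarrow> bool" where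
  "static_exp (Num k) = True"
| "static_exp (Var l) = static_loc l"
| "static_exp (Bin f a b) = (static_exp a \<and> static_exp b)"

primrec static_tree :: "'a tree \<Rightarrow> bool" where
  "static_tree (Leaf a) = True"
| "static_tree (Test e t u) = (static_exp e \<and> static_tree t \<and> static_tree u)"

definition decidable_by_tree :: "(registers \<Rightarrow> 'a) \<Rightarrow> bool" where
  "decidable_by_tree f \<longleftrightarrow> (\<exists>t. static_tree t \<and> (\<forall>s. outcome s t = f s))"

lemma decidable_const: "decidable_by_tree (\<lambda>s. a)"
  unfolding decidable_by_tree_def by (intro exI[of _ "Leaf a"]) simp

lemma decidable_if_pos:
  assumes "static_exp e" "decidable_by_tree f" "decidable_by_tree g"
  shows "decidable_by_tree (\<lambda>s. if ev s e > 0 then f s else g s)"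
proof -
  obtain t u where "static_tree t" "\<And>s. outcome s t = f s" "static_tree u" "\<And>s. outcome s u = g s"
    using assms(2,3) unfolding decidable_by_tree_def by metis
  with assms(1) show ?thesis
    unfolding decidable_by_tree_def by (intro exI[of _ "Test e t u"]) auto
qed

lemma decidable_if_zero:
  assumes "static_exp e" "decidable_by_tree f" "decidable_by_tree g"
  shows "decidable_by_tree (\<lambda>s. if ev s e = 0 then f s else g s)"
proof -
  have "decidable_by_tree (\<lambda>s. if ev s (Times e e) > 0 then g s else f s)"
    using assms by (intro decidable_if_pos) auto
  moreover have "(\<lambda>s. if ev s (Times e e) > 0 then g s else f s) = (\<lambda>s. if ev s e = 0 then f s else g s)"
    by (auto simp: fun_eq_iff zero_less_mult_iff)
  ultimately show ?thesis by simp
qed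

lemma decidable_comp:
  assumes "decidable_by_tree f"
  shows "decidable_by_tree (\<lambda>s. h (f s))"
proof -
  obtain t where t: "static_tree t" "\<And>s. outcome s t = f s"
    using assms unfolding decidable_by_tree_def by blast
  have "static_tree (map_tree h t) \<longleftrightarrow> static_tree t" "outcome s (map_tree h t) = h (outcome s t)" for s
    by (induction t) auto
  with t show ?thesis unfolding decidable_by_tree_def by (intro exI[of _ "map_tree h t"]) auto
qed

lemma decidable_sgn:
  assumes "static_exp e"
  shows "decidable_by_tree (\<lambda>s. sgn (real_of_int (ev s e)))"
proof -
  have "decidable_by_tree (\<lambda>s. if ev s e = 0 then 0 else if ev s e > 0 then 1 else (- 1 :: real))"
    using assms by (intro decidable_if_zero decidable_if_pos decidable_const)
  then show ?thesis by (rule back_subst[where P = decidable_by_tree]) (auto simp: fun_eq_iff)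
qed

lemma decidable_bind:
  assumes "decidable_by_tree f" "\<And>a. decidable_by_tree (g a)"
  shows "decidable_by_tree (\<lambda>s. g (f s) s)"
proof -
  obtain t where t: "static_tree t" "\<And>s. outcome s t = f s"
    using assms(1) unfolding decidable_by_tree_def by blast
  have "decidable_by_tree (\<lambda>s. g (outcome s t) s)"
    using t(1)
  proof (induction t)
    case (Test e t u)
    then have "decidable_by_tree (\<lambda>s. if ev s e > 0 then g (outcome s t) s else g (outcome s u) s)"
      by (intro decidable_if_pos) auto
    then show ?case by (simp add: if_distrib if_distribR)
  qed (use assms(2) in auto)
  then show ?thesis by (simp add: t(2))
qed

lemma decidable_comp2:
  assumes "decidable_by_tree f" "decidable_by_tree g"
  shows "decidable_by_tree (\<lambda>s. h (f s) (g s))"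
  using decidable_bind[where g = "\<lambda>a s. h a (g s)", OF assms(1)] decidable_comp[OF assms(2)] by blast

text \<open>
  Coefficients are listed from the highest one down, because pseudo-division works at the top end.
\<close>

primrec epoly :: "registers \<Rightarrow> exp list \<Rightarrow> real poly" where
  "epoly s [] = 0"
| "epoly s (e # es) = monom (real_of_int (ev s e)) (length es) + epoly s es"

lemma degree_epoly_less: "es \<noteq> [] \<Longrightarrow> degree (epoly s es) < length es"
proof (induction es)
  case (Cons e es)
  have "degree (epoly s es) \<le> length es"
    using Cons.IH by (cases "es = []") auto
  then show ?case
    by (auto intro!: le_imp_less_Suc degree_add_le degree_monom_le)
qed simp

lemma coeff_epoly_beyond: "coeff (epoly s es) (length es) = 0"
  by (cases "es = []") (auto intro: coeff_eq_0 degree_epoly_less)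

lemma epoly_top:
  assumes "ev s e \<noteq> 0"
  shows "degree (epoly s (e # es)) = length es" "lead_coeff (epoly s (e # es)) = real_of_int (ev s e)"
    "epoly s (e # es) \<noteq> 0"
proof -
  have c: "coeff (epoly s (e # es)) (length es) = real_of_int (ev s e)"
    by (simp add: coeff_epoly_beyond)
  then show d: "degree (epoly s (e # es)) = length es"
    using degree_epoly_less[of "e # es" s] assms by (intro antisym le_degree) auto
  show "lead_coeff (epoly s (e # es)) = real_of_int (ev s e)" unfolding d by (rule c)
  show "epoly s (e # es) \<noteq> 0" using c assms by (metis coeff_0 of_int_eq_0_iff)
qed

lemma epoly_append_zeros: "epoly s (es @ replicate k (Num 0)) = monom 1 k * epoly s es"
proof (induction es)
  case Nil
  show ?case by (induction k) auto
next
  case (Cons e es)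
  then show ?case by (simp add: algebra_simps mult_monom)
qed

text \<open>
  For \<open>p\<close> with coefficients \<open>a # ps\<close> and \<open>q\<close> with coefficients \<open>b # qs\<close>, this is \<open>a\<^sup>2 q - a b x\<^sup>k p\<close>, whose top
  coefficient vanishes. The square makes the multiplier of \<open>q\<close> positive, as \<open>cauchy_index_cong\<close> requires.
\<close>

definition cancel_top :: "exp \<Rightarrow> exp \<Rightarrow> exp list \<Rightarrow> exp list \<Rightarrow> exp list" where
  "cancel_top a b ps qs =
     map2 (\<lambda>y z. Minus (Times (Times a a) y) (Times (Times a b) z)) qs
       (ps @ replicate (length qs - length ps) (Num 0))"

lemma epoly_map2:
  "length ys = length zs \<Longrightarrow> epoly s (map2 (\<lambda>y z. Minus (Times e y) (Times f z)) ys zs) =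
     smult (real_of_int (ev s e)) (epoly s ys) - smult (real_of_int (ev s f)) (epoly s zs)"
  by (induction ys zs rule: list_induct2) (auto simp: smult_add_right smult_monom diff_monom[symmetric])

lemma cauchy_index_cancel_top:
  assumes "ev s a \<noteq> 0" and "length ps \<le> length qs"
  shows "cauchy_index (epoly s (a # ps)) (epoly s (cancel_top a b ps qs)) =
    cauchy_index (epoly s (a # ps)) (epoly s (b # qs))"
proof -
  define A where "A = real_of_int (ev s a)"
  define B where "B = real_of_int (ev s b)"
  define k where "k = length qs - length ps"
  have len: "length qs = length ps + k" using assms(2) by (simp add: k_def)
  have "epoly s (cancel_top a b ps qs) =
      smult (A * A) (epoly s qs) - smult (A * B) (monom 1 k * epoly s ps)"
    using len unfolding cancel_top_def k_def[symmetric]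
    by (subst epoly_map2) (auto simp: epoly_append_zeros A_def B_def)
  also have "\<dots> = smult (A\<^sup>2) (epoly s (b # qs)) + (- monom (A * B) k) * epoly s (a # ps)"
  proof -
    have "monom (A * B) k * epoly s ps = smult (A * B) (monom 1 k * epoly s ps)"
      by (metis mult.right_neutral mult_smult_left smult_monom)
    then show ?thesis
      by (simp add: len distrib_left smult_add_right smult_monom mult_monom power2_eq_square mult_ac add_ac
          flip: A_def B_def)
  qed
  finally have "epoly s (cancel_top a b ps qs) = \<dots>" .
  moreover have "A\<^sup>2 > 0" using assms(1) by (simp add: A_def)
  ultimately show ?thesis
    by (simp only: cauchy_index_cong)
qed

lemma static_cancel_top:
  assumes "static_exp a" "static_exp b" "list_all static_exp ps" "list_all static_exp qs"
  shows "list_all static_exp (cancel_top a b ps qs)"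
proof -
  have "list_all static_exp (map2 (\<lambda>y z. Minus (Times (Times a a) y) (Times (Times a b) z)) ys zs)"
    if "list_all static_exp ys" "list_all static_exp zs" for ys zs
    using that assms(1,2) by (force simp: list_all_iff dest: set_zip_leftD set_zip_rightD)
  moreover have "list_all static_exp (ps @ replicate k (Num 0))" for k
    using assms(3) by (auto simp: list_all_iff)
  ultimately show ?thesis using assms(4) unfolding cancel_top_def by blast
qed

text \<open>
  This is the Euclidean algorithm, unrolled. Which coefficients vanish is not known in advance, so
  each step first tests the two top coefficients and shortens a list if its top coefficient is zero.
  Otherwise the reciprocity law allows reducing the longer polynomial by the shorter one.
\<close>

lemma decidable_cauchy_index:
  "list_all static_exp ps \<Longrightarrow> list_all static_exp qs \<Longrightarrow>
    decidable_by_tree (\<lambda>s. cauchy_index (epoly s ps) (epoly s qs))"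
proof (induction "length ps + length qs" arbitrary: ps qs rule: less_induct)
  case less
  show ?case
  proof (cases "ps = [] \<or> qs = []")
    case True
    then show ?thesis by (auto simp: decidable_const)
  next
    case False
    then obtain a ps' b qs' where pq: "ps = a # ps'" "qs = b # qs'" by (auto simp: neq_Nil_conv)
    have st: "static_exp a" "list_all static_exp ps'" "static_exp b" "list_all static_exp qs'"
      using less.prems by (auto simp: pq)
    define h where "h = (\<lambda>s. if length ps' \<le> length qs'
      then cauchy_index (epoly s ps) (epoly s (cancel_top a b ps' qs'))
      else (if odd (length ps' + length qs') then sgn (real_of_int (ev s (Times a b))) else 0) -
        cauchy_index (epoly s qs) (epoly s (cancel_top b a qs' ps')))"
    have "decidable_by_tree h"
    proof (cases "length ps' \<le> length qs'")
      case True
      have "length (cancel_top a b ps' qs') = length qs'" using True by (simp add: cancel_top_def)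
      then show ?thesis unfolding h_def
        using less.hyps[of ps "cancel_top a b ps' qs'"] less.prems st True static_cancel_top
        by (simp add: pq)
    next
      case False
      have "length (cancel_top b a qs' ps') = length ps'" using False by (simp add: cancel_top_def)
      then have "decidable_by_tree (\<lambda>s. cauchy_index (epoly s qs) (epoly s (cancel_top b a qs' ps')))"
        using less.hyps[of qs "cancel_top b a qs' ps'"] less.prems st static_cancel_top
        by (simp add: pq)
      moreover have "decidable_by_tree (\<lambda>s. if odd (length ps' + length qs') then sgn (real_of_int (ev s (Times a b))) else 0)"
        using st by (cases "odd (length ps' + length qs')") (auto intro: decidable_const simp del: ev.simps intro!: decidable_sgn)
      ultimately have "decidable_by_tree (\<lambda>s. (if odd (length ps' + length qs') then sgn (real_of_int (ev s (Times a b))) else 0) - 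
        cauchy_index (epoly s qs) (epoly s (cancel_top b a qs' ps')))"
        by (rule decidable_comp2[where h = "\<lambda>a b. b - a"])
      then show ?thesis unfolding h_def using False by simp
    qed
    moreover have "decidable_by_tree (\<lambda>s. cauchy_index (epoly s ps') (epoly s qs))"
      "decidable_by_tree (\<lambda>s. cauchy_index (epoly s ps) (epoly s qs'))"
      using less.hyps[of ps' qs] less.hyps[of ps qs'] less.prems st by (auto simp: pq)
    ultimately have "decidable_by_tree (\<lambda>s. if ev s a = 0 then cauchy_index (epoly s ps') (epoly s qs)
        else if ev s b = 0 then cauchy_index (epoly s ps) (epoly s qs') else h s)"
      using st by (intro decidable_if_zero)
    moreover have "(if ev s a = 0 then cauchy_index (epoly s ps') (epoly s qs)
        else if ev s b = 0 then cauchy_index (epoly s ps) (epoly s qs') else h s) =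
        cauchy_index (epoly s ps) (epoly s qs)" for s
    proof -
      consider "ev s a = 0" | "ev s a \<noteq> 0" "ev s b = 0" | "ev s a \<noteq> 0" "ev s b \<noteq> 0" by blast
      then show ?thesis
      proof cases
        case 3
        have "cauchy_index (epoly s qs) (epoly s ps) = cauchy_index (epoly s qs) (epoly s (cancel_top b a qs' ps'))"
          if "\<not> length ps' \<le> length qs'"
          using cauchy_index_cancel_top[of s b qs' ps' a] that 3 by (simp add: pq)
        then show ?thesis
          using 3 cauchy_index_cancel_top[of s a ps' qs' b] cauchy_index_reciprocity[of "epoly s ps" "epoly s qs"]
            epoly_top[of s a ps'] epoly_top[of s b qs']
          by (auto simp: h_def pq simp del: epoly.simps)
      qed (auto simp: pq)
    qed
    ultimately show ?thesis by simp
  qed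
qed

primrec epderiv :: "exp list \<Rightarrow> exp list" where
  "epderiv [] = []"
| "epderiv (e # es) = (if es = [] then [] else Times (Num (int (length es))) e # epderiv es)"

lemma length_epderiv: "length (epderiv es) = length es - 1"
  by (induction es) auto

lemma epoly_epderiv: "epoly s (epderiv es) = pderiv (epoly s es)"
  by (induction es) (auto simp: pderiv_add pderiv_monom length_epderiv)

text \<open>
  The zero polynomial has to be tested separately since its index is 0 by convention.
\<close>

lemma decidable_no_real_root:
  assumes "list_all static_exp es"
  shows "decidable_by_tree (\<lambda>s. \<forall>x. poly (epoly s es) x \<noteq> 0)"
proof -
  have st: "list_all static_exp (epderiv es)" using assms by (induction es) auto
  have nz: "decidable_by_tree (\<lambda>s. epoly s es \<noteq> 0)"
    using assms
  proof (induction es)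
    case (Cons e es)
    then have "decidable_by_tree (\<lambda>s. if ev s e = 0 then epoly s es \<noteq> 0 else True)"
      by (intro decidable_if_zero decidable_const) auto
    moreover have "(if ev s e = 0 then epoly s es \<noteq> 0 else True) \<longleftrightarrow> epoly s (e # es) \<noteq> 0" for s
      using epoly_top(3)[of s e es] by auto
    ultimately show ?case by (simp del: epoly.simps)
  qed (simp add: decidable_const)
  have "decidable_by_tree (\<lambda>s. cauchy_index (epoly s es) (epoly s (epderiv es)) = 0 \<and> epoly s es \<noteq> 0)"
    using decidable_cauchy_index[OF assms st] nz
    by (rule decidable_comp2[where h = "\<lambda>c b. c = 0 \<and> b"])
  moreover have "cauchy_index (epoly s es) (epoly s (epderiv es)) = 0 \<and> epoly s es \<noteq> 0 \<longleftrightarrow>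
      (\<forall>x. poly (epoly s es) x \<noteq> 0)" for s
  proof (cases "epoly s es = 0")
    case False
    then show ?thesis
      using cauchy_index_pderiv[of "epoly s es"] poly_roots_finite[of "epoly s es"]
      by (auto simp: epoly_epderiv)
  qed auto
  ultimately show ?thesis by simp
qed

section \<open>Exponent vectors and their codes\<close>

lemma set_exponent_vectors: "set (exponent_vectors n d) = {ks. length ks = n \<and> sum_list ks \<le> d}"
proof (induction n arbitrary: d)
  case (Suc n)
  have "ks \<in> set (exponent_vectors (Suc n) d) \<longleftrightarrow> length ks = Suc n \<and> sum_list ks \<le> d" for ks
    by (cases ks) (auto simp: Suc.IH less_Suc_eq_le image_iff simp del: upt_Suc)
  then show ?case by blast
qed auto

text \<open>
  The exponents are the digits in base \<open>B\<close>. The last variable has weight \<open>B\<close> rather than 1, so that a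
  suffix of \<open>m\<close> variables has exactly the weights \<open>B, \<dots>, B ^ m\<close>.
\<close>

primrec list_code :: "nat \<Rightarrow> nat list \<Rightarrow> nat" where
  "list_code B [] = 0"
| "list_code B (k # ks) = k * B ^ Suc (length ks) + list_code B ks"

lemma list_code_less:
  assumes "\<And>k. k \<in> set ks \<Longrightarrow> k < B" and "B > 0"
  shows "list_code B ks < B ^ Suc (length ks)"
  using assms(1)
proof (induction ks)
  case (Cons k ks)
  have "list_code B (k # ks) < k * B ^ Suc (length ks) + B ^ Suc (length ks)"
    using Cons by simp
  also have "\<dots> = Suc k * B ^ Suc (length ks)" by simp
  also have "\<dots> \<le> B * B ^ Suc (length ks)"
    using Cons.prems[of k] by (intro mult_right_mono) auto
  finally show ?case by simp
qed (use assms(2) in simp)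

lemma list_code_inject:
  assumes "list_code B ks = list_code B ls" and "length ks = length ls"
    and "\<And>k. k \<in> set ks \<Longrightarrow> k < B" and "\<And>k. k \<in> set ls \<Longrightarrow> k < B"
  shows "ks = ls"
  using assms(2,1,3,4)
proof (induction ks ls rule: list_induct2)
  case (Cons k ks l ls)
  have B: "B > 0" using Cons.prems(2)[of k] by simp
  have less: "list_code B ks < B ^ Suc (length ks)" "list_code B ls < B ^ Suc (length ks)"
    using list_code_less[of ks B] list_code_less[of ls B] Cons B by auto
  have "k = list_code B (k # ks) div B ^ Suc (length ks)"
    using less(1) B by (simp del: power_Suc)
  moreover have "l = list_code B (l # ls) div B ^ Suc (length ks)"
    using less(2) B Cons.hyps by (simp del: power_Suc)
  ultimately have "k = l" using Cons.prems(1) by metis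
  moreover from this have "list_code B ks = list_code B ls" using Cons.prems(1) Cons.hyps by simp
  ultimately show ?case using Cons by auto
qed simp

lemma list_code_sum: "list_code B ks = (\<Sum>i<length ks. ks ! i * B ^ (length ks - i))"
  by (induction ks) (auto simp: lessThan_Suc_eq_insert_0 sum.reindex inj_on_def simp del: sum.lessThan_Suc)

section \<open>Monomials\<close>

definition monomials :: "nat \<Rightarrow> nat \<Rightarrow> monomial set" where
  "monomials n d = {m. Poly_Mapping.keys m \<subseteq> {..<n} \<and> monomial_degree m \<le> d}"

abbreviation expo :: "monomial \<Rightarrow> nat \<Rightarrow> nat" where
  "expo \<equiv> Poly_Mapping.lookup"

abbreviation var :: "nat \<Rightarrow> monomial" where
  "var i \<equiv> Poly_Mapping.single i 1"

lemma expo_beyond: "m \<in> monomials n d \<Longrightarrow> n \<le> i \<Longrightarrow> expo m i = 0"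
  unfolding monomials_def by (metis (mono_tags, lifting) in_keys_iff lessThan_iff linorder_not_less mem_Collect_eq subsetD)

lemma monomial_degree_eq:
  assumes "Poly_Mapping.keys m \<subseteq> {..<n}"
  shows "monomial_degree m = (\<Sum>i<n. expo m i)"
  unfolding monomial_degree_def using assms
  by (intro sum.mono_neutral_left) (auto simp: in_keys_iff)

lemma in_monomials_iff:
  "m \<in> monomials n d \<longleftrightarrow> (\<forall>i\<ge>n. expo m i = 0) \<and> (\<Sum>i<n. expo m i) \<le> d"
proof -
  have "Poly_Mapping.keys m \<subseteq> {..<n} \<longleftrightarrow> (\<forall>i\<ge>n. expo m i = 0)"
    by (metis in_keys_iff lessThan_iff linorder_not_less subset_iff)
  then show ?thesis using monomial_degree_eq[of m n] by (auto simp: monomials_def)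
qed

lemma nth_in_monomials:
  assumes "ks \<in> set (exponent_vectors n d)"
  shows "Poly_Mapping.nth ks \<in> monomials n d"
  using assms by (auto simp: in_monomials_iff set_exponent_vectors nth_default_def sum_list_sum_nth atLeast0LessThan)

lemma nth_exponents:
  assumes "m \<in> monomials n d"
  shows "map (expo m) [0..<n] \<in> set (exponent_vectors n d)" "Poly_Mapping.nth (map (expo m) [0..<n]) = m"
proof -
  show "map (expo m) [0..<n] \<in> set (exponent_vectors n d)"
    using assms by (auto simp: in_monomials_iff set_exponent_vectors sum_list_sum_nth atLeast0LessThan)
  show "Poly_Mapping.nth (map (expo m) [0..<n]) = m"
    using assms by (intro poly_mapping_eqI) (auto simp: nth_default_def expo_beyond)
qed

lemma monomials_eq: "monomials n d = Poly_Mapping.nth ` set (exponent_vectors n d)"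
  using nth_in_monomials nth_exponents by (metis (no_types, lifting) image_eqI image_subsetI subsetI subset_antisym)

lemma finite_monomials [simp]: "finite (monomials n d)"
  by (simp add: monomials_eq)

definition code_of :: "nat \<Rightarrow> nat \<Rightarrow> monomial \<Rightarrow> nat" where
  "code_of B n m = (\<Sum>i<n. expo m i * B ^ (n - i))"

lemma code_of_eq_list_code: "code_of B n m = list_code B (map (expo m) [0..<n])"
  by (simp add: code_of_def list_code_sum)

lemma expo_le: "m \<in> monomials n d \<Longrightarrow> expo m i \<le> d"
proof (cases "i < n")
  case True
  assume "m \<in> monomials n d"
  moreover have "expo m i \<le> (\<Sum>i<n. expo m i)" using True by (intro member_le_sum) auto
  ultimately show ?thesis by (simp add: in_monomials_iff)
qed (simp add: expo_beyond)

lemma inj_code_of: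
  assumes "d < B"
  shows "inj_on (code_of B n) (monomials n d)"
proof (rule inj_onI)
  fix m m' assume m: "m \<in> monomials n d" "m' \<in> monomials n d" "code_of B n m = code_of B n m'"
  have "map (expo m) [0..<n] = map (expo m') [0..<n]"
  proof (rule list_code_inject)
    show "list_code B (map (expo m) [0..<n]) = list_code B (map (expo m') [0..<n])"
      using m(3) by (simp only: code_of_eq_list_code)
  qed (use m(1,2)[THEN expo_le] assms in \<open>auto intro: le_less_trans\<close>)
  then show "m = m'" using nth_exponents(2) m by metis
qed

lemma code_of_add: "code_of B n (m + m') = code_of B n m + code_of B n m'"
  by (simp add: code_of_def lookup_add sum.distrib algebra_simps)

lemma code_of_single: "i < n \<Longrightarrow> code_of B n (Poly_Mapping.single i k) = k * B ^ (n - i)"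
  by (simp add: code_of_def lookup_single when_def if_distribR sum.delta cong: if_cong)
    (simp add: if_distrib[of "\<lambda>a. a * _"] sum.delta cong: if_cong)

lemma add_var_in_monomials:
  "i < n \<Longrightarrow> m \<in> monomials n d \<Longrightarrow> m + var i \<in> monomials n (Suc d)"
  by (auto simp: in_monomials_iff lookup_add lookup_single sum.distrib when_def)

lemma single_in_monomials: "i < n \<Longrightarrow> k \<le> d \<Longrightarrow> Poly_Mapping.single i k \<in> monomials n d"
  by (auto simp: in_monomials_iff lookup_single when_def)

section \<open>Polynomial functions\<close>

abbreviation space :: "nat \<Rightarrow> (nat \<Rightarrow> real) set" where
  "space n \<equiv> {x. \<forall>i\<ge>n. x i = 0}"

definition power_product :: "nat \<Rightarrow> monomial \<Rightarrow> (nat \<Rightarrow> real) \<Rightarrow> real" where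
  "power_product n m x = (\<Prod>i<n. x i ^ expo m i)"

definition peval :: "nat \<Rightarrow> nat \<Rightarrow> (monomial \<Rightarrow> real) \<Rightarrow> (nat \<Rightarrow> real) \<Rightarrow> real" where
  "peval n d c x = (\<Sum>m\<in>monomials n d. c m * power_product n m x)"

definition leading_form :: "nat \<Rightarrow> nat \<Rightarrow> (monomial \<Rightarrow> real) \<Rightarrow> (nat \<Rightarrow> real) \<Rightarrow> real" where
  "leading_form n d c = peval n d (\<lambda>m. if monomial_degree m = d then c m else 0)"

text \<open>
  Kronecker's substitution: replacing the variables by powers of one variable according to the
  weights of the code turns distinct monomials into distinct powers, and a nonzero univariate
  polynomial has a point where it does not vanish.
\<close>

lemma nonzero_peval:
  assumes "m \<in> monomials n d" and "c m \<noteq> 0"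
  obtains x where "x \<in> space n" "peval n d c x \<noteq> 0"
proof -
  define Q where "Q = (\<Sum>m\<in>monomials n d. monom (c m) (code_of (Suc d) n m))"
  have "coeff Q (code_of (Suc d) n m) = (\<Sum>m'\<in>monomials n d. if m' = m then c m' else 0)"
    unfolding Q_def coeff_sum using assms(1) inj_code_of[of d "Suc d" n]
    by (intro sum.cong) (auto simp: inj_on_def)
  then have "coeff Q (code_of (Suc d) n m) \<noteq> 0" using assms by simp
  then have "Q \<noteq> 0" by auto
  then obtain s where s: "poly Q s \<noteq> 0" using poly_all_0_iff_0 by blast
  define x where "x i = (if i < n then s ^ (Suc d ^ (n - i)) else 0)" for i
  have "power_product n m' x = s ^ code_of (Suc d) n m'" for m'
    unfolding power_product_def code_of_def x_def power_sum
    by (intro prod.cong) (auto simp: mult.commute simp flip: power_mult)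
  then have "peval n d c x = poly Q s" by (simp add: peval_def Q_def poly_sum poly_monom)
  with s that[of x] show ?thesis by (auto simp: x_def)
qed

text \<open>
  The restriction of a polynomial to the line \<open>x + t v\<close>, as a polynomial in \<open>t\<close>. Its coefficient of
  \<open>t ^ d\<close> is the leading form at \<open>v\<close>, independently of \<open>x\<close> (\<open>coeff_line_poly\<close>).
\<close>

definition line_poly :: "nat \<Rightarrow> nat \<Rightarrow> (monomial \<Rightarrow> real) \<Rightarrow> (nat \<Rightarrow> real) \<Rightarrow> (nat \<Rightarrow> real) \<Rightarrow> real poly" where
  "line_poly n d c x v = (\<Sum>m\<in>monomials n d. smult (c m) (\<Prod>i<n. [:x i, v i:] ^ expo m i))"

lemma poly_line_poly: "poly (line_poly n d c x v) t = peval n d c (\<lambda>i. x i + t * v i)"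
  by (simp add: line_poly_def peval_def power_product_def poly_sum poly_prod poly_power)

lemma coeff_mult_le:
  assumes "degree f \<le> a" and "degree g \<le> b"
  shows "coeff (f * g) (a + b) = coeff f a * (coeff g b :: real)"
proof -
  have "coeff (f * g) (a + b) = (\<Sum>i\<le>a + b. if i = a then coeff f a * coeff g b else 0)"
    unfolding coeff_mult
  proof (intro sum.cong refl)
    fix i assume "i \<in> {..a + b}"
    then have "i < a \<Longrightarrow> degree g < a + b - i" using assms by auto
    then show "coeff f i * coeff g (a + b - i) = (if i = a then coeff f a * coeff g b else 0)"
      using assms by (cases i a rule: linorder_cases) (auto simp: coeff_eq_0)
  qed
  then show ?thesis by simp
qed

lemma degree_line_power: "degree ([:x, v:] ^ k) \<le> k" and coeff_line_power: "coeff ([:x, v:] ^ k) k = (v :: real) ^ k"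
proof -
  have deg: "degree ([:x, v:] ^ k) \<le> k" for k
    using degree_power_le[of "[:x, v:]" k] by (rule order_trans) auto
  then show "degree ([:x, v:] ^ k) \<le> k" .
  show "coeff ([:x, v:] ^ k) k = v ^ k"
  proof (induction k)
    case (Suc k)
    have "coeff ([:x, v:] * [:x, v:] ^ k) (1 + k) = coeff [:x, v:] 1 * coeff ([:x, v:] ^ k) k"
      by (rule coeff_mult_le) (use deg in auto)
    with Suc show ?case by simp
  qed simp
qed

lemma line_power_product:
  fixes n :: nat
  shows "degree (\<Prod>i<n. [:x i, v i:] ^ k i) \<le> (\<Sum>i<n. k i) \<and>
   coeff (\<Prod>i<n. [:x i, v i:] ^ k i) (\<Sum>i<n. k i) = (\<Prod>i<n. (v i :: real) ^ k i)"
proof (induction n)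
  case (Suc n)
  have "degree (\<Prod>i<Suc n. [:x i, v i:] ^ k i) \<le> (\<Sum>i<n. k i) + k n"
    unfolding prod.lessThan_Suc
    by (rule order_trans[OF degree_mult_le add_mono]) (use Suc degree_line_power in auto)
  moreover have "coeff (\<Prod>i<Suc n. [:x i, v i:] ^ k i) ((\<Sum>i<n. k i) + k n) = (\<Prod>i<n. v i ^ k i) * v n ^ k n"
    unfolding prod.lessThan_Suc
    by (subst coeff_mult_le) (use Suc degree_line_power coeff_line_power in auto)
  ultimately show ?case by simp
qed simp

lemma degree_line_poly: "degree (line_poly n d c x v) \<le> d"
  unfolding line_poly_def
  by (intro degree_sum_le order_trans[OF degree_smult_le])
    (use line_power_product[of x v _ n] in \<open>auto simp: in_monomials_iff intro: order_trans\<close>)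

lemma coeff_line_poly: "coeff (line_poly n d c x v) d = leading_form n d c v"
proof -
  have "coeff (\<Prod>i<n. [:x i, v i:] ^ expo m i) d = (if monomial_degree m = d then power_product n m v else 0)"
    if "m \<in> monomials n d" for m
  proof -
    have "monomial_degree m = (\<Sum>i<n. expo m i)" using that by (intro monomial_degree_eq) (auto simp: monomials_def)
    moreover have "monomial_degree m \<le> d" using that by (simp add: monomials_def)
    ultimately show ?thesis using line_power_product[of x v "expo m" n]
      by (auto simp: power_product_def intro!: coeff_eq_0)
  qed
  then show ?thesis
    unfolding line_poly_def leading_form_def peval_def coeff_sum
    by (intro sum.cong) auto
qed

text \<open>
  The leading form on the line \<open>v + \<epsilon> u\<close> is a polynomial in \<open>\<epsilon>\<close> with leading coefficient
  \<open>leading_form n d c u\<close>, so only finitely many \<open>\<epsilon>\<close> are zeros.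
\<close>

lemma leading_form_perturb:
  assumes "leading_form n d c u \<noteq> 0" and "\<delta> > 0"
  obtains \<epsilon> where "0 < \<epsilon>" "\<epsilon> < \<delta>" "leading_form n d c (\<lambda>i. v i + \<epsilon> * u i) \<noteq> 0"
proof -
  define c' where "c' m = (if monomial_degree m = d then c m else 0)" for m
  have "leading_form n d c' u = leading_form n d c u"
    unfolding leading_form_def c'_def by (metis (mono_tags, lifting))
  then have "line_poly n d c' v u \<noteq> 0" using coeff_line_poly[of n d c' v u] assms(1) by auto
  then have "finite {t. poly (line_poly n d c' v u) t = 0}" by (rule poly_roots_finite)
  then have "infinite ({0<..<\<delta>} - {t. poly (line_poly n d c' v u) t = 0})"
    using assms(2) by (simp add: infinite_Ioo Diff_infinite_finite)
  then obtain \<epsilon> where "\<epsilon> \<in> {0<..<\<delta>} - {t. poly (line_poly n d c' v u) t = 0}"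
    using infinite_imp_nonempty by blast
  then have "0 < \<epsilon>" "\<epsilon> < \<delta>" "poly (line_poly n d c' v u) \<epsilon> \<noteq> 0" by auto
  then show ?thesis using that unfolding poly_line_poly leading_form_def c'_def by blast
qed

section \<open>Gradients of polynomials\<close>

definition monomial_fact :: "nat \<Rightarrow> monomial \<Rightarrow> nat" where
  "monomial_fact n m = (\<Prod>i<n. fact (expo m i))"

lemma monomial_fact_pos: "monomial_fact n m > 0"
  by (auto simp: monomial_fact_def intro!: prod_pos)

lemma monomial_fact_add_var:
  assumes "i < n"
  shows "monomial_fact n (m + var i) = Suc (expo m i) * monomial_fact n m"
proof -
  have "fact (expo (m + var i) j) = (if j = i then Suc (expo m i) else 1) * (fact (expo m j) :: nat)" for j
    by (auto simp: lookup_add lookup_single when_def)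
  then have "monomial_fact n (m + var i) = (\<Prod>j<n. if j = i then Suc (expo m i) else 1) * monomial_fact n m"
    by (simp add: monomial_fact_def prod.distrib)
  with assms show ?thesis by simp
qed

text \<open>
  The derivatives at the origin. Passing from \<open>p\<close> to a partial derivative merely shifts them, and the
  factorials keep them integral.
\<close>

definition taylor :: "nat \<Rightarrow> int_mpoly \<Rightarrow> monomial \<Rightarrow> int" where
  "taylor n p m = Poly_Mapping.lookup p m * int (monomial_fact n m)"

definition partial :: "nat \<Rightarrow> nat \<Rightarrow> int_mpoly \<Rightarrow> nat \<Rightarrow> (nat \<Rightarrow> real) \<Rightarrow> real" where
  "partial n d p i = peval n d (\<lambda>m. real_of_int (taylor n p (m + var i)) / real (monomial_fact n m))"

lemma eval_mpoly_eq_peval: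
  assumes "variables p \<subseteq> {..<n}" and "total_degree p \<le> d"
  shows "eval_mpoly p x = peval n d (\<lambda>m. real_of_int (Poly_Mapping.lookup p m)) x"
proof -
  have keys: "Poly_Mapping.keys p \<subseteq> monomials n d"
  proof
    fix m assume m: "m \<in> Poly_Mapping.keys p"
    have "Poly_Mapping.keys m \<subseteq> {..<n}" using m assms(1) by (auto simp: variables_def)
    moreover have "monomial_degree m \<le> total_degree p"
      unfolding total_degree_def using m by (intro Max_ge) auto
    ultimately show "m \<in> monomials n d" using assms(2) by (simp add: monomials_def)
  qed
  have "power_product n m x = (\<Prod>i\<in>Poly_Mapping.keys m. x i ^ expo m i)" if "m \<in> monomials n d" for m
    unfolding power_product_def using that
    by (intro prod.mono_neutral_right) (auto simp: monomials_def in_keys_iff)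
  then have "peval n d (\<lambda>m. real_of_int (Poly_Mapping.lookup p m)) x =
      (\<Sum>m\<in>monomials n d. real_of_int (Poly_Mapping.lookup p m) * (\<Prod>i\<in>Poly_Mapping.keys m. x i ^ expo m i))"
    by (simp add: peval_def)
  also have "\<dots> = eval_mpoly p x"
    unfolding eval_mpoly_def using keys by (intro sum.mono_neutral_right) (auto simp: in_keys_iff)
  finally show ?thesis by simp
qed

lemma power_product_add_var:
  assumes "i < n"
  shows "power_product n (m + var i) x = x i * power_product n m x"
proof -
  have "x j ^ expo (m + var i) j = (if j = i then x i else 1) * x j ^ expo m j" for j
    by (auto simp: lookup_add lookup_single when_def)
  then have "power_product n (m + var i) x = (\<Prod>j<n. if j = i then x i else 1) * power_product n m x"
    by (simp add: power_product_def prod.distrib)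
  with assms show ?thesis by simp
qed

lemma split_var:
  assumes "expo m i \<noteq> 0"
  obtains m' where "m = m' + var i"
proof -
  have "m = (m - var i) + var i"
    by (rule poly_mapping_eqI) (use assms in \<open>auto simp: lookup_add lookup_minus lookup_single when_def\<close>)
  then show ?thesis by (rule that)
qed

lemma power_product_derivative:
  "((\<lambda>t. power_product n m (\<lambda>i. x i + t * v i)) has_field_derivative
    (\<Sum>i<n. v i * (real (expo m i) * power_product n (m - var i) (\<lambda>i. x i + s * v i)))) (at s)"
proof -
  let ?y = "\<lambda>i. x i + s * v i"
  have "((\<lambda>t. \<Prod>i<n. (x i + t * v i) ^ expo m i) has_field_derivative
    (\<Sum>i<n. (real (expo m i) * ?y i ^ (expo m i - 1) * v i) * (\<Prod>j\<in>{..<n} - {i}. ?y j ^ expo m j))) (at s)"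
    by (rule has_field_derivative_prod) (auto intro!: derivative_eq_intros)
  moreover have "(real (expo m i) * ?y i ^ (expo m i - 1) * v i) * (\<Prod>j\<in>{..<n} - {i}. ?y j ^ expo m j) =
      v i * (real (expo m i) * power_product n (m - var i) ?y)" if "i < n" for i
  proof -
    have "(\<Prod>j\<in>{..<n} - {i}. ?y j ^ expo m j) = (\<Prod>j\<in>{..<n} - {i}. ?y j ^ expo (m - var i) j)"
      by (intro prod.cong) (auto simp: lookup_minus lookup_single when_def)
    moreover have "power_product n (m - var i) ?y =
        ?y i ^ expo (m - var i) i * (\<Prod>j\<in>{..<n} - {i}. ?y j ^ expo (m - var i) j)"
      unfolding power_product_def using that by (intro prod.remove) auto
    ultimately show ?thesis by (simp add: lookup_minus lookup_single when_def mult_ac)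
  qed
  then have "(\<Sum>i<n. (real (expo m i) * ?y i ^ (expo m i - 1) * v i) * (\<Prod>j\<in>{..<n} - {i}. ?y j ^ expo m j)) =
      (\<Sum>i<n. v i * (real (expo m i) * power_product n (m - var i) ?y))"
    by (intro sum.cong) auto
  ultimately show ?thesis by (simp only: power_product_def)
qed

lemma sum_monomials_with_var:
  assumes "i < n" and "\<And>m. expo m i = 0 \<Longrightarrow> f m = 0"
  shows "(\<Sum>m\<in>monomials n (Suc d). f m) = (\<Sum>m\<in>monomials n d. f (m + var i) :: real)"
proof -
  have "(\<Sum>m\<in>monomials n (Suc d). f m) = (\<Sum>m\<in>(\<lambda>m. m + var i) ` monomials n d. f m)"
  proof (intro sum.mono_neutral_right ballI)
    show "(\<lambda>m. m + var i) ` monomials n d \<subseteq> monomials n (Suc d)"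
      using add_var_in_monomials[OF assms(1)] by auto
    fix m assume m: "m \<in> monomials n (Suc d) - (\<lambda>m. m + var i) ` monomials n d"
    show "f m = 0"
    proof (rule ccontr)
      assume "f m \<noteq> 0"
      then obtain m' where m': "m = m' + var i" using assms(2) split_var by metis
      with m have "m' \<in> monomials n d"
        using assms(1) by (auto simp: in_monomials_iff lookup_add lookup_single sum.distrib when_def)
      with m m' show False by auto
    qed
  qed simp
  also have "\<dots> = (\<Sum>m\<in>monomials n d. f (m + var i))"
    by (subst sum.reindex) (auto simp: inj_on_def)
  finally show ?thesis .
qed

text \<open>
  The monomials with exponent 0 at \<open>i\<close> contribute nothing to the partial derivative in direction \<open>i\<close>,
  and the others are those of the form \<open>m + var i\<close>.
\<close>

lemma eval_mpoly_derivative: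
  assumes "variables p \<subseteq> {..<n}" and "total_degree p \<le> Suc d"
  shows "((\<lambda>t. eval_mpoly p (\<lambda>i. x i + t * v i)) has_field_derivative
    (\<Sum>i<n. v i * partial n d p i (\<lambda>i. x i + s * v i))) (at s)"
proof -
  let ?y = "\<lambda>i. x i + s * v i" and ?c = "\<lambda>m. real_of_int (Poly_Mapping.lookup p m)"
  have "((\<lambda>t. peval n (Suc d) ?c (\<lambda>i. x i + t * v i)) has_field_derivative
    (\<Sum>m\<in>monomials n (Suc d). ?c m * (\<Sum>i<n. v i * (real (expo m i) * power_product n (m - var i) ?y)))) (at s)"
    unfolding peval_def by (intro DERIV_sum DERIV_cmult power_product_derivative)
  also have "(\<Sum>m\<in>monomials n (Suc d). ?c m * (\<Sum>i<n. v i * (real (expo m i) * power_product n (m - var i) ?y))) =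
     (\<Sum>i<n. v i * (\<Sum>m\<in>monomials n (Suc d). ?c m * real (expo m i) * power_product n (m - var i) ?y))"
    by (simp add: sum_distrib_left mult_ac) (rule sum.swap)
  also have "\<dots> = (\<Sum>i<n. v i * partial n d p i ?y)"
  proof (intro sum.cong refl arg_cong2[of _ _ _ _ "(*)"])
    fix i assume "i \<in> {..<n}"
    then have i: "i < n" by simp
    have "(\<Sum>m\<in>monomials n (Suc d). ?c m * real (expo m i) * power_product n (m - var i) ?y) =
        (\<Sum>m\<in>monomials n d. ?c (m + var i) * real (expo (m + var i) i) * power_product n m ?y)"
      by (subst sum_monomials_with_var[OF i]) (auto simp del: power_product_add_var)
    also have "\<dots> = partial n d p i ?y"
      unfolding partial_def peval_def taylor_def
      using monomial_fact_add_var[OF i] monomial_fact_pos[of n]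
      by (intro sum.cong refl) (auto simp: lookup_add lookup_single field_simps)
    finally show "(\<Sum>m\<in>monomials n (Suc d). ?c m * real (expo m i) * power_product n (m - var i) ?y) = partial n d p i ?y" .
  qed
  finally show ?thesis using eval_mpoly_eq_peval[OF assms] by simp
qed

lemma space_eq: "topspace (Euclidean_space n) = space n"
  by (auto simp: topspace_Euclidean_space)

lemma has_gradient_imp_derivative:
  assumes f: "has_gradient n f x g" and x: "x \<in> space n" and v: "v \<in> space n"
  shows "((\<lambda>t. f (\<lambda>i. x i + t * v i)) has_field_derivative (\<Sum>i<n. g i * v i)) (at 0)"
proof -
  define D where "D = (\<Sum>i<n. g i * v i)"
  define N where "N = L2_set v {..<n}"
  have N: "0 \<le> N" by (simp add: N_def L2_set_nonneg)
  have norm: "L2_set (\<lambda>i. (x i + t * v i) - x i) {..<n} = \<bar>t\<bar> * N" for t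
    by (simp add: L2_set_def N_def power_mult_distrib real_sqrt_mult flip: sum_distrib_left)
  have "\<exists>\<delta>>0. \<forall>t. t \<noteq> 0 \<and> \<bar>t\<bar> < \<delta> \<longrightarrow> \<bar>(f (\<lambda>i. x i + t * v i) - f x) / t - D\<bar> < e" if "e > 0" for e
  proof -
    define \<epsilon> where "\<epsilon> = e / (2 * (N + 1))"
    have \<epsilon>0: "\<epsilon> > 0" using that N by (simp add: \<epsilon>_def)
    then have "\<epsilon> * N < \<epsilon> * (2 * (N + 1))" using N by (intro mult_strict_left_mono) auto
    also have "\<dots> = e" using N by (simp add: \<epsilon>_def)
    finally have \<epsilon>: "\<epsilon> > 0" "\<epsilon> * N < e" using \<epsilon>0 by auto
    obtain \<delta> where \<delta>: "\<delta> > 0" "\<And>y. y \<in> space n \<Longrightarrow> L2_set (\<lambda>i. y i - x i) {..<n} < \<delta> \<Longrightarrow>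
        \<bar>f y - f x - (\<Sum>i<n. g i * (y i - x i))\<bar> \<le> \<epsilon> * L2_set (\<lambda>i. y i - x i) {..<n}"
      using f \<epsilon>(1) unfolding has_gradient_def space_eq by meson
    show ?thesis
    proof (intro exI[of _ "\<delta> / (N + 1)"] conjI allI impI)
      show "\<delta> / (N + 1) > 0" using \<delta>(1) N by simp
      fix t :: real assume t: "t \<noteq> 0 \<and> \<bar>t\<bar> < \<delta> / (N + 1)"
      have "\<bar>t\<bar> * N \<le> \<bar>t\<bar> * (N + 1)" by (intro mult_left_mono) auto
      also have "\<dots> < \<delta>" using t N by (simp add: field_simps)
      finally have "\<bar>f (\<lambda>i. x i + t * v i) - f x - (\<Sum>i<n. g i * (x i + t * v i - x i))\<bar> \<le> \<epsilon> * (\<bar>t\<bar> * N)"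
        using \<delta>(2)[of "\<lambda>i. x i + t * v i"] x v by (simp only: norm) simp
      moreover have "(\<Sum>i<n. g i * (x i + t * v i - x i)) = t * D"
        by (simp add: D_def sum_distrib_left mult_ac)
      ultimately have "\<bar>f (\<lambda>i. x i + t * v i) - f x - t * D\<bar> \<le> \<epsilon> * N * \<bar>t\<bar>" by (simp add: mult_ac)
      moreover have "(f (\<lambda>i. x i + t * v i) - f x) / t - D = (f (\<lambda>i. x i + t * v i) - f x - t * D) / t"
        using t by (simp add: field_simps)
      ultimately have "\<bar>(f (\<lambda>i. x i + t * v i) - f x) / t - D\<bar> \<le> \<epsilon> * N"
        using t by (simp add: abs_divide field_simps)
      with \<epsilon>(2) show "\<bar>(f (\<lambda>i. x i + t * v i) - f x) / t - D\<bar> < e" by simp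
    qed
  qed
  then show ?thesis unfolding DERIV_def LIM_def D_def by (simp add: dist_real_def)
qed

text \<open>
  A gradient determines the derivatives along the coordinate axes.
\<close>

lemma has_gradient_unique:
  assumes "has_gradient n (eval_mpoly p) x g" and "x \<in> space n" and "i < n"
    and "variables p \<subseteq> {..<n}" and "total_degree p \<le> Suc d"
  shows "g i = partial n d p i x"
proof -
  define v :: "nat \<Rightarrow> real" where "v j = of_bool (j = i)" for j
  have "v \<in> space n" using assms(3) by (auto simp: v_def)
  from has_gradient_imp_derivative[OF assms(1,2) this]
  have "((\<lambda>t. eval_mpoly p (\<lambda>i. x i + t * v i)) has_field_derivative g i) (at 0)"
    using assms(3) by (simp add: v_def of_bool_def if_distrib[of "\<lambda>a. _ * a"] cong: if_cong)
  moreover have "((\<lambda>t. eval_mpoly p (\<lambda>i. x i + t * v i)) has_field_derivative partial n d p i x) (at 0)"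
    using eval_mpoly_derivative[OF assms(4,5), of x v 0] assms(3)
    by (simp add: v_def of_bool_def if_distrib[of "\<lambda>a. a * _"] cong: if_cong)
  ultimately show ?thesis by (rule DERIV_unique)
qed

lemma partial_on_axis:
  assumes i: "i < n"
  shows "partial n d p i (\<lambda>j. if j = i then t else 0) =
    (\<Sum>k\<le>d. real_of_int (taylor n p (Poly_Mapping.single i (Suc k))) / fact k * t ^ k)"
proof -
  let ?x = "\<lambda>j. if j = i then t else 0" and ?S = "Poly_Mapping.single i ` {..d}"
  let ?f = "\<lambda>m. real_of_int (taylor n p (m + var i)) / real (monomial_fact n m) * power_product n m ?x"
  have "partial n d p i ?x = (\<Sum>m\<in>?S. ?f m)"
    unfolding partial_def peval_def
  proof (intro sum.mono_neutral_right ballI)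
    show "?S \<subseteq> monomials n d" using single_in_monomials[OF i] by auto
    fix m assume m: "m \<in> monomials n d - ?S"
    have "\<exists>j<n. j \<noteq> i \<and> expo m j \<noteq> 0"
    proof (rule ccontr)
      assume "\<not> ?thesis"
      then have "m = Poly_Mapping.single i (expo m i)"
        using m expo_beyond[of m n d] by (intro poly_mapping_eqI) (auto simp: lookup_single when_def, metis not_less)
      moreover have "expo m i \<le> d" using m expo_le by blast
      ultimately show False using m by (metis DiffE atMost_iff image_eqI)
    qed
    then have "power_product n m ?x = 0" by (auto simp: power_product_def intro!: prod_zero)
    then show "?f m = 0" by simp
  qed simp
  also have "\<dots> = (\<Sum>k\<le>d. ?f (Poly_Mapping.single i k))"
  proof (subst sum.reindex)
    show "inj_on (Poly_Mapping.single i) {..d}"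
      by (rule inj_on_inverseI[of _ "\<lambda>m. expo m i"]) simp
  qed simp
  also have "\<dots> = (\<Sum>k\<le>d. real_of_int (taylor n p (Poly_Mapping.single i (Suc k))) / fact k * t ^ k)"
  proof (intro sum.cong refl)
    fix k
    have "Poly_Mapping.single i k + var i = Poly_Mapping.single i (Suc k)"
      by (simp flip: single_add)
    moreover have "monomial_fact n (Poly_Mapping.single i k) = (\<Prod>j<n. if j = i then fact k else 1)"
      unfolding monomial_fact_def by (intro prod.cong) (auto simp: lookup_single when_def)
    then have "monomial_fact n (Poly_Mapping.single i k) = fact k"
      using i by simp
    moreover have "power_product n (Poly_Mapping.single i k) ?x = (\<Prod>j<n. if j = i then t ^ k else 1)"
      unfolding power_product_def by (intro prod.cong) (auto simp: lookup_single when_def)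
    then have "power_product n (Poly_Mapping.single i k) ?x = t ^ k" using i by simp
    ultimately show "?f (Poly_Mapping.single i k) = real_of_int (taylor n p (Poly_Mapping.single i (Suc k))) / fact k * t ^ k"
      by simp
  qed
  finally show ?thesis .
qed

section \<open>Pseudoconvex polynomials of odd degree\<close>

lemma pseudoconvexD:
  assumes "pseudoconvex n (eval_mpoly p)" and p: "variables p \<subseteq> {..<n}" "total_degree p \<le> Suc d"
    and x: "x \<in> space n" and y: "y \<in> space n"
    and "(\<Sum>i<n. partial n d p i x * (y i - x i)) \<ge> 0"
  shows "eval_mpoly p x \<le> eval_mpoly p y"
proof -
  obtain grad where grad: "(\<forall>x\<in>space n. has_gradient n (eval_mpoly p) x (grad x)) \<and>
    (\<forall>x\<in>space n. \<forall>y\<in>space n. (\<Sum>i<n. grad x i * (y i - x i)) \<ge> 0 \<longrightarrow> eval_mpoly p y \<ge> eval_mpoly p x)"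
    using assms(1) unfolding pseudoconvex_def space_eq by (elim exE) (rule that)
  from grad x have gx: "has_gradient n (eval_mpoly p) x (grad x)" by blast
  have "(\<Sum>i<n. grad x i * (y i - x i)) = (\<Sum>i<n. partial n d p i x * (y i - x i))"
    using has_gradient_unique[OF gx x _ p] by (intro sum.cong) auto
  with assms(6) have "(\<Sum>i<n. grad x i * (y i - x i)) \<ge> 0" by simp
  moreover have "(\<Sum>i<n. grad x i * (y i - x i)) \<ge> 0 \<longrightarrow> eval_mpoly p y \<ge> eval_mpoly p x"
    by (rule bspec[OF bspec[OF conjunct2[OF grad] x] y])
  ultimately show ?thesis by (rule rev_mp)
qed

definition lead :: "nat \<Rightarrow> nat \<Rightarrow> int_mpoly \<Rightarrow> (nat \<Rightarrow> real) \<Rightarrow> real" where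
  "lead n d p = leading_form n d (\<lambda>m. real_of_int (Poly_Mapping.lookup p m))"

text \<open>
  Along a line on which \<open>p\<close> has odd degree, a critical point would be a global minimum by
  pseudoconvexity, but polynomials of odd degree are unbounded below. A derivative without roots has
  everywhere the sign of its leading coefficient.
\<close>

lemma directional_derivative_sign:
  assumes pc: "pseudoconvex n (eval_mpoly p)" and p: "variables p \<subseteq> {..<n}" "total_degree p \<le> Suc d"
    and d: "even d" and x: "x \<in> space n" and v: "v \<in> space n" "lead n (Suc d) p v \<noteq> 0"
  shows "sgn (\<Sum>i<n. v i * partial n d p i x) = sgn (lead n (Suc d) p v)"
proof -
  define \<phi> where "\<phi> = line_poly n (Suc d) (\<lambda>m. real_of_int (Poly_Mapping.lookup p m)) x v"
  have \<phi>: "poly \<phi> t = eval_mpoly p (\<lambda>i. x i + t * v i)" for t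
    unfolding \<phi>_def poly_line_poly eval_mpoly_eq_peval[OF p] ..
  have c: "coeff \<phi> (Suc d) = lead n (Suc d) p v" unfolding \<phi>_def coeff_line_poly lead_def ..
  have deg: "degree \<phi> = Suc d"
    using degree_line_poly[of n "Suc d"] c v(2) unfolding \<phi>_def by (intro antisym le_degree) auto
  have der: "poly (pderiv \<phi>) t = (\<Sum>i<n. v i * partial n d p i (\<lambda>i. x i + t * v i))" for t
    by (rule DERIV_unique[OF poly_DERIV[of \<phi> t, unfolded \<phi>] eval_mpoly_derivative[OF p]])
  have noroot: "poly (pderiv \<phi>) t \<noteq> 0" for t
  proof
    assume t: "poly (pderiv \<phi>) t = 0"
    have min: "poly \<phi> t \<le> poly \<phi> s" for s
    proof -
      let ?X = "\<lambda>i. x i + t * v i" and ?Y = "\<lambda>i. x i + s * v i"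
      have "(\<Sum>i<n. partial n d p i ?X * (?Y i - ?X i)) = (s - t) * poly (pderiv \<phi>) t"
        unfolding der sum_distrib_left by (intro sum.cong) (auto simp: algebra_simps)
      then have "(\<Sum>i<n. partial n d p i ?X * (?Y i - ?X i)) \<ge> 0" using t by simp
      with pseudoconvexD[OF pc p, of ?X ?Y] x v show ?thesis by (simp add: \<phi>)
    qed
    \<comment> \<open>Subtracting a value below the minimum would leave a polynomial of odd degree without roots.\<close>
    have "even (degree (\<phi> - [:poly \<phi> t - 1:]))"
    proof (rule even_degree_if_no_real_root)
      fix s show "poly (\<phi> - [:poly \<phi> t - 1:]) s \<noteq> 0" using min[of s] by simp
    qed
    moreover have "degree (\<phi> - [:poly \<phi> t - 1:]) = degree \<phi>"
      unfolding diff_conv_add_uminus by (rule degree_add_eq_left) (use deg in simp)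
    ultimately show False using deg d by simp
  qed
  have "pderiv \<phi> \<noteq> 0" using noroot by auto
  then have "sgn (poly (pderiv \<phi>) 0) = sgn (lead_coeff (pderiv \<phi>))"
    using noroot by (intro sgn_poly_right_of_roots) auto
  also have "lead_coeff (pderiv \<phi>) = real (Suc d) * lead n (Suc d) p v"
    using deg by (simp add: degree_pderiv coeff_pderiv c)
  finally show ?thesis by (simp add: der sgn_mult)
qed

lemma exists_lead_nonzero:
  assumes "variables p \<subseteq> {..<n}" and "total_degree p = d" and "d > 0"
  obtains u where "u \<in> space n" "lead n d p u \<noteq> 0"
proof -
  have "total_degree p \<in> insert 0 (monomial_degree ` Poly_Mapping.keys p)"
    unfolding total_degree_def by (rule Max_in) auto
  then obtain m where m: "m \<in> Poly_Mapping.keys p" "monomial_degree m = d" using assms by auto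
  then have "m \<in> monomials n d" using assms(1) by (auto simp: monomials_def variables_def)
  from nonzero_peval[OF this, of "\<lambda>m. if monomial_degree m = d then real_of_int (Poly_Mapping.lookup p m) else 0"] m
  show ?thesis using that unfolding lead_def leading_form_def by (auto simp: in_keys_iff)
qed

text \<open>
  If the gradients \<open>a\<close> at \<open>x\<close> and \<open>g\<close> at \<open>y\<close> were not parallel, some direction \<open>v\<close> would satisfy \<open>a \<bullet> v = 1\<close>
  and \<open>g \<bullet> v = -1\<close>. A small perturbation of \<open>v\<close> avoids the zeros of the leading form and keeps the two
  signs, which contradicts \<open>directional_derivative_sign\<close>.
\<close>

lemma gradients_parallel:
  assumes pc: "pseudoconvex n (eval_mpoly p)" and p: "variables p \<subseteq> {..<n}" "total_degree p = Suc d"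
    and d: "even d" and x: "x \<in> space n" and y: "y \<in> space n" and ij: "i < n" "j < n"
  shows "partial n d p i x * partial n d p j y = partial n d p j x * partial n d p i y"
proof (rule ccontr)
  assume neq: "\<not> ?thesis"
  define a where "a k = partial n d p k x" for k
  define g where "g k = partial n d p k y" for k
  define \<Delta> where "\<Delta> = a i * g j - a j * g i"
  have \<Delta>: "\<Delta> \<noteq> 0" using neq by (simp add: \<Delta>_def a_def g_def)
  then have neq_ij: "i \<noteq> j" by (auto simp: \<Delta>_def)
  \<comment> \<open>The solution of the two linear equations by Cramer's rule, supported on the coordinates \<open>i\<close> and \<open>j\<close>.\<close>
  define v where "v k = (if k = i then (g j + a j) / \<Delta> else if k = j then - (g i + a i) / \<Delta> else 0)" for k
  have sumv: "(\<Sum>k<n. v k * h k) = ((g j + a j) * h i - (g i + a i) * h j) / \<Delta>" for h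
  proof -
    have "(\<Sum>k<n. v k * h k) = (\<Sum>k\<in>{i, j}. v k * h k)"
      using ij by (intro sum.mono_neutral_right) (auto simp: v_def)
    then show ?thesis using neq_ij
      by (simp add: v_def add_divide_distrib diff_divide_distrib algebra_simps)
  qed
  have va: "(\<Sum>k<n. v k * a k) = 1"
  proof -
    have "(g j + a j) * a i - (g i + a i) * a j = \<Delta>" by (simp add: \<Delta>_def algebra_simps)
    then show ?thesis using \<Delta> by (simp add: sumv)
  qed
  have vg: "(\<Sum>k<n. v k * g k) = -1"
  proof -
    have "(g j + a j) * g i - (g i + a i) * g j = - \<Delta>" by (simp add: \<Delta>_def algebra_simps)
    then show ?thesis using \<Delta> by (simp add: sumv)
  qed
  have v: "v \<in> space n" using ij by (auto simp: v_def)
  obtain u where u: "u \<in> space n" "lead n (Suc d) p u \<noteq> 0" using exists_lead_nonzero[OF p] by blast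
  define A where "A = (\<Sum>k<n. u k * a k)"
  define G where "G = (\<Sum>k<n. u k * g k)"
  define \<delta> where "\<delta> = 1 / (\<bar>A\<bar> + \<bar>G\<bar> + 1)"
  have "\<delta> > 0" unfolding \<delta>_def by (smt (verit) divide_pos_pos)
  with u(2) obtain \<epsilon> where \<epsilon>: "0 < \<epsilon>" "\<epsilon> < \<delta>" "lead n (Suc d) p (\<lambda>k. v k + \<epsilon> * u k) \<noteq> 0"
    unfolding lead_def by (rule leading_form_perturb[where v = v])
  have pos: "\<bar>A\<bar> + \<bar>G\<bar> + 1 > 0" by linarith
  have "\<epsilon> * (\<bar>A\<bar> + \<bar>G\<bar> + 1) < 1" using \<epsilon>(2) pos unfolding \<delta>_def by (simp add: pos_less_divide_eq)
  then have "\<epsilon> * \<bar>A\<bar> + \<epsilon> * \<bar>G\<bar> < 1" using \<epsilon>(1) by (simp add: algebra_simps)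
  moreover have "0 \<le> \<epsilon> * \<bar>A\<bar>" "0 \<le> \<epsilon> * \<bar>G\<bar>" using \<epsilon>(1) by auto
  moreover have "\<bar>\<epsilon> * A\<bar> = \<epsilon> * \<bar>A\<bar>" "\<bar>\<epsilon> * G\<bar> = \<epsilon> * \<bar>G\<bar>" using \<epsilon>(1) by (auto simp: abs_mult)
  ultimately have small: "\<bar>\<epsilon> * A\<bar> < 1" "\<bar>\<epsilon> * G\<bar> < 1" by linarith+
  let ?w = "\<lambda>k. v k + \<epsilon> * u k"
  have w: "?w \<in> space n" using u v by auto
  have "(\<Sum>k<n. ?w k * f k) = (\<Sum>k<n. v k * f k) + \<epsilon> * (\<Sum>k<n. u k * f k)" for f
    by (simp add: distrib_right sum.distrib sum_distrib_left mult.assoc)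
  then have "(\<Sum>k<n. ?w k * a k) = 1 + \<epsilon> * A" "(\<Sum>k<n. ?w k * g k) = -1 + \<epsilon> * G"
    by (simp_all only: va vg A_def G_def)
  then have "(\<Sum>k<n. ?w k * a k) > 0" "(\<Sum>k<n. ?w k * g k) < 0" using small by linarith+
  moreover have "sgn (\<Sum>k<n. ?w k * a k) = sgn (\<Sum>k<n. ?w k * g k)"
    unfolding a_def g_def
    using directional_derivative_sign[OF pc p(1) _ d x w \<epsilon>(3)] directional_derivative_sign[OF pc p(1) _ d y w \<epsilon>(3)] p(2)
    by simp
  ultimately show False by simp
qed

lemma gradient_nonzero:
  assumes pc: "pseudoconvex n (eval_mpoly p)" and p: "variables p \<subseteq> {..<n}" "total_degree p = Suc d"
    and d: "even d" and x: "x \<in> space n"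
  shows "\<exists>i<n. partial n d p i x \<noteq> 0"
proof (rule ccontr)
  assume z: "\<not> ?thesis"
  obtain u where u: "u \<in> space n" "lead n (Suc d) p u \<noteq> 0" using exists_lead_nonzero[OF p] by blast
  have "sgn (lead n (Suc d) p u) = 0"
    using directional_derivative_sign[OF pc p(1) _ d x u] p(2) z by simp
  with u show False by (simp add: sgn_0_0)
qed

text \<open>
  The gradient is everywhere parallel to the vector of the derivatives
  \<open>taylor n p (Poly_Mapping.single i d + var j)\<close>, written coefficientwise and without division. The
  degree of the polynomial is \<open>Suc d\<close>.
\<close>

definition single_direction :: "nat \<Rightarrow> nat \<Rightarrow> int_mpoly \<Rightarrow> nat \<Rightarrow> bool" where
  "single_direction n d p i \<longleftrightarrow> (\<forall>m\<in>monomials n d. \<forall>j<n.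
     taylor n p (m + var j) * taylor n p (Poly_Mapping.single i (Suc d)) =
     taylor n p (m + var i) * taylor n p (Poly_Mapping.single i d + var j))"

text \<open>
  The sum is the partial derivative in direction \<open>i\<close> on the axis of the variable \<open>i\<close>
  (\<open>partial_on_axis\<close>).
\<close>

definition no_critical_point :: "nat \<Rightarrow> nat \<Rightarrow> int_mpoly \<Rightarrow> nat \<Rightarrow> bool" where
  "no_critical_point n d p i \<longleftrightarrow>
     (\<forall>t. (\<Sum>k\<le>d. real_of_int (taylor n p (Poly_Mapping.single i (Suc k))) / fact k * t ^ k) \<noteq> 0)"

lemma single_add_var: "Poly_Mapping.single i k + var i = Poly_Mapping.single i (Suc k)"
  by (simp flip: single_add)

text \<open>
  All gradients are parallel to the gradient \<open>g\<close> at the origin, and comparing coefficients gives linear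
  relations between the derivatives (\<open>rel\<close>). They allow exchanging a variable of a monomial against any
  variable \<open>i0\<close> with \<open>g i0 \<noteq> 0\<close>, which leads from some nonzero derivative of top degree to the pure power
  of \<open>i0\<close>. Conversely, if the pure power of \<open>i\<close> has a nonzero derivative, then \<open>g i \<noteq> 0\<close>, and the vector
  in \<open>single_direction\<close> is a nonzero multiple of \<open>g\<close>.
\<close>

lemma pseudoconvex_imp_test:
  assumes pc: "pseudoconvex n (eval_mpoly p)" and p: "variables p \<subseteq> {..<n}" "total_degree p = Suc d"
    and d: "even d"
  shows "\<exists>i<n. taylor n p (Poly_Mapping.single i (Suc d)) \<noteq> 0"
    and "\<And>i. i < n \<Longrightarrow> taylor n p (Poly_Mapping.single i (Suc d)) \<noteq> 0 \<Longrightarrow>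
      single_direction n d p i \<and> no_critical_point n d p i"
proof -
  let ?T = "\<lambda>m. real_of_int (taylor n p m)"
  define g where "g i = partial n d p i (\<lambda>_. 0)" for i
  obtain i0 where i0: "i0 < n" "g i0 \<noteq> 0"
    using gradient_nonzero[OF pc p d, of "\<lambda>_. 0"] by (auto simp: g_def)
  have rel: "?T (m + var j) * g i = ?T (m + var i) * g j"
    if i: "i < n" and j: "j < n" and m: "m \<in> monomials n d" for i j m
  proof (rule ccontr)
    assume neq: "\<not> ?thesis"
    let ?c = "\<lambda>m. (?T (m + var j) * g i - ?T (m + var i) * g j) / real (monomial_fact n m)"
    have "?c m \<noteq> 0" using neq monomial_fact_pos[of n m] by simp
    then obtain x where x: "x \<in> space n" "peval n d ?c x \<noteq> 0"
      using nonzero_peval[OF m, of ?c] by blast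
    have "peval n d ?c x = partial n d p j x * g i - partial n d p i x * g j"
      unfolding peval_def partial_def sum_distrib_right sum_subtractf[symmetric]
      by (intro sum.cong refl) (simp add: diff_divide_distrib algebra_simps)
    also have "\<dots> = 0"
      using gradients_parallel[OF pc p d x(1), of "\<lambda>_. 0" i j] i j by (simp add: g_def)
    finally show False using x(2) by simp
  qed
  have top: "?T (Poly_Mapping.single i0 (Suc d)) \<noteq> 0"
    if "m \<in> monomials n (Suc d)" "monomial_degree m = Suc d" "?T m \<noteq> 0" for m
    using that
  proof (induction "Suc d - expo m i0" arbitrary: m rule: less_induct)
    case less
    have deg: "(\<Sum>i<n. expo m i) = Suc d"
      using less.prems monomial_degree_eq[of m n] by (auto simp: monomials_def)
    have eq: "m = Poly_Mapping.single i0 (Suc d)" if z: "\<forall>j<n. j \<noteq> i0 \<longrightarrow> expo m j = 0"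
    proof -
      have "(\<Sum>i<n. expo m i) = (\<Sum>i\<in>{i0}. expo m i)"
        using z i0 by (intro sum.mono_neutral_right) auto
      then have "expo m i0 = Suc d" using deg by simp
      then show ?thesis using z expo_beyond[OF less.prems(1)]
        by (intro poly_mapping_eqI) (auto simp: lookup_single when_def, metis not_less)
    qed
    show ?case
    proof (cases "\<forall>j<n. j \<noteq> i0 \<longrightarrow> expo m j = 0")
      case True
      then show ?thesis using eq less.prems(3) by simp
    next
      case False
      then obtain j where j: "j < n" "j \<noteq> i0" "expo m j \<noteq> 0" by blast
      obtain m' where m': "m = m' + var j" using split_var[OF j(3)] .
      have m'd: "m' \<in> monomials n d"
        using less.prems(1) m' j(1) by (auto simp: in_monomials_iff lookup_add lookup_single sum.distrib when_def)
      have mn: "m' + var i0 \<in> monomials n (Suc d)" using add_var_in_monomials[OF i0(1) m'd] .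
      have sm: "(\<Sum>i<n. expo (m' + var k) i) = Suc (\<Sum>i<n. expo m' i)" if "k < n" for k
        using that by (simp add: lookup_add lookup_single sum.distrib when_def)
      have "monomial_degree (m' + var i0) = Suc d"
        using monomial_degree_eq[of "m' + var i0" n] mn sm[OF i0(1)] sm[OF j(1)] deg m'
        by (simp add: monomials_def)
      moreover have "?T (m' + var i0) \<noteq> 0"
        using rel[OF i0(1) j(1) m'd] less.prems(3) m' i0(2) by auto
      moreover have "Suc d - expo (m' + var i0) i0 < Suc d - expo m i0"
      proof -
        have "(\<Sum>i\<in>{i0, j}. expo m i) \<le> (\<Sum>i<n. expo m i)"
          using i0 j by (intro sum_mono2) auto
        then have "expo m i0 < Suc d" using j deg by simp
        then show ?thesis using j(2) by (simp add: m' lookup_add lookup_single)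
      qed
      ultimately show ?thesis using less.hyps mn by blast
    qed
  qed
  have "total_degree p \<in> insert 0 (monomial_degree ` Poly_Mapping.keys p)"
    unfolding total_degree_def by (rule Max_in) auto
  then obtain m where m: "m \<in> Poly_Mapping.keys p" "monomial_degree m = Suc d" using p by auto
  moreover have "m \<in> monomials n (Suc d)" using m p(1) by (auto simp: monomials_def variables_def)
  moreover have "?T m \<noteq> 0" using m monomial_fact_pos[of n m] by (simp add: taylor_def in_keys_iff)
  ultimately show "\<exists>i<n. taylor n p (Poly_Mapping.single i (Suc d)) \<noteq> 0" using top i0(1) by auto
  fix i assume i: "i < n" "taylor n p (Poly_Mapping.single i (Suc d)) \<noteq> 0"
  let ?b = "\<lambda>j. ?T (Poly_Mapping.single i d + var j)"
  have b: "?b j * g i = ?b i * g j" if "j < n" for j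
    using rel[OF i(1) that single_in_monomials[OF i(1) order_refl]] .
  have bi: "?b i \<noteq> 0" using i(2) single_add_var[of i d] by simp
  have gi: "g i \<noteq> 0"
  proof
    assume "g i = 0"
    then have "?b i * g i0 = 0" using b[OF i0(1)] by simp
    with bi i0(2) show False by simp
  qed
  have "?T (m + var j) * ?b i = ?T (m + var i) * ?b j" if "m \<in> monomials n d" "j < n" for m j
  proof -
    have "g i * (?T (m + var j) * ?b i) = ?b i * (?T (m + var j) * g i)" by (simp only: mult_ac)
    also have "\<dots> = ?b i * (?T (m + var i) * g j)" by (subst rel[OF i(1) that(2,1)]) (rule refl)
    also have "\<dots> = ?T (m + var i) * (?b i * g j)" by (simp only: mult_ac)
    also have "\<dots> = ?T (m + var i) * (?b j * g i)" by (subst b[OF that(2)]) (rule refl)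
    also have "\<dots> = g i * (?T (m + var i) * ?b j)" by (simp only: mult_ac)
    finally show ?thesis using gi by simp
  qed
  then have "single_direction n d p i"
    unfolding single_direction_def single_add_var[symmetric] of_int_eq_iff[where 'a = real, symmetric] of_int_mult by blast
  moreover have "no_critical_point n d p i"
    unfolding no_critical_point_def
  proof (intro allI notI)
    fix t
    assume "(\<Sum>k\<le>d. ?T (Poly_Mapping.single i (Suc k)) / fact k * t ^ k) = 0"
    then have z: "partial n d p i (\<lambda>j. if j = i then t else 0) = 0" by (simp add: partial_on_axis[OF i(1)])
    let ?x = "\<lambda>j. if j = i then t else 0"
    have x: "?x \<in> space n" using i by auto
    have "partial n d p j ?x * g i = 0" if "j < n" for j
      using gradients_parallel[OF pc p d x, of "\<lambda>_. 0" j i] that i z by (simp add: g_def)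
    with gi gradient_nonzero[OF pc p d x] show False by auto
  qed
  ultimately show "single_direction n d p i \<and> no_critical_point n d p i" ..
qed

text \<open>
  Scaling the vector of \<open>single_direction\<close> gives \<open>\<xi>\<close> with \<open>\<xi> i = 1\<close>. As the gradient is a multiple of \<open>\<xi>\<close>,
  \<open>p\<close> is constant on the hyperplanes orthogonal to \<open>\<xi>\<close>, so that \<open>p x = h (\<xi> \<bullet> x)\<close>, where \<open>h\<close> is the restriction
  of \<open>p\<close> to the axis \<open>i\<close>.
\<close>

lemma test_imp_pseudoconvex:
  assumes p: "variables p \<subseteq> {..<n}" "total_degree p \<le> Suc d" and i: "i < n"
    and top: "taylor n p (Poly_Mapping.single i (Suc d)) \<noteq> 0"
    and dir: "single_direction n d p i" and crit: "no_critical_point n d p i"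
  shows "pseudoconvex n (eval_mpoly p)"
proof -
  let ?T = "\<lambda>m. real_of_int (taylor n p m)"
  define \<xi> where "\<xi> j = ?T (Poly_Mapping.single i d + var j) / ?T (Poly_Mapping.single i (Suc d))" for j
  define h where "h t = eval_mpoly p (\<lambda>j. if j = i then t else 0)" for t
  define h' where "h' t = partial n d p i (\<lambda>j. if j = i then t else 0)" for t
  define L where "L x = (\<Sum>j<n. \<xi> j * x j)" for x
  have \<xi>i: "\<xi> i = 1" using top single_add_var[of i d] by (simp add: \<xi>_def)
  have par: "partial n d p j x = \<xi> j * partial n d p i x" if "j < n" for j x
  proof -
    have "?T (m + var j) = \<xi> j * ?T (m + var i)" if "m \<in> monomials n d" for m
    proof -
      have "?T (m + var j) * ?T (Poly_Mapping.single i (Suc d)) = ?T (m + var i) * ?T (Poly_Mapping.single i d + var j)"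
        using dir \<open>j < n\<close> that unfolding single_direction_def by (metis of_int_mult)
      then show ?thesis using top by (simp add: \<xi>_def field_simps)
    qed
    then show ?thesis unfolding partial_def peval_def by (simp add: sum_distrib_left mult_ac)
  qed
  \<comment> \<open>The segment from the point of the axis on the same hyperplane to \<open>x\<close> is orthogonal to \<open>\<xi>\<close>.\<close>
  have rep: "eval_mpoly p x = h (L x)" if x: "x \<in> space n" for x
  proof -
    define y where "y j = (if j = i then L x else 0)" for j
    define v where "v j = x j - y j" for j
    have "(\<Sum>j<n. \<xi> j * v j) = L x - (\<Sum>j<n. \<xi> j * y j)"
      by (simp add: v_def L_def right_diff_distrib sum_subtractf)
    also have "(\<Sum>j<n. \<xi> j * y j) = L x"
      using i \<xi>i by (simp add: y_def if_distrib[of "\<lambda>a. _ * a"] cong: if_cong)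
    finally have orth: "(\<Sum>j<n. \<xi> j * v j) = 0" by simp
    have "((\<lambda>t. eval_mpoly p (\<lambda>j. y j + t * v j)) has_field_derivative 0) (at s)" for s
    proof -
      have "(\<Sum>j<n. v j * partial n d p j (\<lambda>j. y j + s * v j)) =
          (\<Sum>j<n. \<xi> j * v j) * partial n d p i (\<lambda>j. y j + s * v j)"
        unfolding sum_distrib_right by (intro sum.cong refl) (subst par, auto)
      then show ?thesis using eval_mpoly_derivative[OF p, of y v s] orth by simp
    qed
    then have "eval_mpoly p (\<lambda>j. y j + 1 * v j) = eval_mpoly p (\<lambda>j. y j + 0 * v j)"
      by (intro DERIV_isconst_all allI)
    moreover have "(\<lambda>j. y j + 1 * v j) = x" "(\<lambda>j. y j + 0 * v j) = y" by (auto simp: v_def)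
    ultimately show ?thesis by (simp add: h_def y_def[abs_def])
  qed
  have der: "(h has_field_derivative h' t) (at t)" for t
  proof -
    have "((\<lambda>s. eval_mpoly p (\<lambda>j. 0 + s * of_bool (j = i))) has_field_derivative
        (\<Sum>j<n. of_bool (j = i) * partial n d p j (\<lambda>j. 0 + t * of_bool (j = i)))) (at t)"
      by (rule eval_mpoly_derivative[OF p])
    moreover have "(\<lambda>j. 0 + s * of_bool (j = i)) = (\<lambda>j. if j = i then s else (0::real))" for s by auto
    moreover have "(\<Sum>j<n. of_bool (j = i) * partial n d p j x) = partial n d p i x" for x
      using i by (simp add: of_bool_def if_distrib[of "\<lambda>a. a * _"] cong: if_cong)
    ultimately show ?thesis by (simp only: h_def[abs_def] h'_def)
  qed
  have grad: "has_gradient n (eval_mpoly p) x (\<lambda>j. h' (L x) * \<xi> j)" if x: "x \<in> space n" for x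
    unfolding has_gradient_def space_eq
  proof (intro allI impI)
    fix \<epsilon> :: real assume \<epsilon>: "\<epsilon> > 0"
    define N where "N = L2_set \<xi> {..<n} + 1"
    have N: "N > 0" unfolding N_def by (intro add_nonneg_pos L2_set_nonneg) simp
    have "(h has_derivative (\<lambda>s. h' (L x) * s)) (at (L x))"
      using der[of "L x"] by (simp add: has_field_derivative_def)
    then obtain \<delta> where \<delta>: "\<delta> > 0" "\<And>t. \<bar>t - L x\<bar> < \<delta> \<Longrightarrow>
        \<bar>h t - h (L x) - h' (L x) * (t - L x)\<bar> \<le> \<epsilon> / N * \<bar>t - L x\<bar>"
      using \<epsilon> N unfolding has_derivative_at_alt by (metis divide_pos_pos real_norm_def)
    show "\<exists>\<delta>>0. \<forall>y\<in>space n. L2_set (\<lambda>i. y i - x i) {..<n} < \<delta> \<longrightarrow>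
        \<bar>eval_mpoly p y - eval_mpoly p x - (\<Sum>j<n. h' (L x) * \<xi> j * (y j - x j))\<bar>
          \<le> \<epsilon> * L2_set (\<lambda>i. y i - x i) {..<n}"
    proof (intro exI[of _ "\<delta> / N"] conjI ballI impI)
      show "\<delta> / N > 0" using \<delta> N by simp
      fix y assume y: "y \<in> space n" "L2_set (\<lambda>i. y i - x i) {..<n} < \<delta> / N"
      define r where "r = L2_set (\<lambda>i. y i - x i) {..<n}"
      have r: "0 \<le> r" "r < \<delta> / N" using y by (auto simp: r_def L2_set_nonneg)
      have diff: "L y - L x = (\<Sum>j<n. \<xi> j * (y j - x j))"
        by (simp add: L_def right_diff_distrib sum_subtractf)
      have "\<bar>L y - L x\<bar> \<le> (\<Sum>j<n. \<bar>\<xi> j\<bar> * \<bar>y j - x j\<bar>)"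
        unfolding diff by (rule order_trans[OF sum_abs]) (simp add: abs_mult)
      also have "\<dots> \<le> L2_set \<xi> {..<n} * r" unfolding r_def by (rule L2_set_mult_ineq)
      also have "\<dots> \<le> N * r" using r by (intro mult_right_mono) (auto simp: N_def)
      finally have Lr: "\<bar>L y - L x\<bar> \<le> N * r" .
      also have "N * r < \<delta>" using r N by (simp add: field_simps)
      finally have "\<bar>h (L y) - h (L x) - h' (L x) * (L y - L x)\<bar> \<le> \<epsilon> / N * \<bar>L y - L x\<bar>" by (rule \<delta>(2))
      also have "\<dots> \<le> \<epsilon> / N * (N * r)" using Lr \<epsilon> N by (intro mult_left_mono) auto
      also have "\<dots> = \<epsilon> * r" using N by simp
      finally have "\<bar>h (L y) - h (L x) - h' (L x) * (L y - L x)\<bar> \<le> \<epsilon> * r" .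
      then show "\<bar>eval_mpoly p y - eval_mpoly p x - (\<Sum>j<n. h' (L x) * \<xi> j * (y j - x j))\<bar>
          \<le> \<epsilon> * L2_set (\<lambda>i. y i - x i) {..<n}"
        unfolding rep[OF y(1)] rep[OF x] diff r_def by (simp add: sum_distrib_left mult.assoc)
    qed
  qed
  define P where "P = (\<Sum>k\<le>d. monom (?T (Poly_Mapping.single i (Suc k)) / fact k) k)"
  have P: "poly P t = h' t" for t
    by (simp add: P_def h'_def partial_on_axis[OF i] poly_sum poly_monom)
  have noroot: "h' t \<noteq> 0" for t
    using crit by (simp add: h'_def partial_on_axis[OF i] no_critical_point_def)
  then have P0: "P \<noteq> 0" using P by (metis poly_0)
  have sgn: "sgn (h' t) = sgn (lead_coeff P)" for t
    using sgn_poly_right_of_roots[OF P0, of t] noroot P by auto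
  have mono: "h s \<le> h t" if "h' s * (t - s) \<ge> 0" for s t
  proof (cases "h' s > 0")
    case True
    then have pos: "h' r > 0" for r using sgn[of s] sgn[of r] by (metis sgn_1_pos)
    have "s \<le> t" using that True by (simp add: zero_le_mult_iff)
    then show ?thesis
      by (rule DERIV_nonneg_imp_nondecreasing) (meson der pos less_imp_le)
  next
    case False
    then have neg: "h' s < 0" using noroot[of s] by simp
    then have neg': "h' r < 0" for r using sgn[of s] sgn[of r] by (metis sgn_1_neg)
    have "t \<le> s" using that neg by (simp add: zero_le_mult_iff)
    then show ?thesis
      by (rule DERIV_nonpos_imp_nonincreasing) (meson der neg' less_imp_le)
  qed
  show ?thesis
    unfolding pseudoconvex_def space_eq
  proof (intro exI[of _ "\<lambda>x j. h' (L x) * \<xi> j"] conjI ballI impI)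
    fix x y assume x: "x \<in> space n" and y: "y \<in> space n"
      and ge: "0 \<le> (\<Sum>j<n. h' (L x) * \<xi> j * (y j - x j))"
    have "(\<Sum>j<n. h' (L x) * \<xi> j * (y j - x j)) = h' (L x) * (L y - L x)"
      by (simp add: L_def right_diff_distrib sum_subtractf sum_distrib_left mult.assoc)
    with ge mono show "eval_mpoly p x \<le> eval_mpoly p y" unfolding rep[OF x] rep[OF y] by simp
  qed (use grad in auto)
qed

section \<open>Total correctness of programs\<close>

definition ends ::
    "int \<Rightarrow> com \<Rightarrow> nat \<Rightarrow> (registers \<Rightarrow> int list \<Rightarrow> bool) \<Rightarrow> registers \<Rightarrow> int list \<Rightarrow> bool" where
  "ends X c K Q s xs \<longleftrightarrow> (\<exists>k \<le> K. \<exists>s' xs'. exec X c (s, xs) k (s', xs') \<and> Q s' xs')"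

lemma ends_mono:
  assumes "ends X c K Q s xs" and "K \<le> K'" and "\<And>s xs. Q s xs \<Longrightarrow> Q' s xs"
  shows "ends X c K' Q' s xs"
  using assms unfolding ends_def by (meson order_trans)

lemma ends_Assign:
  assumes "data_exp s e" "data_loc s l" "\<bar>ev s e\<bar> \<le> X" "Q (s(address s l := ev s e)) xs"
  shows "ends X (Assign l e) 1 Q s xs"
  using exec.Assign[of s e l X xs] assms unfolding ends_def by blast

lemma ends_Get:
  assumes "data_loc s l" "\<bar>x\<bar> \<le> X" "Q (s(address s l := x)) xs"
  shows "ends X (Get l) 1 Q s (x # xs)"
  using exec.Get[of s l x X xs] assms unfolding ends_def by blast

lemma ends_Seq:
  assumes "ends X c1 K1 (ends X c2 K2 Q) s xs"
  shows "ends X (Seq c1 c2) (K1 + K2) Q s xs"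
  using assms exec.Seq unfolding ends_def by (metis (no_types, lifting) add_mono)

lemma ends_Cond:
  assumes "data_exp s e" and "ev s e > 0 \<Longrightarrow> ends X c1 K Q s xs" and "\<not> ev s e > 0 \<Longrightarrow> ends X c2 K Q s xs"
  shows "ends X (Cond e c1 c2) (K + 1) Q s xs"
proof (cases "ev s e > 0")
  case True
  with assms(2) obtain k s' xs' where "k \<le> K" "exec X c1 (s, xs) k (s', xs')" "Q s' xs'"
    unfolding ends_def by blast
  then show ?thesis using exec.CondT[OF assms(1) True, of X c1 xs k "(s', xs')" c2]
    unfolding ends_def by (intro exI[of _ "k + 1"]) auto
next
  case False
  with assms(3) obtain k s' xs' where "k \<le> K" "exec X c2 (s, xs) k (s', xs')" "Q s' xs'"
    unfolding ends_def by blast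
  then show ?thesis using exec.CondF[OF assms(1) False, of X c2 xs k "(s', xs')" c1]
    unfolding ends_def by (intro exI[of _ "k + 1"]) auto
qed

lemma ends_While:
  fixes N :: nat
  assumes continue: "\<And>j s xs. j < N \<Longrightarrow> I j s xs \<Longrightarrow> data_exp s e \<and> ev s e > 0 \<and> ends X c K (I (Suc j)) s xs"
    and exit: "\<And>s xs. I N s xs \<Longrightarrow> data_exp s e \<and> \<not> ev s e > 0 \<and> Q s xs"
    and start: "I 0 s xs"
  shows "ends X (While e c) (N * (K + 1) + 1) Q s xs"
proof -
  have "ends X (While e c) ((N - j) * (K + 1) + 1) Q s xs" if "j \<le> N" "I j s xs" for j s xs
    using that
  proof (induction "N - j" arbitrary: j s xs)
    case 0
    then have "data_exp s e" "\<not> ev s e > 0" "Q s xs" using exit[of s xs] by auto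
    with exec.WhileF[of s e X c xs] show ?case
      unfolding ends_def by (intro exI[of _ 1] exI[of _ s] exI[of _ xs]) auto
  next
    case (Suc k)
    then have j: "j < N" by simp
    obtain k1 s1 xs1 where 1: "k1 \<le> K" "exec X c (s, xs) k1 (s1, xs1)" "I (Suc j) s1 xs1"
      using continue[OF j Suc.prems(2)] unfolding ends_def by blast
    have "k = N - Suc j" "Suc j \<le> N" using Suc.hyps(2) j by auto
    from Suc.hyps(1)[OF this 1(3)] obtain k2 s2 xs2 where 2: "k2 \<le> (N - Suc j) * (K + 1) + 1" "exec X (While e c) (s1, xs1) k2 (s2, xs2)" "Q s2 xs2"
      unfolding ends_def by blast
    have "exec X (While e c) (s, xs) (k1 + k2 + 1) (s2, xs2)"
      using continue[OF j Suc.prems(2)] exec.WhileT 1(2) 2(2) by blast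
    moreover have "N - j = Suc (N - Suc j)" using j by simp
    then have "k1 + k2 + 1 \<le> (N - j) * (K + 1) + 1" using 1(1) 2(1) by simp
    ultimately show ?case using 2(3) unfolding ends_def by blast
  qed
  from this[of 0 s xs] start show ?thesis by simp
qed

notation Seq (infixr ";;" 60)

abbreviation "R i \<equiv> Var (Reg i)"
abbreviation "At i \<equiv> Var (Ind i)"
abbreviation "Set_to i \<equiv> Assign (Reg i)"

lemma ends_Set:
  assumes "data_exp s e" "data i" "ev s e = v" "\<bar>v\<bar> \<le> X" "Q (s(i := v)) xs"
  shows "ends X (Set_to i e) 1 Q s xs"
  using assms by (intro ends_Assign) auto

lemma ends_Set_Seq:
  assumes "data_exp s e" "data i" "ev s e = v" "\<bar>v\<bar> \<le> X" "ends X c K Q (s(i := v)) xs"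
  shows "ends X (Set_to i e ;; c) (1 + K) Q s xs"
  using assms by (intro ends_Seq ends_Set)

text \<open>
  Families of registers: \<open>reg a k\<close> for \<open>a < 8\<close> is the register number \<open>k\<close> of family \<open>a\<close>. The loop of level
  \<open>k\<close> uses \<open>bnd k\<close> for its largest weight, \<open>cod k\<close> for the address of the current monomial, \<open>mul k\<close> for
  the exponent that the variable chosen last has reached, and \<open>fac k\<close> for the product of the factorials
  of the exponents. The derivatives that enter the decision tree are copied to \<open>tv\<close>, \<open>sc\<close> contains the
  remaining scalars, and the derivative of a monomial with code \<open>c\<close> is stored in \<open>mem c\<close>.
\<close>

definition reg :: "nat \<Rightarrow> nat \<Rightarrow> nat" where
  "reg a k = 2 + 2 * (a + 8 * k)"

lemma data_reg [simp]: "data (reg a k)"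
  by (simp add: data_def reg_def)

lemma reg_eq_iff [simp]: "a < 8 \<Longrightarrow> b < 8 \<Longrightarrow> reg a k = reg b j \<longleftrightarrow> a = b \<and> k = j"
proof -
  assume ab: "a < 8" "b < 8"
  have "a = b \<and> k = j" if eq: "a + 8 * k = b + 8 * j"
  proof -
    have "(a + 8 * k) mod 8 = (b + 8 * j) mod 8" by (simp only: eq)
    then have "a = b" using ab by simp
    with eq show ?thesis by simp
  qed
  then show ?thesis by (auto simp: reg_def)
qed

abbreviation "bnd \<equiv> reg 0"
abbreviation "cod \<equiv> reg 7"
abbreviation "mul \<equiv> reg 2"
abbreviation "fac \<equiv> reg 3"
abbreviation "tv \<equiv> reg 4"
abbreviation "sc \<equiv> reg 5"
abbreviation "mem \<equiv> reg 6"

text \<open>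
  Weights are stored with the factor 16, the distance of consecutive registers of a family, so that
  one addition moves from the address of a monomial to that of its multiple by a variable.
\<close>

lemma mem_add: "int (mem c) + 16 * int b = int (mem (c + b))"
  by (simp add: reg_def)

text \<open>
  The variables are chosen in the order of decreasing weight. So the variable of the current round
  repeats the previous choice if and only if its weight is the largest one still allowed. The
  outermost loop has no previous choice, which is recorded as multiplicity 0.
\<close>

definition next_multiplicity :: "nat \<Rightarrow> com" where
  "next_multiplicity k = Cond (Minus (R (bnd (Suc k))) (R (bnd k)))
     (Set_to (mul k) (Num 1))
     (Set_to (mul k) (Plus (R (mul (Suc k))) (Num 1)))"

definition nest_step :: "nat \<Rightarrow> nat \<Rightarrow> com \<Rightarrow> com" where
  "nest_step B k c =
     Set_to (cod k) (Plus (R (cod (Suc k))) (R (bnd k))) ;;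
     next_multiplicity k ;;
     Set_to (fac k) (Times (R (fac (Suc k))) (R (mul k))) ;;
     c ;;
     Set_to (bnd k) (Times (R (bnd k)) (Num (int B)))"

abbreviation at_most :: "nat \<Rightarrow> nat \<Rightarrow> exp" where
  "at_most i j \<equiv> Plus (Minus (R j) (R i)) (Num 1)"

text \<open>
  The loop variable \<open>bnd k\<close> is the weight of the chosen variable, and at the same time the largest
  weight that the loop inside may choose. At most \<open>k\<close> further variables are chosen on level \<open>k\<close>.
\<close>

primrec nest :: "nat \<Rightarrow> (nat \<Rightarrow> com) \<Rightarrow> nat \<Rightarrow> com" where
  "nest B body 0 = body 0"
| "nest B body (Suc k) =
     body (Suc k) ;;
     Set_to (bnd k) (Num (16 * int B)) ;;
     While (at_most (bnd k) (bnd (Suc k))) (nest_step B k (nest B body k))"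

text \<open>
  The codes and products of factorials that \<open>nest\<close> passes to its body, in this order. The argument \<open>m\<close>
  is the number of variables that may still be chosen, \<open>\<mu>\<close> the exponent of the variable of weight
  \<open>B ^ m\<close> so far.
\<close>

primrec visits :: "nat \<Rightarrow> nat \<Rightarrow> nat \<Rightarrow> nat \<Rightarrow> nat \<Rightarrow> nat \<Rightarrow> (nat \<times> nat) list" where
  "visits B 0 m c \<mu> f = [(c, f)]"
| "visits B (Suc k) m c \<mu> f = (c, f) # concat (map (\<lambda>j.
     let \<mu>' = (if j < m then 1 else Suc \<mu>) in visits B k j (c + B ^ j) \<mu>' (f * \<mu>')) [1..<Suc m])"

lemma visits_head: "\<exists>vs. visits B k m c \<mu> f = (c, f) # vs"
  by (cases k) auto

definition is_level :: "nat \<Rightarrow> bool" where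
  "is_level i \<longleftrightarrow> (\<exists>k. i = bnd k \<or> i = cod k \<or> i = mul k \<or> i = fac k)"

lemma is_level_reg [simp]:
  "a < 8 \<Longrightarrow> is_level (reg a k) \<longleftrightarrow> a = 0 \<or> a = 7 \<or> a = 2 \<or> a = 3"
  by (auto simp: is_level_def)

definition same_levels :: "nat \<Rightarrow> registers \<Rightarrow> registers \<Rightarrow> bool" where
  "same_levels k s s' \<longleftrightarrow> (\<forall>j\<ge>k. s' (bnd j) = s (bnd j) \<and> s' (cod j) = s (cod j) \<and>
     s' (mul j) = s (mul j) \<and> s' (fac j) = s (fac j))"

lemma same_levels_trans: "same_levels k s s' \<Longrightarrow> same_levels k s' s'' \<Longrightarrow> same_levels k s s''"
  by (simp add: same_levels_def)

lemma same_levels_le: "same_levels k s s' \<Longrightarrow> k \<le> k' \<Longrightarrow> same_levels k' s s'"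
  by (simp add: same_levels_def)

primrec nest_time :: "nat \<Rightarrow> nat \<Rightarrow> nat \<Rightarrow> nat" where
  "nest_time K n 0 = K"
| "nest_time K n (Suc k) = K + n * (nest_time K n k + 6) + 2"

context
  fixes X :: int and B n K top :: nat and V :: "(nat \<times> nat) list" and body :: "nat \<Rightarrow> com"
    and J :: "(nat \<times> nat) list \<Rightarrow> registers \<Rightarrow> int list \<Rightarrow> bool"
  assumes B: "B \<ge> 2"
    and frame: "\<And>vs s s' xs. J vs s xs \<Longrightarrow> (\<And>i. \<not> is_level i \<Longrightarrow> s' i = s i) \<Longrightarrow> J vs s' xs"
    and body: "\<And>pre c f post k s xs. V = pre @ (c, f) # post \<Longrightarrow> J pre s xs \<Longrightarrow>
      s (cod k) = int (mem c) \<Longrightarrow> s (fac k) = int f \<Longrightarrow>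
      ends X (body k) K (\<lambda>s' xs'. J (pre @ [(c, f)]) s' xs' \<and> same_levels 0 s s') s xs"
    and V_bound: "\<And>c f. (c, f) \<in> set V \<Longrightarrow> int (mem c) \<le> X \<and> int f \<le> X"
    and X: "16 * int B ^ Suc n \<le> X"
begin

text \<open>
  The invariant \<open>J\<close> describes the state after the body has processed a given part of \<open>V\<close>; it may not
  depend on the registers that control the loops. The bounds on \<open>V\<close> cover all addresses and products
  of factorials that the loops compute because every one of them is passed to the body at once.
\<close>

lemma ends_nest:
  assumes "V = pre @ visits B k m c \<mu> f @ post" and "J pre s xs"
    and "s (bnd k) = 16 * int B ^ m" "s (cod k) = int (mem c)" "s (mul k) = int \<mu>" "s (fac k) = int f"
    and "f > 0" "m \<le> n"
  shows "ends X (nest B body k) (nest_time K n k)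
    (\<lambda>s' xs'. J (pre @ visits B k m c \<mu> f) s' xs' \<and> same_levels k s s') s xs"
  using assms
proof (induction k arbitrary: pre m c \<mu> f post s xs)
  case 0
  show ?case
    unfolding nest.simps nest_time.simps visits.simps
    by (rule body[of pre c f post]) (use 0 in auto)
next
  case (Suc k)
  define \<mu>' where "\<mu>' j = (if j < m then 1 else Suc \<mu>)" for j
  define W where "W j = visits B k j (c + B ^ j) (\<mu>' j) (f * \<mu>' j)" for j
  have vis: "visits B (Suc k) m c \<mu> f = (c, f) # concat (map W [1..<Suc m])"
    by (simp add: W_def[abs_def] \<mu>'_def Let_def del: upt_Suc)
  define seen where "seen j = pre @ (c, f) # concat (map W [1..<Suc j])" for j
  have seen_Suc: "seen (Suc j) = seen j @ W (Suc j)" for j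
    by (simp add: seen_def)
  have seen_m: "seen m = pre @ visits B (Suc k) m c \<mu> f"
    by (simp only: seen_def vis)
  have V: "\<exists>post'. V = seen j @ W (Suc j) @ post'" if "j < m" for j
  proof -
    have "[1..<Suc m] = [1..<Suc j] @ [Suc j..<Suc m]"
      using upt_add_eq_append[of 1 "Suc j" "m - j"] that by (simp del: upt_Suc)
    also have "[Suc j..<Suc m] = Suc j # [Suc (Suc j)..<Suc m]"
      using that by (simp add: upt_conv_Cons)
    finally show ?thesis using Suc.prems(1) unfolding vis seen_def by simp
  qed
  define I where "I j s' xs' \<longleftrightarrow> J (seen j) s' xs' \<and> s' (bnd k) = 16 * int B ^ Suc j \<and> same_levels (Suc k) s s'"
    for j s' xs'
  have powX: "16 * int B ^ j \<le> X" if "j \<le> Suc n" for j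
  proof -
    have "int B ^ j \<le> int B ^ Suc n" using that B by (intro power_increasing) auto
    with X show ?thesis by linarith
  qed
  have guard_pos: "16 * int B ^ Suc j \<le> 16 * int B ^ m" if "j < m" for j
    using that B by (simp add: power_increasing del: power_Suc)
  have strict: "0 < 16 * int B ^ m - 16 * int B ^ Suc j \<longleftrightarrow> Suc j < m" if "j < m" for j
    using that B by (simp del: power_Suc)
  let ?guard = "at_most (bnd k) (bnd (Suc k))" and ?step = "nest_step B k (nest B body k)"
    and ?fin = "Set_to (bnd k) (Times (R (bnd k)) (Num (int B)))"
  define T where "T = 1 + ((1 + 1) + (1 + (nest_time K n k + 1)))"
  have iterate: "data_exp s' ?guard \<and> ev s' ?guard > 0 \<and> ends X ?step T (I (Suc j)) s' xs'"
    if j: "j < m" and I: "I j s' xs'" for j s' xs'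
  proof (intro conjI)
    have lv: "s' (bnd (Suc k)) = 16 * int B ^ m" "s' (cod (Suc k)) = int (mem c)"
      "s' (mul (Suc k)) = int \<mu>" "s' (fac (Suc k)) = int f" "s' (bnd k) = 16 * int B ^ Suc j"
      using I Suc.prems by (auto simp: I_def same_levels_def)
    show "data_exp s' ?guard" by simp
    show "ev s' ?guard > 0"
      using guard_pos[OF j] lv by simp
    obtain post' where post': "V = seen j @ W (Suc j) @ post'" using V[OF j] by blast
    obtain vs where "W (Suc j) = (c + B ^ Suc j, f * \<mu>' (Suc j)) # vs"
      using visits_head unfolding W_def by metis
    then have "(c + B ^ Suc j, f * \<mu>' (Suc j)) \<in> set V" using post' by simp
    then have bd: "int (mem (c + B ^ Suc j)) \<le> X" "int (f * \<mu>' (Suc j)) \<le> X" using V_bound by blast+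
    have "int (\<mu>' (Suc j)) \<le> int (f * \<mu>' (Suc j))" using Suc.prems(7) by (cases f) auto
    then have bdm: "int (\<mu>' (Suc j)) \<le> X" using bd by linarith
    define s1 where "s1 = s'(cod k := int (mem (c + B ^ Suc j)))"
    define s2 where "s2 = s1(mul k := int (\<mu>' (Suc j)))"
    define s3 where "s3 = s2(fac k := int (f * \<mu>' (Suc j)))"
    have J3: "J (seen j) s3 xs'"
      by (rule frame[of _ s']) (use I in \<open>auto simp: I_def s1_def s2_def s3_def\<close>)
    have l3: "same_levels (Suc k) s' s3" by (auto simp: same_levels_def s1_def s2_def s3_def)
    have "ends X (nest B body k) (nest_time K n k)
      (\<lambda>s' xs'. J (seen j @ W (Suc j)) s' xs' \<and> same_levels k s3 s') s3 xs'"
      unfolding W_def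
    proof (rule Suc.IH)
      show "V = seen j @ visits B k (Suc j) (c + B ^ Suc j) (\<mu>' (Suc j)) (f * \<mu>' (Suc j)) @ post'"
        using post' by (simp add: W_def)
      show "J (seen j) s3 xs'" by (rule J3)
      show "f * \<mu>' (Suc j) > 0" using Suc.prems(7) by (simp add: \<mu>'_def)
      show "Suc j \<le> n" using j Suc.prems(8) by simp
    qed (use lv in \<open>auto simp: s1_def s2_def s3_def\<close>)
    then have nest: "ends X (nest B body k) (nest_time K n k)
      (ends X ?fin 1 (I (Suc j))) s3 xs'"
    proof (rule ends_mono[OF _ order_refl], elim conjE)
      fix t ys assume t: "J (seen j @ W (Suc j)) t ys" "same_levels k s3 t"
      have tl: "t (bnd k) = 16 * int B ^ Suc j"
        using t(2) lv by (simp add: same_levels_def s3_def s2_def s1_def)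
      have ne: "16 * int B ^ Suc (Suc j) \<le> X" using powX[of "Suc (Suc j)"] j Suc.prems(8) by simp
      have "same_levels (Suc k) s t"
        using I same_levels_le[OF t(2), of "Suc k"] l3 same_levels_trans unfolding I_def by (meson lessI less_imp_le)
      then have "same_levels (Suc k) s (t(bnd k := 16 * int B ^ Suc (Suc j)))"
        by (auto simp: same_levels_def)
      moreover have "J (seen (Suc j)) (t(bnd k := 16 * int B ^ Suc (Suc j))) ys"
        unfolding seen_Suc by (rule frame[OF t(1)]) auto
      ultimately have "I (Suc j) (t(bnd k := 16 * int B ^ Suc (Suc j))) ys" by (simp add: I_def)
      then show "ends X ?fin 1 (I (Suc j)) t ys"
        using ne tl by (intro ends_Assign) (auto simp: mult_ac)
    qed
    have e1: "s' (cod (Suc k)) + s' (bnd k) = int (mem (c + B ^ Suc j))"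
      using lv mem_add[of c "B ^ Suc j"] by simp
    have mulbit: "ends X (next_multiplicity k) (1 + 1) Q s1 xs'" if "Q s2 xs'" for Q
      unfolding next_multiplicity_def
    proof (rule ends_Cond)
      assume "ev s1 (Minus (R (bnd (Suc k))) (R (bnd k))) > 0"
      then have "\<mu>' (Suc j) = 1" using lv strict[OF j] by (simp add: s1_def \<mu>'_def)
      then show "ends X (Set_to (mul k) (Num 1)) 1 Q s1 xs'"
        using that bdm by (intro ends_Assign) (auto simp: s2_def)
    next
      assume "\<not> ev s1 (Minus (R (bnd (Suc k))) (R (bnd k))) > 0"
      then have "int (\<mu>' (Suc j)) = int \<mu> + 1" using lv strict[OF j] by (simp add: s1_def \<mu>'_def)
      then show "ends X (Set_to (mul k) (Plus (R (mul (Suc k))) (Num 1))) 1 Q s1 xs'"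
        using that bdm lv by (intro ends_Assign) (auto simp: s1_def s2_def)
    qed simp
    have e3: "s2 (fac (Suc k)) * s2 (mul k) = int (f * \<mu>' (Suc j))"
      using lv by (simp add: s1_def s2_def)
    let ?tail = "Set_to (fac k) (Times (R (fac (Suc k))) (R (mul k))) ;; nest B body k ;; ?fin"
    have tail: "ends X ?tail (1 + (nest_time K n k + 1)) (I (Suc j)) s2 xs'"
    proof (rule ends_Set_Seq)
      show "ev s2 (Times (R (fac (Suc k))) (R (mul k))) = int (f * \<mu>' (Suc j))" using e3 by simp
      show "ends X (nest B body k ;; ?fin) (nest_time K n k + 1) (I (Suc j)) (s2(fac k := int (f * \<mu>' (Suc j)))) xs'"
        unfolding s3_def[symmetric] using nest by (rule ends_Seq)
    qed (use bd in auto)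
    have "ends X (next_multiplicity k ;; ?tail) ((1 + 1) + (1 + (nest_time K n k + 1))) (I (Suc j)) s1 xs'"
      by (rule ends_Seq, rule mulbit, rule tail)
    then show "ends X ?step T (I (Suc j)) s' xs'"
      unfolding nest_step_def T_def s1_def by (rule ends_Set_Seq[rotated 4]) (use bd e1 in auto)
  qed
  have loop: "ends X (While ?guard ?step) (m * (T + 1) + 1)
      (\<lambda>s' xs'. J (pre @ visits B (Suc k) m c \<mu> f) s' xs' \<and> same_levels (Suc k) s s') s' xs'"
    if "I 0 s' xs'" for s' xs'
  proof (rule ends_While[where I = I, OF iterate _ that])
    fix t ys assume I: "I m t ys"
    have "t (bnd (Suc k)) = 16 * int B ^ m" "t (bnd k) = 16 * int B ^ Suc m"
      using I Suc.prems by (auto simp: I_def same_levels_def)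
    moreover have "16 * int B ^ Suc m \<ge> 16 * int B ^ m + 1"
    proof -
      have "1 \<le> int B ^ m" using B by simp
      moreover have "2 * int B ^ m \<le> int B * int B ^ m" using B by (intro mult_right_mono) auto
      ultimately show ?thesis by simp
    qed
    ultimately show "data_exp t ?guard \<and> \<not> 0 < ev t ?guard \<and>
      J (pre @ visits B (Suc k) m c \<mu> f) t ys \<and> same_levels (Suc k) s t"
      using I by (simp add: I_def seen_m del: visits.simps)
  qed
  have first: "ends X (body (Suc k)) K (\<lambda>s' xs'. J (pre @ [(c, f)]) s' xs' \<and> same_levels 0 s s') s xs"
    using Suc.prems by (intro body[where post = "concat (map W [1..<Suc m]) @ post"]) (auto simp: vis simp del: upt_Suc visits.simps)
  have "ends X (nest B body (Suc k)) (K + (1 + (m * (T + 1) + 1)))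
    (\<lambda>s' xs'. J (pre @ visits B (Suc k) m c \<mu> f) s' xs' \<and> same_levels (Suc k) s s') s xs"
    unfolding nest.simps
  proof (rule ends_Seq, rule ends_mono[OF first order_refl], elim conjE)
    fix t ys assume t: "J (pre @ [(c, f)]) t ys" "same_levels 0 s t"
    have "I 0 (t(bnd k := 16 * int B)) ys"
      unfolding I_def
    proof (intro conjI)
      show "J (seen 0) (t(bnd k := 16 * int B)) ys"
        by (rule frame[of _ t]) (use t in \<open>auto simp: seen_def\<close>)
      show "same_levels (Suc k) s (t(bnd k := 16 * int B))" using t by (auto simp: same_levels_def)
    qed simp
    note L = loop[OF this]
    show "ends X (Set_to (bnd k) (Num (16 * int B)) ;; While ?guard ?step) (1 + (m * (T + 1) + 1))
      (\<lambda>s' xs'. J (pre @ visits B (Suc k) m c \<mu> f) s' xs' \<and> same_levels (Suc k) s s') t ys"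
      using powX[of 1] L by (intro ends_Set_Seq[where v = "16 * int B"]) auto
  qed
  then show ?case
  proof (rule ends_mono)
    have "m * (nest_time K n k + 6) \<le> n * (nest_time K n k + 6)" using Suc.prems(8) by (rule mult_right_mono) simp
    then show "K + (1 + (m * (T + 1) + 1)) \<le> nest_time K n (Suc k)"
      by (simp add: T_def algebra_simps)
  qed
qed

end

section \<open>The order in which the loops visit the exponent vectors\<close>

fun raise_first :: "nat list \<Rightarrow> nat list" where
  "raise_first [] = []"
| "raise_first (k # ks) = Suc k # ks"

lemma exponent_vectors_degree_0: "exponent_vectors m 0 = [replicate m 0]"
  by (induction m) auto

text \<open>
  In lexicographic order, the vectors whose first nonzero entry is at the \<open>j\<close>-th position from the end
  are obtained, in order, from the vectors of length \<open>j\<close> and smaller degree by raising the first entry.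
  This is what matches the order of the input with the nest of loops.
\<close>

lemma exponent_vectors_by_first:
  "exponent_vectors m (Suc d) = replicate m 0 # concat (map (\<lambda>j.
     map (\<lambda>ks. replicate (m - j) 0 @ raise_first ks) (exponent_vectors j d)) [1..<Suc m])"
proof (induction m)
  case (Suc m)
  have "[0..<Suc (Suc d)] = 0 # map Suc [0..<Suc d]"
    by (simp add: upt_conv_Cons map_Suc_upt del: upt_Suc)
  then have "exponent_vectors (Suc m) (Suc d) =
      map ((#) 0) (exponent_vectors m (Suc d)) @ map raise_first (exponent_vectors (Suc m) d)"
    by (simp add: map_concat comp_def del: upt_Suc)
  also have "map ((#) 0) (exponent_vectors m (Suc d)) = replicate (Suc m) 0 # concat (map (\<lambda>j.
      map (\<lambda>ks. replicate (Suc m - j) 0 @ raise_first ks) (exponent_vectors j d)) [1..<Suc m])"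
    unfolding Suc.IH by (auto simp: map_concat comp_def Suc_diff_le simp del: upt_Suc intro!: arg_cong[of _ _ concat])
  finally show ?case by simp
qed simp

text \<open>
  The product of the factorials of the entries, except that the first entry continues a run of length
  \<open>\<mu>\<close> and the factors of this run are left out.
\<close>

definition weight :: "nat \<Rightarrow> nat list \<Rightarrow> nat" where
  "weight \<mu> ks = (case ks of [] \<Rightarrow> 1 | k # ks \<Rightarrow> (\<Prod>i<k. Suc (\<mu> + i)) * prod_list (map fact ks))"

lemma prod_Suc_eq_fact: "(\<Prod>i<k. Suc i) = fact k"
  by (induction k) auto

lemma weight_0: "weight 0 ks = prod_list (map fact ks)"
  by (cases ks) (auto simp: weight_def prod_Suc_eq_fact)

lemma list_code_zeros: "list_code B (replicate m 0 @ ks) = list_code B ks"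
  by (induction m) auto

lemma visits_eq:
  "visits B k m c \<mu> f = map (\<lambda>ks. (c + list_code B ks, f * weight \<mu> ks)) (exponent_vectors m k)"
proof (induction k arbitrary: m c \<mu> f)
  case 0
  have "weight \<mu> (replicate m 0) = 1" by (cases m) (auto simp: weight_def map_replicate_const)
  then show ?case using list_code_zeros[of B m "[]"] by (simp add: exponent_vectors_degree_0)
next
  case (Suc k)
  have zero: "weight \<mu> (replicate m 0) = 1" "list_code B (replicate m 0) = 0"
    using list_code_zeros[of B m "[]"] by (cases m; auto simp: weight_def map_replicate_const)+
  have eq: "map (\<lambda>ks. (c + list_code B ks, f * weight \<mu> ks))
        (map (\<lambda>ks. replicate (m - j) 0 @ raise_first ks) (exponent_vectors j k)) =
      (let \<mu>' = if j < m then 1 else Suc \<mu> in visits B k j (c + B ^ j) \<mu>' (f * \<mu>'))"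
    if j: "j \<in> set [1..<Suc m]" for j
  proof -
    have "weight \<mu> (replicate (m - j) 0 @ raise_first ks) =
        (if j < m then 1 else Suc \<mu>) * weight (if j < m then 1 else Suc \<mu>) ks \<and>
        list_code B (replicate (m - j) 0 @ raise_first ks) = B ^ j + list_code B ks"
      if ks: "ks \<in> set (exponent_vectors j k)" for ks
    proof -
      have "length ks = j" "j \<ge> 1" using ks j unfolding set_exponent_vectors by auto
      then obtain a l where al: "ks = a # l" "j = Suc (length l)" by (cases ks) auto
      show ?thesis
      proof (cases "j < m")
        case True
        then obtain z where z: "m - j = Suc z" by (metis Suc_diff_Suc)
        have "fact (Suc a) = (\<Prod>i<a. Suc (Suc i))"
          unfolding prod_Suc_eq_fact[symmetric] by (subst prod.lessThan_Suc_shift) simp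
        have rep: "replicate (m - j) 0 @ raise_first ks = 0 # replicate z 0 @ Suc a # l"
          unfolding z by (simp add: al(1))
        show ?thesis using True \<open>fact (Suc a) = _\<close> unfolding rep
          by (simp add: al weight_def list_code_zeros map_replicate_const del: fact_Suc)
      next
        case False
        have "(\<Prod>i<Suc a. Suc (\<mu> + i)) = Suc \<mu> * (\<Prod>i<a. Suc (Suc \<mu> + i))"
          by (subst prod.lessThan_Suc_shift) simp
        then show ?thesis using False
          by (simp add: al weight_def distrib_right mult.assoc del: prod.lessThan_Suc)
      qed
    qed
    then show ?thesis by (simp add: Let_def Suc.IH comp_def mult.assoc add.assoc)
  qed
  let ?F = "\<lambda>ks. (c + list_code B ks, f * weight \<mu> ks)"
  have "map ?F (exponent_vectors m (Suc k)) = (c, f) # concat (map (\<lambda>j. map ?F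
      (map (\<lambda>ks. replicate (m - j) 0 @ raise_first ks) (exponent_vectors j k))) [1..<Suc m])"
    unfolding exponent_vectors_by_first by (simp only: list.map zero map_concat map_map comp_def) simp
  also have "\<dots> = visits B (Suc k) m c \<mu> f"
    unfolding visits.simps by (simp only: eq cong: map_cong)
  finally show ?case by simp
qed

section \<open>The phases of the program\<close>

lemma ends_bounded:
  assumes "ends X c K Q s xs" and "bounded_by X s"
  shows "ends X c K (\<lambda>s xs. Q s xs \<and> bounded_by X s) s xs"
  using assms exec_bounded unfolding ends_def by fastforce

abbreviation "NN \<equiv> sc 0"
abbreviation "TOP \<equiv> sc 2"
abbreviation "CNT \<equiv> sc 3"
abbreviation "IW \<equiv> sc 4"
abbreviation "W \<equiv> sc 5"
abbreviation "OK \<equiv> sc 6"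
abbreviation "A1 \<equiv> sc 7"
abbreviation "A2 \<equiv> sc 8"
abbreviation "A3 \<equiv> sc 9"
abbreviation "A4 \<equiv> sc 10"
abbreviation "RES \<equiv> sc 11"
abbreviation "DUMMY \<equiv> sc 12"

text \<open>
  Computes the weight of the first variable, \<open>B ^ n\<close>, in the scaling of \<open>mem_add\<close>.
\<close>

definition init_com :: "nat \<Rightarrow> com" where
  "init_com B = Get (Reg NN) ;; Set_to TOP (Num 16) ;; Set_to CNT (R NN) ;;
     While (R CNT) (Set_to TOP (Times (R TOP) (Num (int B))) ;; Set_to CNT (Minus (R CNT) (Num 1)))"

definition read_body :: "nat \<Rightarrow> com" where
  "read_body k = Get (Ind (cod k)) ;; Assign (Ind (cod k)) (Times (At (cod k)) (R (fac k)))"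

definition traverse :: "nat \<Rightarrow> (nat \<Rightarrow> com) \<Rightarrow> nat \<Rightarrow> com" where
  "traverse B body k = Set_to (bnd k) (R TOP) ;; Set_to (cod k) (Num (int (mem 0))) ;;
     Set_to (mul k) (Num 0) ;; Set_to (fac k) (Num 1) ;; nest B body k"

text \<open>
  \<open>IW\<close> ends up with the largest weight of a variable whose pure power of degree \<open>d\<close> has a nonzero
  coefficient, and stays 0 if there is none. Nonzero numbers are recognized by their positive square.
\<close>

definition find_step :: "nat \<Rightarrow> nat \<Rightarrow> com" where
  "find_step B d =
     Set_to A1 (Plus (Num (int (mem 0))) (Times (Num (int d)) (R W))) ;;
     Cond (Times (At A1) (At A1)) (Set_to IW (R W)) (Set_to DUMMY (Num 0)) ;;
     Set_to W (Times (R W) (Num (int B)))"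

definition find_com :: "nat \<Rightarrow> nat \<Rightarrow> com" where
  "find_com B d = Set_to IW (Num 0) ;; Set_to W (Num (16 * int B)) ;;
     While (at_most W TOP) (find_step B d)"

definition mismatch :: exp where
  "mismatch = Minus (Times (At A1) (At A2)) (Times (At A3) (At A4))"

text \<open>
  The identities of \<open>single_direction\<close> for the monomial at hand and the variable of weight \<open>W\<close>.
\<close>

definition check_step :: "nat \<Rightarrow> nat \<Rightarrow> nat \<Rightarrow> com" where
  "check_step B d k =
     Set_to A1 (Plus (R (cod k)) (R W)) ;;
     Set_to A2 (Plus (Num (int (mem 0))) (Times (Num (int (Suc d))) (R IW))) ;;
     Set_to A3 (Plus (R (cod k)) (R IW)) ;;
     Set_to A4 (Plus (Num (int (mem 0))) (Plus (Times (Num (int d)) (R IW)) (R W))) ;;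
     Cond (Times mismatch mismatch) (Set_to OK (Num 0)) (Set_to DUMMY (Num 0)) ;;
     Set_to W (Times (R W) (Num (int B)))"

definition check_body :: "nat \<Rightarrow> nat \<Rightarrow> nat \<Rightarrow> com" where
  "check_body B d k =
     Set_to W (Num (16 * int B)) ;; While (at_most W TOP) (check_step B d k)"

primrec load_com :: "nat \<Rightarrow> com" where
  "load_com 0 = Set_to A1 (Num (int (mem 0))) ;; Set_to (tv 0) (At A1)"
| "load_com (Suc k) = load_com k ;;
     Set_to A1 (Plus (Num (int (mem 0))) (Times (Num (int (Suc k))) (R IW))) ;; Set_to (tv (Suc k)) (At A1)"

primrec tree_com :: "bool tree \<Rightarrow> com" where
  "tree_com (Leaf b) = Set_to RES (Num (if b then 1 else 0))"
| "tree_com (Test e t u) = Cond e (tree_com t) (tree_com u)"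

primrec tree_height :: "'a tree \<Rightarrow> nat" where
  "tree_height (Leaf b) = 1"
| "tree_height (Test e t u) = max (tree_height t) (tree_height u) + 1"

lemma static_exp_data: "static_exp e \<Longrightarrow> data_exp s e"
proof (induction e)
  case (Var l)
  then show ?case by (cases l) auto
qed auto

lemma ends_tree:
  assumes "1 \<le> X"
  shows "static_tree t \<Longrightarrow> ends X (tree_com t) (tree_height t)
    (\<lambda>s' xs'. s' = s(RES := if outcome s t then 1 else 0)) s xs"
proof (induction t)
  case (Leaf b)
  show ?case unfolding tree_com.simps tree_height.simps
    by (rule ends_Assign) (use assms in auto)
next
  case (Test e t u)
  show ?case unfolding tree_com.simps tree_height.simps
    by (rule ends_Cond) (use Test in \<open>auto simp: static_exp_data elim!: ends_mono\<close>)
qed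

lemma ends_init:
  assumes "int n \<le> X" and "16 * int B ^ n \<le> X" and B: "B \<ge> 2"
  shows "ends X (init_com B) (n * 3 + 4) (\<lambda>s xs. s TOP = 16 * int B ^ n \<and> xs = cs) (\<lambda>_. 0) (int n # cs)"
proof -
  define I where "I j s xs \<longleftrightarrow> s TOP = 16 * int B ^ j \<and> s CNT = int n - int j \<and> xs = cs" for j :: nat and s :: registers and xs
  have pow: "16 * int B ^ j \<le> X" if "j \<le> n" for j
  proof -
    have "int B ^ j \<le> int B ^ n" using that B by (intro power_increasing) auto
    with assms(2) show ?thesis by linarith
  qed
  have loop: "ends X (While (R CNT) (Set_to TOP (Times (R TOP) (Num (int B))) ;; Set_to CNT (Minus (R CNT) (Num 1))))
      (n * (1 + 1 + 1) + 1) (\<lambda>s xs. s TOP = 16 * int B ^ n \<and> xs = cs) s xs"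
    if "I 0 s xs" for s xs
  proof (rule ends_While[where I = I, OF _ _ that])
    fix j s xs assume j: "j < n" and I: "I j s xs"
    have "ends X (Set_to TOP (Times (R TOP) (Num (int B))) ;; Set_to CNT (Minus (R CNT) (Num 1))) (1 + 1) (I (Suc j)) s xs"
      using I j pow[of "Suc j"] assms(1)
      by (intro ends_Seq ends_Assign) (auto simp: I_def mult_ac)
    then show "data_exp s (R CNT) \<and> 0 < ev s (R CNT) \<and>
        ends X (Set_to TOP (Times (R TOP) (Num (int B))) ;; Set_to CNT (Minus (R CNT) (Num 1))) (1 + 1) (I (Suc j)) s xs"
      using I j by (auto simp: I_def)
  qed (auto simp: I_def)
  have "ends X (init_com B) (1 + (1 + (1 + (n * (1 + 1 + 1) + 1)))) (\<lambda>s xs. s TOP = 16 * int B ^ n \<and> xs = cs) (\<lambda>_. 0) (int n # cs)"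
    unfolding init_com_def
    using assms pow[of 0] loop[of "(\<lambda>_. 0)(NN := int n, TOP := 16, CNT := int n)" cs]
    by (intro ends_Seq ends_Get ends_Assign) (auto simp: I_def)
  then show ?thesis by (rule ends_mono) auto
qed

lemma ends_traverse:
  assumes B: "B \<ge> 2"
    and frame: "\<And>vs s s' xs. J vs s xs \<Longrightarrow> (\<And>i. \<not> is_level i \<Longrightarrow> s' i = s i) \<Longrightarrow> J vs s' xs"
    and body: "\<And>pre c f post k s xs. visits B d n 0 0 1 = pre @ (c, f) # post \<Longrightarrow> J pre s xs \<Longrightarrow>
      s (cod k) = int (mem c) \<Longrightarrow> s (fac k) = int f \<Longrightarrow>
      ends X (body k) K (\<lambda>s' xs'. J (pre @ [(c, f)]) s' xs' \<and> same_levels 0 s s') s xs"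
    and V_bound: "\<And>c f. (c, f) \<in> set (visits B d n 0 0 1) \<Longrightarrow> int (mem c) \<le> X \<and> int f \<le> X"
    and X: "16 * int B ^ Suc n \<le> X"
    and start: "J [] s xs" "s TOP = 16 * int B ^ n"
  shows "ends X (traverse B body d) (nest_time K n d + 4) (J (visits B d n 0 0 1)) s xs"
proof -
  let ?s = "s(bnd d := 16 * int B ^ n, cod d := int (mem 0), mul d := 0, fac d := 1)"
  have "ends X (nest B body d) (nest_time K n d) (\<lambda>s' xs'. J ([] @ visits B d n 0 0 1) s' xs' \<and> same_levels d ?s s') ?s xs"
  proof (rule ends_nest[where J = J and V = "visits B d n 0 0 1" and post = "[]"])
    show "J vs s' xs" if "J vs s xs" "\<And>i. \<not> is_level i \<Longrightarrow> s' i = s i" for vs s s' xs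
      using that by (rule frame)
    show "J [] ?s xs" by (rule frame[OF start(1)]) auto
    show "ends X (body k) K (\<lambda>s' xs'. J (pre @ [(c, f)]) s' xs' \<and> same_levels 0 s s') s xs"
      if "visits B d n 0 0 1 = pre @ (c, f) # post" "J pre s xs" "s (cod k) = int (mem c)" "s (fac k) = int f"
      for pre c f post k s xs
      using that by (rule body)
  qed (use B V_bound X in auto)
  then have nest: "ends X (nest B body d) (nest_time K n d) (J (visits B d n 0 0 1)) ?s xs"
    by (rule ends_mono) auto
  have "int B ^ n \<le> int B ^ Suc n" using B by (intro power_increasing) auto
  then have t: "16 * int B ^ n \<le> X" using X by linarith
  have "1 \<le> int B ^ Suc n" using B by (simp add: one_le_power del: power_Suc)
  then have m: "int (mem 0) \<le> X" "1 \<le> X" using X by (auto simp: reg_def)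
  have "ends X (traverse B body d) (1 + (1 + (1 + (1 + nest_time K n d)))) (J (visits B d n 0 0 1)) s xs"
    unfolding traverse_def
    using t m nest start by (intro ends_Seq ends_Assign) auto
  then show ?thesis by (rule ends_mono) auto
qed

text \<open>
  Cells that have been filled stay intact because distinct exponent vectors have distinct codes.
\<close>

lemma ends_read:
  assumes B: "B \<ge> 2" and X: "16 * int B ^ Suc n \<le> X"
    and V: "V = visits B d n 0 0 1"
    and dist: "distinct (map fst V)"
    and V_bound: "\<And>c f. (c, f) \<in> set V \<Longrightarrow> int (mem c) \<le> X \<and> int f \<le> X"
    and len: "length cs = length V"
    and c_bound: "\<And>i. i < length V \<Longrightarrow> \<bar>cs ! i\<bar> \<le> X \<and> \<bar>cs ! i * int (snd (V ! i))\<bar> \<le> X"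
    and s: "s TOP = 16 * int B ^ n"
  shows "ends X (traverse B read_body d) (nest_time 2 n d + 4)
    (\<lambda>s' xs'. s' TOP = 16 * int B ^ n \<and> (\<forall>i<length V. s' (mem (fst (V ! i))) = cs ! i * int (snd (V ! i)))) s cs"
proof -
  define J where "J pre s xs \<longleftrightarrow> xs = drop (length pre) cs \<and> s TOP = 16 * int B ^ n \<and>
    (\<forall>i<length pre. s (mem (fst (pre ! i))) = cs ! i * int (snd (pre ! i)))" for pre s xs
  have "ends X (traverse B read_body d) (nest_time 2 n d + 4) (J (visits B d n 0 0 1)) s cs"
  proof (rule ends_traverse[where J = J])
    show "J [] s cs" using s by (simp add: J_def)
    show "B \<ge> 2" "16 * int B ^ Suc n \<le> X" "s TOP = 16 * int B ^ n" by fact+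
    show "int (mem c) \<le> X \<and> int f \<le> X" if "(c, f) \<in> set (visits B d n 0 0 1)" for c f
      using that V_bound V by blast
    fix vs s s' xs assume "J vs s xs" "\<And>i. \<not> is_level i \<Longrightarrow> s' i = s i"
    then show "J vs s' xs" by (simp add: J_def)
  next
    fix pre c f post k s xs
    assume split: "visits B d n 0 0 1 = pre @ (c, f) # post" and J: "J pre s xs"
      and lv: "s (cod k) = int (mem c)" "s (fac k) = int f"
    let ?i = "length pre"
    have Vi: "V ! ?i = (c, f)" "?i < length V" using split V by auto
    have xs: "xs = cs ! ?i # drop (Suc ?i) cs" using J Vi(2) len by (simp add: J_def Cons_nth_drop_Suc)
    have fresh: "fst (pre ! i) \<noteq> c" if "i < ?i" for i
    proof -
      have "fst (pre ! i) \<in> set (map fst pre)" using that by simp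
      moreover have "c \<notin> set (map fst pre)" using dist unfolding V split by auto
      ultimately show ?thesis by metis
    qed
    let ?s1 = "s(mem c := cs ! ?i)" and ?s2 = "s(mem c := cs ! ?i * int f)"
    have J2: "J (pre @ [(c, f)]) ?s2 (drop (Suc ?i) cs)"
      unfolding J_def using J fresh by (auto simp: J_def nth_append less_Suc_eq)
    have "ends X (read_body k) (1 + 1) (\<lambda>s' xs'. J (pre @ [(c, f)]) s' xs' \<and> same_levels 0 s s') s (cs ! ?i # drop (Suc ?i) cs)"
      unfolding read_body_def
    proof (rule ends_Seq, rule ends_Get)
      show "data_loc s (Ind (cod k))" using lv by simp
      show "\<bar>cs ! ?i\<bar> \<le> X" using c_bound[OF Vi(2)] by simp
      have "ends X (Assign (Ind (cod k)) (Times (At (cod k)) (R (fac k)))) 1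
        (\<lambda>s' xs'. J (pre @ [(c, f)]) s' xs' \<and> same_levels 0 s s') ?s1 (drop (Suc ?i) cs)"
        using c_bound[OF Vi(2)] Vi(1) lv J2 by (intro ends_Assign) (auto simp: same_levels_def)
      then show "ends X (Assign (Ind (cod k)) (Times (At (cod k)) (R (fac k)))) 1
        (\<lambda>s' xs'. J (pre @ [(c, f)]) s' xs' \<and> same_levels 0 s s') (s(address s (Ind (cod k)) := cs ! ?i)) (drop (Suc ?i) cs)"
        using lv by simp
    qed
    then show "ends X (read_body k) 2 (\<lambda>s' xs'. J (pre @ [(c, f)]) s' xs' \<and> same_levels 0 s s') s xs"
      unfolding xs by (simp only: one_add_one)
  qed
  then show ?thesis by (rule ends_mono) (auto simp: J_def V)
qed

lemma mem_mono: "a \<le> b \<Longrightarrow> mem a \<le> mem b"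
  by (simp add: reg_def)

lemma ends_find:
  assumes B: "B \<ge> 2" and X: "16 * int B ^ Suc n \<le> X" and d: "int (mem (d * B ^ n)) \<le> X"
    and s: "s TOP = 16 * int B ^ n"
  shows "ends X (find_com B d) (n * 5 + 3)
    (\<lambda>s' xs'. s' TOP = s TOP \<and> (\<forall>c. s' (mem c) = s (mem c)) \<and>
      (s' IW = 0 \<and> (\<forall>j\<in>{1..n}. s (mem (d * B ^ j)) = 0) \<or>
       (\<exists>j\<in>{1..n}. s' IW = 16 * int B ^ j \<and> s (mem (d * B ^ j)) \<noteq> 0))) s xs"
    (is "ends X _ _ ?Q s xs")
proof -
  define I where "I j t (ys :: int list) \<longleftrightarrow> t TOP = s TOP \<and> (\<forall>c. t (mem c) = s (mem c)) \<and> t W = 16 * int B ^ Suc j \<and>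
      (t IW = 0 \<and> (\<forall>i\<in>{1..j}. s (mem (d * B ^ i)) = 0) \<or>
       (\<exists>i\<in>{1..j}. t IW = 16 * int B ^ i \<and> s (mem (d * B ^ i)) \<noteq> 0))" for j t ys
  have pow: "16 * int B ^ j \<le> X" if "j \<le> Suc n" for j
  proof -
    have "int B ^ j \<le> int B ^ Suc n" using that B by (intro power_increasing) auto
    with X show ?thesis by linarith
  qed
  have mem: "int (mem 0) + int d * (16 * int B ^ j) = int (mem (d * B ^ j))" for j
    by (simp add: reg_def)
  have memX: "int (mem (d * B ^ j)) \<le> X" if "j \<le> n" for j
  proof -
    have "d * B ^ j \<le> d * B ^ n" using that B by (intro mult_left_mono power_increasing) auto
    then have "mem (d * B ^ j) \<le> mem (d * B ^ n)" by (rule mem_mono)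
    with d show ?thesis by linarith
  qed
  have X1: "1 \<le> X" using pow[of 0] by simp
  let ?step2 = "Cond (Times (At A1) (At A1)) (Set_to IW (R W)) (Set_to DUMMY (Num 0))"
    and ?step3 = "Set_to W (Times (R W) (Num (int B)))"
  have loop: "ends X (While (at_most W TOP) (find_step B d)) (n * (4 + 1) + 1) ?Q t ys"
    if "I 0 t ys" for t ys
  proof (rule ends_While[where I = I, OF _ _ that])
    fix j t ys assume j: "j < n" and I: "I j t ys"
    have W: "t W = 16 * int B ^ Suc j" "t TOP = 16 * int B ^ n" using I s by (auto simp: I_def)
    have "16 * int B ^ Suc j \<le> 16 * int B ^ n" using j B by (simp add: power_increasing del: power_Suc)
    then have guard: "0 < ev t (at_most W TOP)" using W by simp
    let ?M = "mem (d * B ^ Suc j)"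
    let ?t = "t(A1 := int ?M)"
    have next_I: "I (Suc j) (u(W := 16 * int B ^ Suc (Suc j))) ys"
      if "u = (if s ?M \<noteq> 0 then ?t(IW := 16 * int B ^ Suc j) else ?t(DUMMY := 0))" for u
      unfolding I_def
    proof (intro conjI)
      have old: "t IW = 0 \<and> (\<forall>i\<in>{1..j}. s (mem (d * B ^ i)) = 0) \<or>
       (\<exists>i\<in>{1..j}. t IW = 16 * int B ^ i \<and> s (mem (d * B ^ i)) \<noteq> 0)" using I by (simp add: I_def)
      show "(u(W := 16 * int B ^ Suc (Suc j))) IW = 0 \<and> (\<forall>i\<in>{1..Suc j}. s (mem (d * B ^ i)) = 0) \<or>
       (\<exists>i\<in>{1..Suc j}. (u(W := 16 * int B ^ Suc (Suc j))) IW = 16 * int B ^ i \<and> s (mem (d * B ^ i)) \<noteq> 0)"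
      proof (cases "s ?M = 0")
        case True
        then have "u IW = t IW" using that by simp
        then show ?thesis using old True by (auto simp: atLeastAtMostSuc_conv simp del: power_Suc)
      next
        case False
        then have "u IW = 16 * int B ^ Suc j" using that by simp
        then show ?thesis using False by (intro disjI2 bexI[of _ "Suc j"]) (auto simp del: power_Suc)
      qed
    qed (use I that in \<open>auto simp: I_def\<close>)
    have last: "ends X ?step3 1 (I (Suc j)) u ys"
      if "u = (if s ?M \<noteq> 0 then ?t(IW := 16 * int B ^ Suc j) else ?t(DUMMY := 0))" for u
    proof (rule ends_Assign)
      have uW: "u W * int B = 16 * int B ^ Suc (Suc j)" using that W by simp
      then show "\<bar>ev u (Times (R W) (Num (int B)))\<bar> \<le> X"
        unfolding ev.simps arith_fun.simps address.simps uW
        using pow[of "Suc (Suc j)"] j by (simp del: power_Suc)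
      show "I (Suc j) (u(address u (Reg W) := ev u (Times (R W) (Num (int B))))) ys"
        using next_I[OF that] uW by (simp del: power_Suc)
    qed simp_all
    have cond: "ends X (?step2 ;; ?step3) (1 + 1 + 1) (I (Suc j)) ?t ys"
    proof (rule ends_Seq, rule ends_Cond)
      have tM: "ev ?t (Times (At A1) (At A1)) = s ?M * s ?M" using I by (simp add: I_def)
      show "ends X (Set_to IW (R W)) 1 (ends X ?step3 1 (I (Suc j))) ?t ys"
        if "0 < ev ?t (Times (At A1) (At A1))"
      proof -
        have "s ?M \<noteq> 0" using that tM by auto
        then show ?thesis using W pow[of "Suc j"] j by (intro ends_Assign last) auto
      qed
      show "ends X (Set_to DUMMY (Num 0)) 1 (ends X ?step3 1 (I (Suc j))) ?t ys"
        if "\<not> 0 < ev ?t (Times (At A1) (At A1))"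
      proof -
        have "s ?M = 0" using that tM by (auto simp: zero_less_mult_iff linorder_neq_iff)
        then show ?thesis using X1 by (intro ends_Assign last) auto
      qed
    qed simp
    have "ends X (find_step B d) (1 + (1 + 1 + 1)) (I (Suc j)) t ys"
      unfolding find_step_def
    proof (rule ends_Set_Seq[OF _ _ _ _ cond])
      show "ev t (Plus (Num (int (mem 0))) (Times (Num (int d)) (R W))) = int ?M"
        using mem[of "Suc j"] W by simp
      show "\<bar>int ?M\<bar> \<le> X" using memX[of "Suc j"] j by simp
    qed simp_all
    then have "ends X (find_step B d) 4 (I (Suc j)) t ys" by (rule ends_mono) auto
    then show "data_exp t (at_most W TOP) \<and> 0 < ev t (at_most W TOP) \<and>
      ends X (find_step B d) 4 (I (Suc j)) t ys"
      using guard by simp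
  next
    fix t ys assume I: "I n t ys"
    have "1 \<le> int B ^ n" using B by simp
    moreover have "2 * int B ^ n \<le> int B * int B ^ n" using B by (intro mult_right_mono) auto
    ultimately have "16 * int B ^ n + 1 \<le> 16 * int B ^ Suc n" by simp
    then show "data_exp t (at_most W TOP) \<and> \<not> 0 < ev t (at_most W TOP) \<and> ?Q t ys"
      using I s by (simp add: I_def)
  qed
  have "ends X (find_com B d) (1 + (1 + (n * (4 + 1) + 1))) ?Q s xs"
    unfolding find_com_def using X1 pow[of 1] loop[of "s(IW := 0, W := 16 * int B)" xs]
    by (intro ends_Seq ends_Assign) (auto simp: I_def)
  then show ?thesis by (rule ends_mono) auto
qed

text \<open>
  The weight \<open>q\<close> of the selected variable may be 0, in case that none was found. The program runs the
  check even then, and the final multiplication by \<open>IW\<close> makes it reject.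
\<close>

lemma ends_check:
  assumes B: "B \<ge> 2" and V: "V = visits B d n 0 0 1"
    and V_bound: "\<And>c f. (c, f) \<in> set V \<Longrightarrow> int (mem (c + B ^ n)) \<le> X \<and> int f \<le> X"
    and X: "16 * int B ^ Suc n \<le> X" and dX: "int (mem (Suc d * B ^ n)) \<le> X"
    and q: "q \<le> B ^ n"
    and s: "s TOP = 16 * int B ^ n" "s IW = 16 * int q"
  shows "ends X (Set_to OK (Num 1) ;; traverse B (check_body B d) d) (nest_time (n * 8 + 2) n d + 5)
    (\<lambda>s' xs'. s' IW = s IW \<and> (\<forall>c. s' (mem c) = s (mem c)) \<and>
      s' OK = of_bool (\<forall>(c, f)\<in>set V. \<forall>j\<in>{1..n}.
        s (mem (c + B ^ j)) * s (mem (Suc d * q)) = s (mem (c + q)) * s (mem (d * q + B ^ j)))) s xs"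
proof -
  define holds where "holds c j \<longleftrightarrow>
    s (mem (c + B ^ j)) * s (mem (Suc d * q)) = s (mem (c + q)) * s (mem (d * q + B ^ j))" for c j
  define good where "good c = (\<forall>j\<in>{1..n}. holds c j)" for c
  define J where "J pre t (ys :: int list) \<longleftrightarrow> t TOP = s TOP \<and> t IW = s IW \<and> (\<forall>c. t (mem c) = s (mem c)) \<and>
    t OK = of_bool (\<forall>(c, f)\<in>set pre. good c)" for pre :: "(nat \<times> nat) list" and t ys
  have pow: "16 * int B ^ j \<le> X" if "j \<le> Suc n" for j
  proof -
    have "int B ^ j \<le> int B ^ Suc n" using that B by (intro power_increasing) auto
    with X show ?thesis by linarith
  qed
  have X1: "1 \<le> X" using pow[of 0] by simp
  have memX: "int (mem (d * q + b)) \<le> X" "int (mem (Suc d * q)) \<le> X" if "b \<le> B ^ n" for b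
  proof -
    have "d * q + b \<le> d * B ^ n + B ^ n" using that q by (intro add_mono mult_left_mono) auto
    then have "int (mem (d * q + b)) \<le> int (mem (Suc d * B ^ n))"
      using mem_mono[of "d * q + b" "Suc d * B ^ n"] by (simp add: add.commute)
    with dX show "int (mem (d * q + b)) \<le> X" by linarith
    have "Suc d * q \<le> Suc d * B ^ n" using q by (rule mult_left_mono) simp
    then have "int (mem (Suc d * q)) \<le> int (mem (Suc d * B ^ n))" using mem_mono by simp
    with dX show "int (mem (Suc d * q)) \<le> X" by linarith
  qed
  have body: "ends X (check_body B d k) (1 + (n * (7 + 1) + 1))
      (\<lambda>s' xs'. J (pre @ [(c, f)]) s' xs' \<and> same_levels 0 t s') t ys"
    if cf: "(c, f) \<in> set V" and J: "J pre t ys" and lv: "t (cod k) = int (mem c)" for pre c f k t ys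
  proof -
    define I where "I j u (zs :: int list) \<longleftrightarrow> u TOP = s TOP \<and> u IW = s IW \<and> (\<forall>c. u (mem c) = s (mem c)) \<and>
      same_levels 0 t u \<and> u W = 16 * int B ^ Suc j \<and>
      u OK = of_bool ((\<forall>(c, f)\<in>set pre. good c) \<and> (\<forall>i\<in>{1..j}. holds c i))" for j u zs
    have cX: "int (mem (c + b)) \<le> X" if "b \<le> B ^ n" for b
      using V_bound[OF cf] mem_mono[of "c + b" "c + B ^ n"] that by auto
    have "ends X (While (at_most W TOP) (check_step B d k)) (n * (7 + 1) + 1)
        (\<lambda>s' xs'. J (pre @ [(c, f)]) s' xs' \<and> same_levels 0 t s') u ys" if "I 0 u ys" for u
    proof (rule ends_While[where I = I, OF _ _ that])
      fix j u zs assume j: "j < n" and I: "I j u zs"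
      have W: "u W = 16 * int B ^ Suc j" "u TOP = 16 * int B ^ n" "u IW = 16 * int q"
        and cod: "u (cod k) = int (mem c)"
        using I s lv by (auto simp: I_def same_levels_def)
      have Bj: "B ^ Suc j \<le> B ^ n" using j B by (intro power_increasing) auto
      then have "16 * int B ^ Suc j \<le> 16 * int B ^ n"
        by (simp del: power_Suc flip: of_nat_power)
      then have guard: "0 < ev u (at_most W TOP)" using W by simp
      let ?a1 = "mem (c + B ^ Suc j)" and ?a2 = "mem (Suc d * q)" and ?a3 = "mem (c + q)" and ?a4 = "mem (d * q + B ^ Suc j)"
      let ?u4 = "u(A1 := int ?a1, A2 := int ?a2, A3 := int ?a3, A4 := int ?a4)"
      have e1: "u (cod k) + u W = int ?a1" using cod W mem_add[of c "B ^ Suc j"] by simp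
      have e2: "int (mem 0) + int (Suc d) * u IW = int ?a2" using W by (simp add: reg_def algebra_simps)
      have e3: "u (cod k) + u IW = int ?a3" using cod W mem_add[of c q] by simp
      have e4: "int (mem 0) + (int d * u IW + u W) = int ?a4" using W by (simp add: reg_def algebra_simps)
      have b: "\<bar>int ?a1\<bar> \<le> X" "\<bar>int ?a2\<bar> \<le> X" "\<bar>int ?a3\<bar> \<le> X" "\<bar>int ?a4\<bar> \<le> X"
        using cX[OF Bj] cX[OF q] memX[OF Bj] by auto
      have I4: "I j ?u4 zs" using I by (auto simp: I_def same_levels_def)
      have evE: "ev ?u4 (Times mismatch mismatch) > 0 \<longleftrightarrow> \<not> holds c (Suc j)"
      proof -
        have "ev ?u4 mismatch = s ?a1 * s ?a2 - s ?a3 * s ?a4"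
          using I by (simp add: mismatch_def I_def)
        then show ?thesis by (auto simp: holds_def zero_less_mult_iff linorder_neq_iff simp del: power_Suc mult_Suc)
      qed
      let ?c6 = "Set_to W (Times (R W) (Num (int B)))"
      let ?c5 = "Cond (Times mismatch mismatch) (Set_to OK (Num 0)) (Set_to DUMMY (Num 0)) ;; ?c6"
      let ?c4 = "Set_to A4 (Plus (Num (int (mem 0))) (Plus (Times (Num (int d)) (R IW)) (R W))) ;; ?c5"
      let ?c3 = "Set_to A3 (Plus (R (cod k)) (R IW)) ;; ?c4"
      let ?c2 = "Set_to A2 (Plus (Num (int (mem 0))) (Times (Num (int (Suc d))) (R IW))) ;; ?c3"
      have last: "ends X ?c6 1 (I (Suc j)) v zs"
        if v: "v = (if holds c (Suc j) then ?u4(DUMMY := 0) else ?u4(OK := 0))" for v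
      proof (rule ends_Assign)
        have vW: "v W * int B = 16 * int B ^ Suc (Suc j)" using v W by simp
        show "\<bar>ev v (Times (R W) (Num (int B)))\<bar> \<le> X"
          unfolding ev.simps arith_fun.simps address.simps vW
          using pow[of "Suc (Suc j)"] j by (simp del: power_Suc)
        have upto: "{1..Suc j} = insert (Suc j) {1..j}" by auto
        show "I (Suc j) (v(address v (Reg W) := ev v (Times (R W) (Num (int B))))) zs"
          unfolding ev.simps arith_fun.simps address.simps vW
          using I v unfolding I_def upto by (auto simp: same_levels_def simp del: power_Suc)
      qed simp_all
      have dE: "data_exp ?u4 (Times mismatch mismatch)" by (simp add: mismatch_def)
      have c5: "ends X ?c5 (1 + 1 + 1) (I (Suc j)) ?u4 zs"
      proof (rule ends_Seq, rule ends_Cond, rule dE)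
        show "ends X (Set_to OK (Num 0)) 1 (ends X ?c6 1 (I (Suc j))) ?u4 zs"
          if "0 < ev ?u4 (Times mismatch mismatch)"
          using that X1 unfolding evE by (intro ends_Assign last) auto
        show "ends X (Set_to DUMMY (Num 0)) 1 (ends X ?c6 1 (I (Suc j))) ?u4 zs"
          if "\<not> 0 < ev ?u4 (Times mismatch mismatch)"
          using that X1 unfolding evE by (intro ends_Assign last) auto
      qed
      let ?u1 = "u(A1 := int ?a1)" and ?u2 = "u(A1 := int ?a1, A2 := int ?a2)"
        and ?u3 = "u(A1 := int ?a1, A2 := int ?a2, A3 := int ?a3)"
      have c4: "ends X ?c4 (1 + (1 + 1 + 1)) (I (Suc j)) ?u3 zs"
        by (rule ends_Set_Seq[OF _ _ _ b(4) c5]) (use e4 in simp_all)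
      have c3: "ends X ?c3 (1 + (1 + (1 + 1 + 1))) (I (Suc j)) ?u2 zs"
        by (rule ends_Set_Seq[OF _ _ _ b(3) c4]) (use e3 in simp_all)
      have c2: "ends X ?c2 (1 + (1 + (1 + (1 + 1 + 1)))) (I (Suc j)) ?u1 zs"
        by (rule ends_Set_Seq[OF _ _ _ b(2) c3]) (use e2 in simp_all)
      have "ends X (check_step B d k) (1 + (1 + (1 + (1 + (1 + 1 + 1))))) (I (Suc j)) u zs"
        unfolding check_step_def by (rule ends_Set_Seq[OF _ _ _ b(1) c2]) (use e1 in simp_all)
      then have "ends X (check_step B d k) 7 (I (Suc j)) u zs" by (rule ends_mono) auto
      with guard show "data_exp u (at_most W TOP) \<and>
        0 < ev u (at_most W TOP) \<and> ends X (check_step B d k) 7 (I (Suc j)) u zs" by simp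
    next
      fix u zs assume I: "I n u zs"
      have "1 \<le> int B ^ n" using B by simp
      moreover have "2 * int B ^ n \<le> int B * int B ^ n" using B by (intro mult_right_mono) auto
      ultimately have "16 * int B ^ n + 1 \<le> 16 * int B ^ Suc n" by simp
      then show "data_exp u (at_most W TOP) \<and> \<not> 0 < ev u (at_most W TOP) \<and>
        J (pre @ [(c, f)]) u zs \<and> same_levels 0 t u"
        using I s by (auto simp: I_def J_def good_def)
    qed
    moreover have "I 0 (t(W := 16 * int B)) ys"
      using J by (auto simp: I_def J_def same_levels_def)
    ultimately show ?thesis
      unfolding check_body_def
      using pow[of 1] by (intro ends_Seq ends_Assign) auto
  qed
  have tr: "ends X (traverse B (check_body B d) d) (nest_time (1 + (n * (7 + 1) + 1)) n d + 4) (J (visits B d n 0 0 1)) (s(OK := 1)) xs"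
  proof (rule ends_traverse[where J = J])
    show "J vs s' xs" if "J vs s xs" "\<And>i. \<not> is_level i \<Longrightarrow> s' i = s i" for vs s s' xs
      using that by (simp add: J_def)
    show "ends X (check_body B d k) (1 + (n * (7 + 1) + 1)) (\<lambda>s' xs'. J (pre @ [(c, f)]) s' xs' \<and> same_levels 0 s s') s xs"
      if "visits B d n 0 0 1 = pre @ (c, f) # post" "J pre s xs" "s (cod k) = int (mem c)" "s (fac k) = int f"
      for pre c f post k s xs
      by (rule body) (use that V in auto)
    show "int (mem c) \<le> X \<and> int f \<le> X" if "(c, f) \<in> set (visits B d n 0 0 1)" for c f
      using V_bound[of c f] that V mem_mono[of c "c + B ^ n"] by auto
  qed (use B X s in \<open>auto simp: J_def\<close>)
  have "ends X (Set_to OK (Num 1) ;; traverse B (check_body B d) d)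
      (1 + (nest_time (1 + (n * (7 + 1) + 1)) n d + 4)) (J (visits B d n 0 0 1)) s xs"
    using X1 tr by (intro ends_Seq ends_Assign) auto
  then show ?thesis
    by (rule ends_mono) (auto simp: J_def V good_def holds_def eval_nat_numeral)
qed

lemma ends_load:
  assumes "\<And>c. \<bar>s (mem c)\<bar> \<le> X" and "int (mem (k * q)) \<le> X" and "s IW = 16 * int q"
  shows "ends X (load_com k) (2 * Suc k)
    (\<lambda>s' xs'. s' IW = s IW \<and> s' OK = s OK \<and> (\<forall>c. s' (mem c) = s (mem c)) \<and> (\<forall>i\<le>k. s' (tv i) = s (mem (i * q)))) s xs"
  using assms(2)
proof (induction k)
  case 0
  have "ends X (load_com 0) (1 + 1)
    (\<lambda>s' xs'. s' IW = s IW \<and> s' OK = s OK \<and> (\<forall>c. s' (mem c) = s (mem c)) \<and> (\<forall>i\<le>0. s' (tv i) = s (mem (i * q)))) s xs"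
    unfolding load_com.simps using 0 assms(1) by (intro ends_Seq ends_Assign) auto
  then show ?case by (rule ends_mono) auto
next
  case (Suc k)
  have "int (mem (k * q)) \<le> X" using Suc.prems mem_mono[of "k * q" "Suc k * q"] by simp
  note IH = Suc.IH[OF this]
  have e: "int (mem 0) + int (Suc k) * (16 * int q) = int (mem (Suc k * q))"
    by (simp add: reg_def algebra_simps)
  have "ends X (load_com (Suc k)) (2 * Suc k + (1 + 1))
    (\<lambda>s' xs'. s' IW = s IW \<and> s' OK = s OK \<and> (\<forall>c. s' (mem c) = s (mem c)) \<and> (\<forall>i\<le>Suc k. s' (tv i) = s (mem (i * q)))) s xs"
    unfolding load_com.simps
  proof (rule ends_Seq, rule ends_mono[OF IH order_refl], elim conjE)
    fix t ys assume t: "t IW = s IW" "t OK = s OK" "\<forall>c. t (mem c) = s (mem c)" "\<forall>i\<le>k. t (tv i) = s (mem (i * q))"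
    have e': "ev t (Plus (Num (int (mem 0))) (Times (Num (int (Suc k))) (R IW))) = int (mem (Suc k * q))"
      using t(1) assms(3) e by simp
    show "ends X (Set_to A1 (Plus (Num (int (mem 0))) (Times (Num (int (Suc k))) (R IW))) ;;
        Set_to (tv (Suc k)) (At A1)) (1 + 1)
      (\<lambda>s' xs'. s' IW = s IW \<and> s' OK = s OK \<and> (\<forall>c. s' (mem c) = s (mem c)) \<and> (\<forall>i\<le>Suc k. s' (tv i) = s (mem (i * q)))) t ys"
    proof (rule ends_Seq, rule ends_Assign, simp, simp)
      show "\<bar>ev t (Plus (Num (int (mem 0))) (Times (Num (int (Suc k))) (R IW)))\<bar> \<le> X"
        unfolding e' using Suc.prems by simp
      show "ends X (Set_to (tv (Suc k)) (At A1)) 1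
        (\<lambda>s' xs'. s' IW = s IW \<and> s' OK = s OK \<and> (\<forall>c. s' (mem c) = s (mem c)) \<and> (\<forall>i\<le>Suc k. s' (tv i) = s (mem (i * q))))
        (t(address t (Reg A1) := ev t (Plus (Num (int (mem 0))) (Times (Num (int (Suc k))) (R IW))))) ys"
        unfolding e' address.simps using t assms(1) by (intro ends_Assign) (auto simp: le_Suc_eq)
    qed
  qed
  then show ?case by (rule ends_mono) auto
qed

section \<open>The decision procedure\<close>

lemma distinct_exponent_vectors: "distinct (exponent_vectors n d)"
proof (induction n arbitrary: d)
  case (Suc n)
  have "distinct (concat (map (\<lambda>k. map ((#) k) (exponent_vectors n (d - k))) ks))" if "distinct ks" for ks
    using that Suc.IH by (induction ks) (auto simp: distinct_map)
  from this[of "[0..<Suc d]"] show ?case by (simp del: upt_Suc)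
qed simp

lemma le_length_exponent_vectors:
  assumes "d > 0"
  shows "n \<le> length (exponent_vectors n d)"
proof -
  have "inj_on var {..<n}" by (rule inj_onI) (metis lookup_single_eq lookup_single_not_eq one_neq_zero)
  then have "n = card (var ` {..<n})" by (simp add: card_image)
  also have "\<dots> \<le> card (monomials n d)"
    by (rule card_mono) (use assms single_in_monomials in auto)
  also have "\<dots> \<le> card (set (exponent_vectors n d))"
    unfolding monomials_eq by (rule card_image_le) simp
  also have "\<dots> \<le> length (exponent_vectors n d)" by (rule card_length)
  finally show ?thesis .
qed

lemma abs_le_power_bits: "\<bar>x\<bar> \<le> 2 ^ bits x"
proof (cases "x = 0")
  case False
  then have "nat \<bar>x\<bar> < 2 ^ floorlog 2 (nat \<bar>x\<bar>)" using floorlog_bounds[of "nat \<bar>x\<bar>" 2] by simp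
  then have "\<bar>x\<bar> < 2 ^ floorlog 2 (nat \<bar>x\<bar>)" by (simp add: nat_less_iff)
  also have "\<dots> \<le> 2 ^ bits x" unfolding bits_def by (intro power_increasing) auto
  finally show ?thesis by simp
qed simp

lemma fact_le_power_nat: "k \<le> d \<Longrightarrow> fact k \<le> (d ^ k :: nat)"
  by (induction k) (auto intro!: mult_mono simp del: mult_Suc)

text \<open>
  Each factorial \<open>k!\<close> is at most \<open>d ^ k\<close>, and the exponents add up to at most \<open>d\<close>.
\<close>

lemma weight_le:
  assumes "ks \<in> set (exponent_vectors n d)" and "0 < d"
  shows "weight 0 ks \<le> d ^ d" and "weight 0 ks \<ge> 1"
proof -
  have d: "sum_list ks \<le> d" using assms by (simp add: set_exponent_vectors)
  have "prod_list (map fact ks) \<le> d ^ sum_list ks \<and> prod_list (map fact ks) \<ge> (1::nat)"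
    if "\<And>k. k \<in> set ks \<Longrightarrow> k \<le> d" for ks
    using that
  proof (induction ks)
    case (Cons k ks)
    then show ?case using fact_le_power_nat[of k d] by (auto simp: power_add mult_mono)
  qed simp
  moreover have "k \<le> d" if "k \<in> set ks" for k using that d member_le_sum_list[of k ks] by linarith
  ultimately have "weight 0 ks \<le> d ^ sum_list ks" "weight 0 ks \<ge> 1" unfolding weight_0 by blast+
  moreover have "d ^ sum_list ks \<le> d ^ d" using d assms(2) by (intro power_increasing) auto
  ultimately show "weight 0 ks \<le> d ^ d" "weight 0 ks \<ge> 1" by linarith+
qed

lemma weight_eq_monomial_fact: "weight 0 (map (expo m) [0..<n]) = monomial_fact n m"
  unfolding weight_0 monomial_fact_def by (induction n) (auto simp: mult.commute)

text \<open>
  The derivative of the polynomial on the axis, multiplied by \<open>e!\<close> to make its coefficients integral.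
\<close>

definition derivative_exps :: "nat \<Rightarrow> exp list" where
  "derivative_exps e =
     map (\<lambda>k. Times (Num (int (fact e div fact k))) (R (tv (Suc k)))) (rev [0..<Suc e])"

lemma epoly_rev: "epoly s (map g (rev [0..<m])) = (\<Sum>k<m. monom (real_of_int (ev s (g k))) k)"
  by (induction m) auto

lemma poly_derivative_exps:
  "poly (epoly s (derivative_exps e)) t = fact e * (\<Sum>k\<le>e. real_of_int (s (tv (Suc k))) / fact k * t ^ k)"
proof -
  have "real (fact e div fact k) = fact e / fact k" if "k \<le> e" for k
    using that by (simp add: real_of_nat_div fact_dvd)
  then have "poly (epoly s (derivative_exps e)) t =
      (\<Sum>k\<le>e. fact e * (real_of_int (s (tv (Suc k))) / fact k * t ^ k))"
    unfolding derivative_exps_def epoly_rev lessThan_Suc_atMost poly_sum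
    by (intro sum.cong) (auto simp: poly_monom)
  then show ?thesis by (simp add: sum_distrib_left)
qed

lemma no_root_tree:
  obtains t where "static_tree t"
    "\<And>s. outcome s t \<longleftrightarrow> (\<forall>x. (\<Sum>k\<le>e. real_of_int (s (tv (Suc k))) / fact k * x ^ k) \<noteq> 0)"
proof -
  have "list_all static_exp (derivative_exps e)" by (auto simp: derivative_exps_def list_all_iff)
  from decidable_no_real_root[OF this] obtain t where
    "static_tree t" "\<And>s. outcome s t \<longleftrightarrow> (\<forall>x. poly (epoly s (derivative_exps e)) x \<noteq> 0)"
    unfolding decidable_by_tree_def by blast
  with that show ?thesis unfolding poly_derivative_exps by simp
qed

definition program_com :: "nat \<Rightarrow> nat \<Rightarrow> bool tree \<Rightarrow> com" where
  "program_com B e t = init_com B ;; traverse B read_body (Suc e) ;; find_com B (Suc e) ;;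
     (Set_to OK (Num 1) ;; traverse B (check_body B e) e) ;; load_com (Suc e) ;; tree_com t ;;
     Set_to RES (Times (R RES) (Times (R OK) (R IW)))"

text \<open>
  The bound \<open>64 * B ^ Suc n\<close> covers all addresses: codes are less than \<open>B ^ Suc n\<close>, and the program
  exceeds them by at most one weight. The other bounds are for \<open>n\<close>, for the products of factorials and
  for their products with the coefficients.
\<close>

lemma ends_program:
  fixes e n :: nat and p :: int_mpoly
  assumes e: "even e" and B: "B = 2 ^ Suc (Suc e)"
    and p: "variables p \<subseteq> {..<n}" "total_degree p = Suc e"
    and t: "static_tree t"
      "\<And>s. outcome s t \<longleftrightarrow> (\<forall>x. (\<Sum>k\<le>e. real_of_int (s (tv (Suc k))) / fact k * x ^ k) \<noteq> 0)"
    and X: "64 * int B ^ Suc n \<le> X" "int n \<le> X"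
    and c_bound: "\<And>ks. ks \<in> set (exponent_vectors n (Suc e)) \<Longrightarrow>
      \<bar>Poly_Mapping.lookup p (Poly_Mapping.nth ks)\<bar> * int (Suc e ^ Suc e) \<le> X"
    and fX: "int (Suc e ^ Suc e) \<le> X"
  shows "ends X (program_com B e t)
    ((n * 3 + 4) + ((nest_time 2 n (Suc e) + 4) + ((n * 5 + 3) + ((nest_time (n * 8 + 2) n e + 5) +
      (2 * Suc (Suc e) + (tree_height t + 1))))))
    (\<lambda>s xs. s RES > 0 \<longleftrightarrow> pseudoconvex n (eval_mpoly p)) (\<lambda>_. 0) (encode (Suc e) n p)"
proof -
  let ?out = "Set_to RES (Times (R RES) (Times (R OK) (R IW)))"
  let ?tree = "tree_com t ;; ?out" and ?tree_time = "tree_height t + 1"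
  let ?load = "load_com (Suc e) ;; ?tree" and ?load_time = "2 * Suc (Suc e) + ?tree_time"
  let ?check = "(Set_to OK (Num 1) ;; traverse B (check_body B e) e) ;; ?load"
    and ?check_time = "(nest_time (n * 8 + 2) n e + 5) + ?load_time"
  let ?find = "find_com B (Suc e) ;; ?check" and ?find_time = "(n * 5 + 3) + ?check_time"
  define d where "d = Suc e"
  define cs where "cs = map (\<lambda>ks. Poly_Mapping.lookup p (Poly_Mapping.nth ks)) (exponent_vectors n d)"
  define V where "V = visits B d n 0 0 1"
  define V' where "V' = visits B e n 0 0 1"
  have V: "V = map (\<lambda>ks. (list_code B ks, weight 0 ks)) (exponent_vectors n d)"
    and V': "V' = map (\<lambda>ks. (list_code B ks, weight 0 ks)) (exponent_vectors n e)"
    by (simp_all add: V_def V'_def visits_eq)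
  have dB: "d < B" using less_exp[of "Suc (Suc e)"] unfolding B d_def by linarith
  have B2: "B \<ge> 2" unfolding B by simp
  have enc: "encode (Suc e) n p = int n # cs" by (simp add: encode_def cs_def d_def)
  have memX: "int (mem c) \<le> X" if "c \<le> 2 * B ^ Suc n" for c
  proof -
    have "mem c \<le> mem (2 * B ^ Suc n)" using that by (rule mem_mono)
    also have "\<dots> \<le> 64 * B ^ Suc n"
    proof -
      have "1 \<le> B ^ Suc n" using B2 by (intro one_le_power) simp
      then show ?thesis by (simp add: reg_def del: power_Suc)
    qed
    finally have "int (mem c) \<le> int (64 * B ^ Suc n)" by (simp only: of_nat_le_iff)
    also have "\<dots> \<le> X" using X by simp
    finally show ?thesis .
  qed
  have Bn: "B ^ n \<le> B ^ Suc n" using B2 by (intro power_increasing) auto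
  have code_less: "list_code B ks < B ^ Suc n" if "ks \<in> set (exponent_vectors n k)" "k \<le> d" for ks k
  proof -
    have ks: "length ks = n" "sum_list ks \<le> k" using that by (auto simp: set_exponent_vectors)
    have "a < B" if "a \<in> set ks" for a using member_le_sum_list[OF that] ks \<open>k \<le> d\<close> dB by linarith
    then show ?thesis using list_code_less[of ks B] ks B2 by simp
  qed
  have V_bound: "int (mem (c + B ^ n)) \<le> X \<and> int (mem c) \<le> X \<and> int f \<le> X"
    if cf: "(c, f) \<in> set V \<union> set V'" for c f
  proof -
    obtain ks where ks: "ks \<in> set (exponent_vectors n d)" "c = list_code B ks" "f = weight 0 ks"
    proof -
      have "set (exponent_vectors n e) \<subseteq> set (exponent_vectors n d)"
        by (auto simp: set_exponent_vectors d_def)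
      then have "(c, f) \<in> (\<lambda>ks. (list_code B ks, weight 0 ks)) ` set (exponent_vectors n d)"
        using cf unfolding V V' set_map by blast
      then show ?thesis using that by blast
    qed
    have "int f \<le> int (Suc e ^ Suc e)" using weight_le(1)[OF ks(1)] unfolding ks(3) d_def by (simp only: of_nat_le_iff)
    moreover have "c < B ^ Suc n" using code_less[OF ks(1)] ks(2) by simp
    then have "c + B ^ n \<le> 2 * B ^ Suc n" "c \<le> 2 * B ^ Suc n" using Bn by linarith+
    ultimately show ?thesis using memX fX by (meson order_trans)
  qed
  have dBn: "d * B ^ n \<le> B ^ Suc n" using dB by simp
  have dX: "int (mem (d * B ^ n)) \<le> X" by (rule memX) (use dBn in linarith)
  have B_pos: "1 \<le> int B ^ Suc n" using B2 by (intro one_le_power) simp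
  then have X16: "16 * int B ^ Suc n \<le> X" using X(1) by linarith
  have pow_X: "16 * int B ^ n \<le> X"
  proof -
    have "int B ^ n \<le> int B ^ Suc n" using B2 by (intro power_increasing) auto
    with X16 show ?thesis by linarith
  qed
  have "X \<ge> 1" using X16 B_pos by linarith
  have dist: "distinct (map fst V)"
  proof -
    have "inj_on (list_code B) (set (exponent_vectors n d))"
    proof (rule inj_onI, rule list_code_inject)
      fix ks ls assume kl: "ks \<in> set (exponent_vectors n d)" "ls \<in> set (exponent_vectors n d)"
      then show "length ks = length ls" by (simp add: set_exponent_vectors)
      show "k < B" if "k \<in> set ks" for k
        using member_le_sum_list[OF that] kl(1) dB by (auto simp: set_exponent_vectors)
      show "k < B" if "k \<in> set ls" for k
        using member_le_sum_list[OF that] kl(2) dB by (auto simp: set_exponent_vectors)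
    qed
    then show ?thesis by (simp add: V comp_def distinct_map distinct_exponent_vectors)
  qed
  define T where "T m = taylor n p m" for m
  define filled where "filled s \<longleftrightarrow> (\<forall>m\<in>monomials n d. s (mem (code_of B n m)) = T m)" for s :: registers
  have filledI: "filled s" if "\<forall>i<length V. s (mem (fst (V ! i))) = cs ! i * int (snd (V ! i))" for s
    unfolding filled_def
  proof
    fix m assume m: "m \<in> monomials n d"
    let ?ks = "map (expo m) [0..<n]"
    from nth_exponents[OF m] obtain i where i: "i < length (exponent_vectors n d)" "exponent_vectors n d ! i = ?ks"
      by (auto simp: in_set_conv_nth)
    have Vi: "V ! i = (code_of B n m, monomial_fact n m)"
      using i by (simp add: V code_of_eq_list_code weight_eq_monomial_fact)
    have "cs ! i = Poly_Mapping.lookup p m" using i nth_exponents(2)[OF m] by (simp add: cs_def)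
    with Vi that i show "s (mem (code_of B n m)) = T m" by (auto simp: T_def taylor_def V)
  qed
  have top_code: "s (mem (k * B ^ (n - i))) = T (Poly_Mapping.single i k)" if "filled s" "i < n" "k \<le> d" for s i k
    using that single_in_monomials[of i n k d] code_of_single[of i n B k] by (auto simp: filled_def)
  define result where "result s \<longleftrightarrow> (s RES > 0 \<longleftrightarrow> pseudoconvex n (eval_mpoly p))" for s :: registers
  \<comment> \<open>The variable \<open>i\<close> has weight \<open>B ^ (n - i)\<close>.\<close>
  have dir: "(\<forall>(c, f)\<in>set V'. \<forall>j\<in>{1..n}. s (mem (c + B ^ j)) * s (mem (d * B ^ (n - i))) =
      s (mem (c + B ^ (n - i))) * s (mem (e * B ^ (n - i) + B ^ j))) \<longleftrightarrow> single_direction n e p i"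
    if s: "filled s" and i: "i < n" for s i
  proof -
    have each: "s (mem (code_of B n m + B ^ (n - j))) * s (mem (d * B ^ (n - i))) =
        s (mem (code_of B n m + B ^ (n - i))) * s (mem (e * B ^ (n - i) + B ^ (n - j))) \<longleftrightarrow>
        T (m + var j) * T (Poly_Mapping.single i d) = T (m + var i) * T (Poly_Mapping.single i e + var j)"
      if m: "m \<in> monomials n e" and j: "j < n" for m j
    proof -
      have add: "s (mem (code_of B n m' + B ^ (n - k))) = T (m' + var k)" if "m' \<in> monomials n e" "k < n" for m' k
        using s add_var_in_monomials[OF that(2,1)] code_of_single[OF that(2), of B 1]
        by (auto simp: filled_def d_def code_of_add)
      have "e * B ^ (n - i) = code_of B n (Poly_Mapping.single i e)" using code_of_single[OF i] by simp
      then have "s (mem (e * B ^ (n - i) + B ^ (n - j))) = T (Poly_Mapping.single i e + var j)"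
        using add[OF single_in_monomials[OF i order_refl] j] by simp
      then show ?thesis using add[OF m j] add[OF m i] top_code[OF s i, of d] by simp
    qed
    have codes: "(\<forall>(c, f)\<in>set V'. P c) \<longleftrightarrow> (\<forall>m\<in>monomials n e. P (code_of B n m))" for P
    proof -
      have "(\<forall>(c, f)\<in>set V'. P c) \<longleftrightarrow> (\<forall>ks\<in>set (exponent_vectors n e). P (list_code B ks))"
        by (auto simp: V')
      also have "\<dots> \<longleftrightarrow> (\<forall>m\<in>monomials n e. P (code_of B n m))"
      proof (intro iffI ballI)
        fix m assume "\<forall>ks\<in>set (exponent_vectors n e). P (list_code B ks)" "m \<in> monomials n e"
        then show "P (code_of B n m)" using nth_exponents(1) by (metis code_of_eq_list_code)
      next
        fix ks assume a: "\<forall>m\<in>monomials n e. P (code_of B n m)" and ks: "ks \<in> set (exponent_vectors n e)"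
        have "map (expo (Poly_Mapping.nth ks)) [0..<n] = ks"
          using ks by (intro nth_equalityI) (auto simp: set_exponent_vectors nth_default_def)
        then show "P (list_code B ks)" using a nth_in_monomials[OF ks] by (metis code_of_eq_list_code)
      qed
      finally show ?thesis .
    qed
    have index: "(\<forall>j\<in>{1..n}. P (B ^ j)) \<longleftrightarrow> (\<forall>j<n. P (B ^ (n - j)))" for P
    proof (intro iffI allI ballI impI)
      fix j assume P: "\<forall>j<n. P (B ^ (n - j))" and "j \<in> {1..n}"
      then have "n - j < n" "n - (n - j) = j" by auto
      with P show "P (B ^ j)" by metis
    qed auto
    define G where "G m x \<longleftrightarrow> s (mem (code_of B n m + x)) * s (mem (d * B ^ (n - i))) =
        s (mem (code_of B n m + B ^ (n - i))) * s (mem (e * B ^ (n - i) + x))" for m x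
    have "(\<forall>(c, f)\<in>set V'. \<forall>j\<in>{1..n}. s (mem (c + B ^ j)) * s (mem (d * B ^ (n - i))) =
        s (mem (c + B ^ (n - i))) * s (mem (e * B ^ (n - i) + B ^ j))) \<longleftrightarrow>
        (\<forall>m\<in>monomials n e. \<forall>j\<in>{1..n}. G m (B ^ j))"
      unfolding codes G_def ..
    also have "\<dots> \<longleftrightarrow> (\<forall>m\<in>monomials n e. \<forall>j<n. G m (B ^ (n - j)))"
      by (rule ball_cong[OF refl index])
    also have "\<dots> \<longleftrightarrow> single_direction n e p i"
      using each unfolding single_direction_def G_def T_def d_def by blast
    finally show ?thesis .
  qed
  have c_bounds: "\<bar>cs ! i\<bar> \<le> X \<and> \<bar>cs ! i * int (snd (V ! i))\<bar> \<le> X" if "i < length V" for i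
  proof -
    let ?ks = "exponent_vectors n d ! i"
    have i: "i < length (exponent_vectors n d)" using that by (simp add: V)
    then have ks: "?ks \<in> set (exponent_vectors n d)" by simp
    have ci: "cs ! i = Poly_Mapping.lookup p (Poly_Mapping.nth ?ks)" "snd (V ! i) = weight 0 ?ks"
      using i by (auto simp: cs_def V)
    have le: "\<bar>cs ! i\<bar> * int (Suc e ^ Suc e) \<le> X" using c_bound[of ?ks] ks unfolding ci d_def by blast
    have w: "int (weight 0 ?ks) \<le> int (Suc e ^ Suc e)" "1 \<le> int (weight 0 ?ks)"
      using weight_le[OF ks] unfolding d_def of_nat_le_iff by auto
    have "\<bar>cs ! i\<bar> * int (weight 0 ?ks) \<le> \<bar>cs ! i\<bar> * int (Suc e ^ Suc e)" using w by (intro mult_left_mono) auto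
    moreover have "\<bar>cs ! i\<bar> * 1 \<le> \<bar>cs ! i\<bar> * int (weight 0 ?ks)" using w by (intro mult_left_mono) auto
    ultimately show ?thesis using le by (auto simp: ci(2) abs_mult)
  qed
  have last: "ends X ?out 1 (\<lambda>s xs. result s) s xs"
    if "s RES \<in> {0, 1}" "s OK \<in> {0, 1}" "0 \<le> s IW" "s IW \<le> X"
      and "s RES = 1 \<and> s OK = 1 \<and> s IW > 0 \<longleftrightarrow> pseudoconvex n (eval_mpoly p)" for s xs
    using that \<open>X \<ge> 1\<close> by (intro ends_Assign) (auto simp: result_def)
  have after_find: "ends X ?check
      ?check_time (\<lambda>s xs. result s) s xs"
    if s: "s TOP = 16 * int B ^ n" "filled s" "bounded_by X s"
      and IW: "s IW = 0 \<and> (\<forall>j\<in>{1..n}. s (mem (d * B ^ j)) = 0) \<or>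
       (\<exists>j\<in>{1..n}. s IW = 16 * int B ^ j \<and> s (mem (d * B ^ j)) \<noteq> 0)" for s xs
  proof -
    obtain q where q: "s IW = 16 * int q" "q \<le> B ^ n"
      and cases: "q = 0 \<and> (\<forall>i<n. T (Poly_Mapping.single i d) = 0) \<or>
        (\<exists>i<n. q = B ^ (n - i) \<and> T (Poly_Mapping.single i d) \<noteq> 0)"
    proof (cases "s IW = 0 \<and> (\<forall>j\<in>{1..n}. s (mem (d * B ^ j)) = 0)")
      case True
      have "T (Poly_Mapping.single i d) = 0" if "i < n" for i
        using True top_code[OF s(2) that, of d] that by auto
      then show ?thesis using that[of 0] True by auto
    next
      case False
      then obtain j where j: "j \<in> {1..n}" "s IW = 16 * int B ^ j" "s (mem (d * B ^ j)) \<noteq> 0" using IW by blast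
      have "n - j < n" "B ^ (n - (n - j)) = B ^ j" using j(1) by auto
      moreover from this have "T (Poly_Mapping.single (n - j) d) \<noteq> 0" using top_code[OF s(2), of "n - j" d] j(3) by simp
      moreover have "B ^ j \<le> B ^ n" using j(1) B2 by (intro power_increasing) auto
      ultimately show ?thesis using that[of "B ^ j"] j(2) by (metis of_nat_power)
    qed
    define good where "good \<longleftrightarrow> (\<forall>(c, f)\<in>set V'. \<forall>j\<in>{1..n}.
        s (mem (c + B ^ j)) * s (mem (Suc e * q)) = s (mem (c + q)) * s (mem (e * q + B ^ j)))"
    have check: "ends X (Set_to OK (Num 1) ;; traverse B (check_body B e) e) (nest_time (n * 8 + 2) n e + 5)
      (\<lambda>s' xs'. (s' IW = s IW \<and> (\<forall>c. s' (mem c) = s (mem c)) \<and> s' OK = of_bool good) \<and> bounded_by X s') s xs"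
      unfolding good_def
    proof (rule ends_bounded[OF ends_check[OF B2 V'_def _ X16 _ q(2) s(1) q(1)] s(3)])
      show "int (mem (Suc e * B ^ n)) \<le> X" using dX by (simp only: d_def)
      show "int (mem (c + B ^ n)) \<le> X \<and> int f \<le> X" if "(c, f) \<in> set V'" for c f
        using V_bound[of c f] that by blast
    qed
    have final: "ends X ?out 1 (\<lambda>s xs. result s)
        (u(RES := if outcome u t then 1 else 0)) ys"
      if u: "u IW = s IW" "u OK = of_bool good" "\<forall>i\<le>d. u (tv i) = s (mem (i * q))" for u ys
    proof (rule last)
      let ?u = "u(RES := if outcome u t then 1 else 0)"
      show "?u RES \<in> {0, 1}" "?u OK \<in> {0, 1}" using u by auto
      show "0 \<le> ?u IW" using u q by simp
      have "int q \<le> int (B ^ n)" using q(2) by (simp only: of_nat_le_iff)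
      then have "16 * int q \<le> X" using pow_X unfolding of_nat_power by linarith
      then show "?u IW \<le> X" using u(1) q(1) by simp
      show "?u RES = 1 \<and> ?u OK = 1 \<and> ?u IW > 0 \<longleftrightarrow> pseudoconvex n (eval_mpoly p)"
      proof (cases "q = 0")
        case True
        then have "\<forall>i<n. T (Poly_Mapping.single i d) = 0" using cases B2 by auto
        then have "\<not> pseudoconvex n (eval_mpoly p)"
          using pseudoconvex_imp_test(1)[OF _ p e] by (auto simp: T_def d_def)
        then show ?thesis using True u q by simp
      next
        case False
        then obtain i where i: "i < n" "q = B ^ (n - i)" "T (Poly_Mapping.single i d) \<noteq> 0" using cases by blast
        have "good \<longleftrightarrow> single_direction n e p i"
          using dir[OF s(2) i(1)] unfolding good_def i(2) d_def by simp
        moreover have "u (tv (Suc k)) = T (Poly_Mapping.single i (Suc k))" if "k \<le> e" for k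
          using u(3) top_code[OF s(2) i(1), of "Suc k"] that by (simp add: i(2) d_def del: mult_Suc)
        then have "outcome u t \<longleftrightarrow> no_critical_point n e p i"
          unfolding t(2) no_critical_point_def by (simp add: T_def)
        moreover have "pseudoconvex n (eval_mpoly p) \<longleftrightarrow> single_direction n e p i \<and> no_critical_point n e p i"
          using pseudoconvex_imp_test(2)[OF _ p e i(1)] test_imp_pseudoconvex[OF p(1) _ i(1)] p(2) i(3)
          by (auto simp: T_def d_def)
        ultimately show ?thesis using u q False by auto
      qed
    qed
    show ?thesis
    proof (rule ends_Seq, rule ends_mono[OF check order_refl], elim conjE)
      fix u ys assume u: "u IW = s IW" "\<forall>c. u (mem c) = s (mem c)" "u OK = of_bool good" "bounded_by X u"
      have "d * q \<le> d * B ^ n" using q(2) by simp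
      then have "int (mem (d * q)) \<le> X" using mem_mono[of "d * q" "d * B ^ n"] dX by linarith
      then have load: "ends X (load_com d) (2 * Suc d) (\<lambda>s' xs'. s' IW = u IW \<and> s' OK = u OK \<and>
          (\<forall>c. s' (mem c) = u (mem c)) \<and> (\<forall>i\<le>d. s' (tv i) = u (mem (i * q)))) u ys"
        using u(1,4) q(1) by (intro ends_load) (auto simp: bounded_by_def)
      show "ends X ?load
        ?load_time (\<lambda>s xs. result s) u ys"
      proof (rule ends_Seq, rule ends_mono[OF load[unfolded d_def] order_refl], elim conjE)
        fix v zs assume v: "v IW = u IW" "v OK = u OK" "\<forall>i\<le>Suc e. v (tv i) = u (mem (i * q))"
        show "ends X ?tree ?tree_time (\<lambda>s xs. result s) v zs"
        proof (rule ends_Seq, rule ends_mono[OF ends_tree[OF \<open>X \<ge> 1\<close> t(1)] order_refl])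
          fix w zs' assume "w = v(RES := if outcome v t then 1 else 0)"
          then show "ends X ?out 1 (\<lambda>s xs. result s) w zs'"
            using final[of v zs'] u v by (simp add: d_def)
        qed
      qed
    qed
  qed
  have zero: "bounded_by X (\<lambda>_. 0)" using \<open>X \<ge> 1\<close> by (simp add: bounded_by_def)
  show ?thesis
    unfolding program_com_def enc result_def[symmetric]
  proof (rule ends_Seq, rule ends_mono[OF ends_bounded[OF ends_init[OF X(2) pow_X B2, where cs = cs] zero] order_refl], elim conjE)
    fix s xs assume s: "s TOP = 16 * int B ^ n" "xs = cs" "bounded_by X s"
    have len: "length cs = length V" by (simp add: cs_def V)
    have read: "ends X (traverse B read_body (Suc e)) (nest_time 2 n (Suc e) + 4)
      (\<lambda>s' xs'. (s' TOP = 16 * int B ^ n \<and> (\<forall>i<length V. s' (mem (fst (V ! i))) = cs ! i * int (snd (V ! i)))) \<and> bounded_by X s') s cs"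
      unfolding d_def[symmetric]
    proof (rule ends_bounded[OF ends_read[where V = V] s(3)])
      show "int (mem c) \<le> X \<and> int f \<le> X" if "(c, f) \<in> set V" for c f
        using V_bound[of c f] that by blast
      show "\<bar>cs ! i\<bar> \<le> X \<and> \<bar>cs ! i * int (snd (V ! i))\<bar> \<le> X" if "i < length V" for i
        using that by (rule c_bounds)
    qed (fact B2 X16 V_def dist len s(1))+
    show "ends X (traverse B read_body (Suc e) ;; ?find)
      ((nest_time 2 n (Suc e) + 4) + ?find_time) (\<lambda>s xs. result s) s xs"
      unfolding s(2)
    proof (rule ends_Seq, rule ends_mono[OF read order_refl], elim conjE)
      fix u ys assume u: "u TOP = 16 * int B ^ n" "bounded_by X u"
        "\<forall>i<length V. u (mem (fst (V ! i))) = cs ! i * int (snd (V ! i))"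
      note find = ends_bounded[OF ends_find[where s = u and xs = ys, OF B2 X16 dX u(1)] u(2)]
      show "ends X ?find
        ?find_time (\<lambda>s xs. result s) u ys"
      proof (rule ends_Seq, rule ends_mono[OF find[unfolded d_def] order_refl])
        fix v zs
        assume v: "(v TOP = u TOP \<and> (\<forall>c. v (mem c) = u (mem c)) \<and>
          (v IW = 0 \<and> (\<forall>j\<in>{1..n}. u (mem (Suc e * B ^ j)) = 0) \<or>
          (\<exists>j\<in>{1..n}. v IW = 16 * int B ^ j \<and> u (mem (Suc e * B ^ j)) \<noteq> 0))) \<and> bounded_by X v"
        have "filled v" using filledI[OF u(3)] v by (simp add: filled_def)
        then show "ends X ?check
          ?check_time (\<lambda>s xs. result s) v zs"
          using v u(1) by (intro after_find) (auto simp: d_def)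
      qed
    qed
  qed
qed

primrec nest_poly :: "nat poly \<Rightarrow> nat \<Rightarrow> nat poly" where
  "nest_poly q 0 = q"
| "nest_poly q (Suc k) = q + [:0, 1:] * (nest_poly q k + [:6:]) + [:2:]"

lemma poly_nest_poly: "poly (nest_poly q k) N = nest_time (poly q N) N k"
  by (induction k) (auto simp: algebra_simps)

lemma nest_time_mono: "K \<le> K' \<Longrightarrow> n \<le> n' \<Longrightarrow> nest_time K n k \<le> nest_time K' n' k"
  by (induction k) (auto intro!: add_mono mult_mono)

text \<open>
  The input contains more than \<open>n\<close> numbers, so the bounds on time and on the size of the values, which
  are polynomial in \<open>n\<close> and the length of the coefficients, are polynomial in the length \<open>N\<close> of the input.
\<close>

theorem corollary4p9:
  fixes d :: nat
  assumes "odd d"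
  shows "\<exists>P. poly_time_decides P
           {(n, p). variables p \<subseteq> {..<n} \<and> total_degree p = d}
           (\<lambda>(n, p). encode d n p)
           (\<lambda>(n, p). pseudoconvex n (eval_mpoly p))"
proof -
  obtain e where d: "d = Suc e" and e: "even e" using assms by (cases d) auto
  define B :: nat where "B = 2 ^ Suc (Suc e)"
  obtain t where t: "static_tree t"
    "\<And>s. outcome s t \<longleftrightarrow> (\<forall>x. (\<Sum>k\<le>e. real_of_int (s (tv (Suc k))) / fact k * x ^ k) \<noteq> 0)"
    by (rule no_root_tree[of e]) (rule that)
  define size :: "nat poly" where
    "size = [:6 + Suc (Suc e) + Suc (Suc e) * d:] + [:0, Suc (Suc e) + 1:]"
  define time :: "nat poly" where
    "time = ([:0, 3:] + [:4:]) + ((nest_poly [:2:] (Suc e) + [:4:]) + (([:0, 5:] + [:3:]) +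
      ((nest_poly ([:0, 8:] + [:2:]) e + [:5:]) + ([:2 * Suc (Suc e):] + [:tree_height t + 1:]))))"
  show ?thesis
  proof (rule poly_time_decides_by_com[where res = RES and size = size and time = time and c = "program_com B e t"])
    show "data RES" by simp
    show "1 \<le> poly size N" for N by (simp add: size_def)
    fix x :: "nat \<times> int_mpoly"
    assume "x \<in> {(n, p). variables p \<subseteq> {..<n} \<and> total_degree p = d}"
    then obtain n p where x: "x = (n, p)" and p: "variables p \<subseteq> {..<n}" "total_degree p = d" by blast
    define N where "N = (\<Sum>a\<leftarrow>encode d n p. bits a)"
    define X :: int where "X = 2 ^ poly size N"
    \<comment> \<open>Here \<open>n \<le> N\<close>, the coefficients are at most \<open>2 ^ N\<close>, and the factorials contribute at most \<open>B ^ d\<close>.\<close>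
    have X: "X = 64 * int B ^ Suc N * int B ^ d * 2 ^ N"
    proof -
      define b where "b = Suc (Suc e)"
      have "int B ^ k = 2 ^ (b * k)" for k by (simp only: B_def of_nat_power of_nat_numeral power_mult b_def)
      moreover have "poly size N = 6 + b * Suc N + b * d + N" by (simp add: size_def b_def algebra_simps)
      then have "X = 2 ^ 6 * 2 ^ (b * Suc N) * 2 ^ (b * d) * 2 ^ N" by (simp only: X_def power_add)
      ultimately show ?thesis by (simp del: power_Suc mult_Suc_right)
    qed
    have len: "length xs \<le> (\<Sum>a\<leftarrow>xs. bits a)" for xs :: "int list"
    proof (induction xs)
      case (Cons a xs)
      then show ?case using bits_pos[of a] by simp
    qed simp
    have nN: "n \<le> N"
      using len[of "encode d n p"] le_length_exponent_vectors[of d n] d by (simp add: N_def encode_def)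
    have B1: "1 \<le> int B" unfolding B_def of_nat_power by (intro one_le_power) simp
    have pos: "1 \<le> int B ^ Suc N" "1 \<le> int B ^ d" "(1::int) \<le> 2 ^ N" using B1 by (auto simp: one_le_power simp del: power_Suc)
    have prod_le: "a \<le> a * b" if "0 \<le> a" "1 \<le> b" for a b :: int
      using mult_left_mono[of 1 b a] that by simp
    have prod_le': "a \<le> b * a" if "0 \<le> a" "1 \<le> b" for a b :: int
      using prod_le[OF that] by (simp only: mult.commute)
    have X64: "64 * int B ^ Suc N \<le> X"
    proof -
      have "64 * int B ^ Suc N \<le> 64 * int B ^ Suc N * int B ^ d" using pos by (intro prod_le) auto
      also have "\<dots> \<le> X" unfolding X using pos by (intro prod_le) auto
      finally show ?thesis .
    qed
    have XN: "int B ^ d * 2 ^ N \<le> X"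
    proof -
      have "int B ^ d * 2 ^ N \<le> (64 * int B ^ Suc N) * (int B ^ d * 2 ^ N)" using pos by (intro prod_le') auto
      then show ?thesis unfolding X by (simp only: mult.assoc)
    qed
    have dB: "int (Suc e ^ Suc e) \<le> int B ^ d"
    proof -
      have "Suc e \<le> B" using less_exp[of "Suc (Suc e)"] unfolding B_def by linarith
      then have "Suc e ^ Suc e \<le> B ^ Suc e" by (intro power_mono) auto
      then have "int (Suc e ^ Suc e) \<le> int (B ^ Suc e)" by (simp only: of_nat_le_iff)
      then show ?thesis unfolding d by (simp only: of_nat_power)
    qed
    have dX: "int (Suc e ^ Suc e) \<le> X"
    proof -
      have "int B ^ d \<le> int B ^ d * 2 ^ N" using pos by (intro prod_le) auto
      with dB XN show ?thesis by linarith
    qed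
    have nX: "int n \<le> X"
    proof -
      have "int n \<le> 2 ^ N" using nN less_exp[of N] by (metis le_less_trans less_imp_le of_nat_le_numeral_power_cancel_iff)
      also have "\<dots> \<le> int B ^ d * 2 ^ N" using pos by (intro prod_le') auto
      finally show ?thesis using XN by linarith
    qed
    have cX: "\<bar>Poly_Mapping.lookup p (Poly_Mapping.nth ks)\<bar> * int (Suc e ^ Suc e) \<le> X"
      if ks: "ks \<in> set (exponent_vectors n (Suc e))" for ks
    proof -
      let ?a = "Poly_Mapping.lookup p (Poly_Mapping.nth ks)"
      have "?a \<in> set (encode d n p)" using ks by (auto simp: encode_def d)
      then have "bits ?a \<le> N" unfolding N_def by (intro member_le_sum_list) auto
      then have "(2::int) ^ bits ?a \<le> 2 ^ N" by (intro power_increasing) auto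
      then have "\<bar>?a\<bar> \<le> 2 ^ N" using abs_le_power_bits[of ?a] by linarith
      then have "\<bar>?a\<bar> * int (Suc e ^ Suc e) \<le> 2 ^ N * int B ^ d" using dB by (intro mult_mono) auto
      also have "\<dots> \<le> X" using XN by (simp only: mult.commute)
      finally show ?thesis .
    qed
    have "64 * int B ^ Suc n \<le> X"
    proof -
      have "int B ^ Suc n \<le> int B ^ Suc N" using nN B1 by (intro power_increasing) auto
      with X64 show ?thesis by linarith
    qed
    from ends_program[OF e B_def p(1) p(2)[unfolded d] t this nX cX dX]
    obtain k s xs where
      k: "k \<le> (n * 3 + 4) + ((nest_time 2 n (Suc e) + 4) + ((n * 5 + 3) + ((nest_time (n * 8 + 2) n e + 5) +
        (2 * Suc (Suc e) + (tree_height t + 1)))))" and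
      ex: "exec X (program_com B e t) (\<lambda>_. 0, encode d n p) k (s, xs)" and
      s: "s RES > 0 \<longleftrightarrow> pseudoconvex n (eval_mpoly p)"
      unfolding ends_def d by blast
    have "k \<le> (N * 3 + 4) + ((nest_time 2 N (Suc e) + 4) + ((N * 5 + 3) + ((nest_time (N * 8 + 2) N e + 5) +
        (2 * Suc (Suc e) + (tree_height t + 1)))))"
      by (rule order_trans[OF k]) (intro add_mono nest_time_mono mult_right_mono order_refl nN; simp)
    also have "\<dots> = poly time N"
      by (simp add: time_def poly_nest_poly mult.commute del: nest_time.simps nest_poly.simps)
    finally have "k \<le> poly time N" .
    with ex s show "\<exists>k s xs. k \<le> poly time (\<Sum>a\<leftarrow>(case x of (n, p) \<Rightarrow> encode d n p). bits a) \<and>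
      exec (2 ^ poly size (\<Sum>a\<leftarrow>(case x of (n, p) \<Rightarrow> encode d n p). bits a)) (program_com B e t)
        (\<lambda>_. 0, case x of (n, p) \<Rightarrow> encode d n p) k (s, xs) \<and>
      ((case x of (n, p) \<Rightarrow> pseudoconvex n (eval_mpoly p)) \<longleftrightarrow> s RES > 0)"
      unfolding x prod.case N_def[symmetric] X_def[symmetric] by blast
  qed
qed

end
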